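(* Let $a<c<b<d$, let $n\ge 1$ be an integer, and let $f:(a,d)\to\mathbb{R}$ be such that both restrictions $f|_{(a,b)}$ and $f|_{(c,d)}$ are $n$-monotone. Then $f$ is $n$-monotone on $(a,d)$. Likewise, if both $f|_{(a,b)}$ and $f|_{(c,d)}$ are $n$-convex, then $f$ is $n$-convex on $(a,d)$.
   Context: Matrices are ordered by the Loewner order: $A\le B$ iff $B-A$ is positive semidefinite; $f(A)$ is defined by the functional calculus. For an open interval $I$, a function $f:I\to\mathbb{R}$ is $n$-monotone if for all $n\times n$ (complex) Hermitian matrices $A\le B$ with all eigenvalues in $I$ one has $f(A)\le f(B)$. It is $n$-convex if for all $t\in[0,1]$ and all $n\times n$ Hermitian matrices $A,B$ with all eigenvalues in $I$ one has $f(tA+(1-t)B)\le tf(A)+(1-t)f(B)$. *)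

theory Defs
  imports "Jordan_Normal_Form.Schur_Decomposition" "Jordan_Normal_Form.Spectral_Radius"
begin

definition hermitian_mats :: "nat \<Rightarrow> complex mat set" where
  "hermitian_mats n = {A \<in> carrier_mat n n. mat_adjoint A = A}"

definition unitary_mats :: "nat \<Rightarrow> complex mat set" where
  "unitary_mats n = {U \<in> carrier_mat n n. mat_adjoint U * U = 1\<^sub>m n \<and> U * mat_adjoint U = 1\<^sub>m n}"

text \<open>The order on \<^typ>\<open>complex\<close> is that of \<^theory>\<open>HOL-Library.Complex_Order\<close>:
  \<open>0 \<le> z\<close> says that \<open>z\<close> is real and nonnegative.\<close>

definition pos_semidef_mats :: "nat \<Rightarrow> complex mat set" where
  "pos_semidef_mats n = {A \<in> hermitian_mats n. \<forall>v \<in> carrier_vec n. 0 \<le> (A *\<^sub>v v) \<bullet>c v}"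

definition loewner_le :: "nat \<Rightarrow> complex mat \<Rightarrow> complex mat \<Rightarrow> bool" where
  "loewner_le n A B \<longleftrightarrow> A \<in> carrier_mat n n \<and> B \<in> carrier_mat n n \<and> B - A \<in> pos_semidef_mats n"

abbreviation real_diag :: "nat \<Rightarrow> (nat \<Rightarrow> real) \<Rightarrow> complex mat" where
  "real_diag n l \<equiv> mat_diag n (\<lambda>i. complex_of_real (l i))"

text \<open>Functional calculus: \<open>f (U diag(l) U\<^sup>*) = U diag(f l) U\<^sup>*\<close> for \<open>U\<close> unitary and \<open>l\<close> real.
  The lemma \<open>mat_fun_eq\<close> below shows that the value does not depend on the diagonalization.\<close>

definition mat_fun :: "(real \<Rightarrow> real) \<Rightarrow> complex mat \<Rightarrow> complex mat" where
  "mat_fun f A = (THE B. \<exists>U \<in> unitary_mats (dim_row A). \<exists>l.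
     A = U * real_diag (dim_row A) l * mat_adjoint U \<and>
     B = U * real_diag (dim_row A) (\<lambda>i. f (l i)) * mat_adjoint U)"

lemma mat_adjoint_carrier: "A \<in> carrier_mat n m \<Longrightarrow> mat_adjoint A \<in> carrier_mat m n"
  unfolding mat_adjoint_def by auto

lemma real_diag_intertwine:
  assumes W: "W \<in> carrier_mat n n" and eq: "W * real_diag n l = real_diag n k * W"
  shows "W * real_diag n (\<lambda>i. f (l i)) = real_diag n (\<lambda>i. f (k i)) * W"
proof (rule eq_matI)
  fix i j assume "i < dim_row (real_diag n (\<lambda>i. f (k i)) * W)" "j < dim_col (real_diag n (\<lambda>i. f (k i)) * W)"
  then have ij: "i < n" "j < n" using W by (auto simp: mat_diag_def)
  have "(W * real_diag n l) $$ (i,j) = (real_diag n k * W) $$ (i,j)" using eq by simp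
  then have "W $$ (i,j) * complex_of_real (l j) = complex_of_real (k i) * W $$ (i,j)"
    using ij W by (simp add: mat_diag_mult_left[OF W] mat_diag_mult_right[OF W])
  then have "W $$ (i,j) = 0 \<or> l j = k i" by auto
  then show "(W * real_diag n (\<lambda>i. f (l i))) $$ (i,j) = (real_diag n (\<lambda>i. f (k i)) * W) $$ (i,j)"
    using ij W by (auto simp add: mat_diag_mult_left[OF W] mat_diag_mult_right[OF W])
qed (use W in \<open>auto simp: mat_diag_def\<close>)

lemma diagonalization_unique:
  assumes U: "U \<in> unitary_mats n" and V: "V \<in> unitary_mats n"
    and eq: "U * real_diag n l * mat_adjoint U = V * real_diag n k * mat_adjoint V"
  shows "U * real_diag n (\<lambda>i. f (l i)) * mat_adjoint U = V * real_diag n (\<lambda>i. f (k i)) * mat_adjoint V"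
proof -
  define U' V' where "U' = mat_adjoint U" and "V' = mat_adjoint V"
  have c: "U \<in> carrier_mat n n" "V \<in> carrier_mat n n" "U' \<in> carrier_mat n n" "V' \<in> carrier_mat n n"
    using U V mat_adjoint_carrier unfolding unitary_mats_def U'_def V'_def by auto
  have i: "U' * U = 1\<^sub>m n" "U * U' = 1\<^sub>m n" "V' * V = 1\<^sub>m n" "V * V' = 1\<^sub>m n"
    using U V unfolding unitary_mats_def U'_def V'_def by auto
  have mm: "\<And>X Y. X \<in> carrier_mat n n \<Longrightarrow> Y \<in> carrier_mat n n \<Longrightarrow> X * Y \<in> carrier_mat n n"
    by auto
  have as: "\<And>X Y Z. X \<in> carrier_mat n n \<Longrightarrow> Y \<in> carrier_mat n n \<Longrightarrow> Z \<in> carrier_mat n n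
      \<Longrightarrow> (X * Y) * Z = X * (Y * Z)"
    by (rule assoc_mult_mat)
  define D where "D = real_diag n"
  have R: "D g \<in> carrier_mat n n" for g unfolding D_def by simp
  have cancel: "P * (Q * X) = X" if "P * Q = 1\<^sub>m n" "P \<in> carrier_mat n n" "Q \<in> carrier_mat n n"
    "X \<in> carrier_mat n n" for P Q X :: "complex mat"
    using as[of P Q X] that by simp
  note c' = c R mm
  have "U * D l * U' = V * D k * V'"
    using eq unfolding U'_def V'_def D_def .
  then have eq': "U * (D l * U') = V * (D k * V')"
    by (simp only: as c')
  have "V' * (U * (D l * U')) * U = V' * (V * (D k * V')) * U" unfolding eq' ..
  then have "(V' * U) * D l = D k * (V' * U)"
    by (simp only: as c' i cancel right_mult_one_mat[of _ n n])
  then have key: "(V' * U) * D (\<lambda>i. f (l i)) = D (\<lambda>i. f (k i)) * (V' * U)"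
    unfolding D_def by (rule real_diag_intertwine[rotated]) (simp only: c mm)
  have "U * D (\<lambda>i. f (l i)) * U' = V * (((V' * U) * D (\<lambda>i. f (l i))) * U')"
    by (simp only: as c' i cancel)
  also have "\<dots> = V * D (\<lambda>i. f (k i)) * V'"
    unfolding key by (simp only: as c' i cancel right_mult_one_mat[of _ n n])
  finally show ?thesis unfolding U'_def V'_def D_def .
qed

lemma mat_fun_eq:
  assumes U: "U \<in> unitary_mats n" and A: "A = U * real_diag n l * mat_adjoint U"
  shows "mat_fun f A = U * real_diag n (\<lambda>i. f (l i)) * mat_adjoint U"
proof -
  have dim: "dim_row A = n" using U A unfolding unitary_mats_def by auto
  show ?thesis
    unfolding mat_fun_def dim
  proof (rule the_equality)
    show "\<exists>V\<in>unitary_mats n. \<exists>k. A = V * real_diag n k * mat_adjoint V \<and>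
       U * real_diag n (\<lambda>i. f (l i)) * mat_adjoint U = V * real_diag n (\<lambda>i. f (k i)) * mat_adjoint V"
      using U A by blast
  next
    fix B assume "\<exists>V\<in>unitary_mats n. \<exists>k. A = V * real_diag n k * mat_adjoint V \<and>
       B = V * real_diag n (\<lambda>i. f (k i)) * mat_adjoint V"
    then obtain V k where V: "V \<in> unitary_mats n" and Ak: "A = V * real_diag n k * mat_adjoint V"
      and B: "B = V * real_diag n (\<lambda>i. f (k i)) * mat_adjoint V" by blast
    show "B = U * real_diag n (\<lambda>i. f (l i)) * mat_adjoint U"
      unfolding B by (rule diagonalization_unique[OF V U]) (use Ak A in simp)
  qed
qed

definition herm_mats_on :: "nat \<Rightarrow> real set \<Rightarrow> complex mat set" where
  "herm_mats_on n I = {A \<in> hermitian_mats n. spectrum A \<subseteq> complex_of_real ` I}"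

text \<open>In both definitions \<open>I\<close> is meant to be an open interval; only the values of \<open>f\<close> on \<open>I\<close>
  matter, so \<open>n_monotone n I f\<close> speaks about the restriction of \<open>f\<close> to \<open>I\<close>.\<close>

definition n_monotone :: "nat \<Rightarrow> real set \<Rightarrow> (real \<Rightarrow> real) \<Rightarrow> bool" where
  "n_monotone n I f \<longleftrightarrow>
     (\<forall>A \<in> herm_mats_on n I. \<forall>B \<in> herm_mats_on n I.
        loewner_le n A B \<longrightarrow> loewner_le n (mat_fun f A) (mat_fun f B))"

definition n_convex :: "nat \<Rightarrow> real set \<Rightarrow> (real \<Rightarrow> real) \<Rightarrow> bool" where
  "n_convex n I f \<longleftrightarrow>
     (\<forall>t \<in> {0..1}. \<forall>A \<in> herm_mats_on n I. \<forall>B \<in> herm_mats_on n I.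
        loewner_le n
          (mat_fun f (complex_of_real t \<cdot>\<^sub>m A + complex_of_real (1 - t) \<cdot>\<^sub>m B))
          (complex_of_real t \<cdot>\<^sub>m mat_fun f A + complex_of_real (1 - t) \<cdot>\<^sub>m mat_fun f B))"

end

theory Submission
  imports Defs "HOL-Analysis.Analysis"
begin

text \<open>
  Why the theorem holds: for a smooth function \<open>F\<close> on an open interval \<open>J\<close>, both properties are equivalent to
  a pointwise differential inequality, and a pointwise inequality that holds on two open sets holds on
  their union. The inequality (\<open>local_cond\<close>) says that for every real polynomial \<open>q\<close> of degree less
  than \<open>n\<close> the derivative of \<open>F q\<^sup>2\<close> of order \<open>2n - 1\<close> (for \<open>n\<close>-monotonicity) or of order \<open>2n\<close> (for
  \<open>n\<close>-convexity) is nonnegative on \<open>J\<close>.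

  Monotonicity. Let \<open>C\<close> be diagonal with distinct eigenvalues \<open>a\<^sub>i\<close>, let \<open>v\<close> have no zero entry and let
  \<open>l\<^sub>j\<close> be the eigenvalues of \<open>C + v v\<^sup>*\<close>. Then \<open>\<langle>F(C + v v\<^sup>*) x, x\<rangle> - \<langle>F(C) x, x\<rangle>\<close> is exactly the divided
  difference of \<open>F |q|\<^sup>2\<close> at the \<open>2n\<close> nodes \<open>a\<^sub>i, l\<^sub>j\<close>, where \<open>q\<close> is a polynomial of degree less than \<open>n\<close>
  that depends linearly on \<open>x\<close> (\<open>rank1_divdiff\<close>). A divided difference is a derivative at an
  intermediate point. So a point where the derivative of \<open>F q\<^sup>2\<close> is negative produces two matrices with
  spectrum near that point that violate monotonicity, and conversely the differential inequality yields
  \<open>F(M) \<le> F(M + z z\<^sup>*)\<close>; every inequality \<open>M \<le> M'\<close> is a chain of such rank one steps.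

  Convexity. The same computation for the bordered matrix with blocks \<open>C, v, v\<^sup>*, g\<close> has \<open>2n + 1\<close> nodes
  and compares \<open>F\<close> of the bordered matrix, compressed to the first \<open>n\<close> coordinates, with \<open>F(C)\<close>
  (\<open>bordered_divdiff\<close>). The bridge to convexity is \<open>second_order_comparison\<close>: for diagonal \<open>C\<close> and Hermitian \<open>H\<close>,
  half of \<open>F(C + hH) + F(C - hH) - 2 F(C)\<close> agrees up to \<open>o(h\<^sup>2)\<close> with the sum over \<open>k\<close> of these
  differences for the borders \<open>v = h H e\<^sub>k\<close>, \<open>g = a\<^sub>k\<close>. Hence the differential inequality makes
  \<open>s \<mapsto> \<langle>F(M + sH) x, x\<rangle>\<close> convex, and if the inequality fails near a point, taking all entries of \<open>H\<close>
  equal to one violates convexity there.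

  General \<open>f\<close>. Both properties say that certain weighted sums of values of \<open>f\<close> are nonnegative, for a
  family of weighted sums that is invariant under translation. Such families are respected by the
  averages \<open>\<integral>\<^sub>0\<^sup>h f(x + s) ds / h\<close>, whose iterates are smooth and converge to \<open>f\<close> when \<open>f\<close> is continuous
  (\<open>nonneg_on_glue\<close>). Convex functions on open intervals are continuous, and for \<open>n \<ge> 2\<close> so are
  \<open>n\<close>-monotone functions (\<open>n_monotone_imp_continuous\<close>); for \<open>n = 1\<close> the claim is about increasing
  functions and is elementary.
\<close>

section \<open>Hermitian matrices and their spectral decomposition\<close>

text \<open>Vectors and matrices are functions of indices below an explicit dimension. The arguments below
  pass from dimension \<open>n\<close> to \<open>n + 1\<close> and change single entries along limits, and both are direct for
  such functions.\<close>

definition inprod :: "nat \<Rightarrow> (nat \<Rightarrow> complex) \<Rightarrow> (nat \<Rightarrow> complex) \<Rightarrow> complex" where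
  "inprod n x y = (\<Sum>i<n. x i * cnj (y i))"

definition sqnorm :: "nat \<Rightarrow> (nat \<Rightarrow> complex) \<Rightarrow> real" where
  "sqnorm n x = (\<Sum>i<n. (cmod (x i))\<^sup>2)"

definition app :: "nat \<Rightarrow> (nat \<Rightarrow> nat \<Rightarrow> complex) \<Rightarrow> (nat \<Rightarrow> complex) \<Rightarrow> nat \<Rightarrow> complex" where
  "app n M x i = (\<Sum>j<n. M i j * x j)"

definition herm :: "nat \<Rightarrow> (nat \<Rightarrow> nat \<Rightarrow> complex) \<Rightarrow> bool" where
  "herm n M \<longleftrightarrow> (\<forall>i<n. \<forall>j<n. M j i = cnj (M i j))"

definition hform :: "nat \<Rightarrow> (nat \<Rightarrow> nat \<Rightarrow> complex) \<Rightarrow> (nat \<Rightarrow> complex) \<Rightarrow> real" where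
  "hform n M x = Re (inprod n (app n M x) x)"

definition orthobasis :: "nat \<Rightarrow> (nat \<Rightarrow> nat \<Rightarrow> complex) \<Rightarrow> bool" where
  "orthobasis n u \<longleftrightarrow>
     (\<forall>j<n. \<forall>k<n. inprod n (u j) (u k) = of_bool (j = k)) \<and>
     (\<forall>i<n. \<forall>k<n. (\<Sum>j<n. u j i * cnj (u j k)) = of_bool (i = k))"

text \<open>The matrix \<open>\<Sum>\<^sub>j l\<^sub>j u\<^sub>j u\<^sub>j\<^sup>*\<close>.\<close>

definition synth :: "nat \<Rightarrow> (nat \<Rightarrow> real) \<Rightarrow> (nat \<Rightarrow> nat \<Rightarrow> complex) \<Rightarrow> nat \<Rightarrow> nat \<Rightarrow> complex" where
  "synth n l u i k = (\<Sum>j<n. complex_of_real (l j) * u j i * cnj (u j k))"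

definition spectral_dec ::
  "nat \<Rightarrow> (nat \<Rightarrow> nat \<Rightarrow> complex) \<Rightarrow> (nat \<Rightarrow> real) \<Rightarrow> (nat \<Rightarrow> nat \<Rightarrow> complex) \<Rightarrow> bool" where
  "spectral_dec n M l u \<longleftrightarrow> orthobasis n u \<and> (\<forall>i<n. \<forall>k<n. M i k = synth n l u i k)"

abbreviation to_mat :: "nat \<Rightarrow> (nat \<Rightarrow> nat \<Rightarrow> complex) \<Rightarrow> complex mat" where
  "to_mat n M \<equiv> Matrix.mat n n (\<lambda>(i,j). M i j)"

lemma cnj_of_bool [simp]: "cnj (of_bool b) = of_bool b"
  by (cases b) auto

lemma inprod_commute: "inprod n y x = cnj (inprod n x y)"
  by (simp add: inprod_def mult.commute)

lemma inprod_self: "inprod n x x = of_real (sqnorm n x)"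
  unfolding sqnorm_def of_real_sum complex_norm_square by (simp add: inprod_def)

lemma inprod_synth:
  "inprod n (app n (synth n l u) x) y
     = (\<Sum>j<n. of_real (l j) * inprod n x (u j) * cnj (inprod n y (u j)))"
proof -
  have "inprod n (app n (synth n l u) x) y
     = (\<Sum>i<n. \<Sum>k<n. \<Sum>j<n. of_real (l j) * (x k * cnj (u j k)) * (cnj (y i) * u j i))"
    by (simp add: inprod_def app_def synth_def sum_distrib_left sum_distrib_right mult_ac)
  also have "\<dots> = (\<Sum>j<n. \<Sum>i<n. \<Sum>k<n. of_real (l j) * (x k * cnj (u j k)) * (cnj (y i) * u j i))"
    by (rule trans[OF sum.cong[OF refl sum.swap] sum.swap])
  also have "\<dots> = (\<Sum>j<n. of_real (l j) * inprod n x (u j) * cnj (inprod n y (u j)))"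
    by (intro sum.cong refl, subst sum.swap) (simp add: inprod_def sum_distrib_left sum_distrib_right mult_ac)
  finally show ?thesis .
qed

lemma inprod_cong:
  "(\<And>i. i < n \<Longrightarrow> x i = x' i) \<Longrightarrow> (\<And>i. i < n \<Longrightarrow> y i = y' i) \<Longrightarrow> inprod n x y = inprod n x' y'"
  by (simp add: inprod_def)

lemma app_cong:
  "i < n \<Longrightarrow> (\<And>i j. i < n \<Longrightarrow> j < n \<Longrightarrow> M i j = M' i j) \<Longrightarrow> (\<And>i. i < n \<Longrightarrow> x i = x' i) \<Longrightarrow> app n M x i = app n M' x' i"
  by (simp add: app_def)

lemma hform_cong:
  "(\<And>i j. i < n \<Longrightarrow> j < n \<Longrightarrow> M i j = M' i j) \<Longrightarrow> (\<And>i. i < n \<Longrightarrow> x i = x' i) \<Longrightarrow> hform n M x = hform n M' x'"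
  unfolding hform_def by (intro arg_cong[of _ _ Re] inprod_cong app_cong) auto

lemma hform_synth: "hform n (synth n l u) x = (\<Sum>j<n. l j * (cmod (inprod n x (u j)))\<^sup>2)"
proof -
  have "of_real (l j) * inprod n x (u j) * cnj (inprod n x (u j))
      = complex_of_real (l j * (cmod (inprod n x (u j)))\<^sup>2)" for j
    unfolding of_real_mult complex_norm_square by (simp only: mult.assoc)
  then have "inprod n (app n (synth n l u) x) x = of_real (\<Sum>j<n. l j * (cmod (inprod n x (u j)))\<^sup>2)"
    by (simp only: inprod_synth of_real_sum)
  then show ?thesis
    by (simp only: hform_def Re_complex_of_real)
qed

lemma herm_synth: "herm n (synth n l u)"
  by (simp add: herm_def synth_def mult_ac)

lemma hermD: "herm n M \<Longrightarrow> i < n \<Longrightarrow> j < n \<Longrightarrow> cnj (M i j) = M j i"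
  unfolding herm_def by (elim allE[of _ i] impE allE[of _ j]) simp_all

lemma spectral_dec_herm: "spectral_dec n M l u \<Longrightarrow> herm n M"
  unfolding herm_def by (simp add: spectral_dec_def hermD[OF herm_synth])

lemma parseval:
  assumes "orthobasis n u"
  shows "(\<Sum>j<n. inprod n x (u j) * cnj (inprod n y (u j))) = inprod n x y"
proof -
  have "(\<Sum>j<n. inprod n x (u j) * cnj (inprod n y (u j))) = inprod n (app n (synth n (\<lambda>_. 1) u) x) y"
    by (simp add: inprod_synth)
  also have "\<dots> = inprod n x y"
  proof (rule inprod_cong)
    fix i assume i: "i < n"
    have "app n (synth n (\<lambda>_. 1) u) x i = (\<Sum>j<n. of_bool (i = j) * x j)"
      unfolding app_def using i assms by (intro sum.cong) (auto simp: synth_def orthobasis_def)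
    then show "app n (synth n (\<lambda>_. 1) u) x i = x i"
      using i by (simp add: of_bool_def if_distrib if_distribR sum.delta cong: if_cong)
  qed simp
  finally show ?thesis .
qed

lemma parseval_sqnorm:
  assumes "orthobasis n u"
  shows "(\<Sum>j<n. (cmod (inprod n x (u j)))\<^sup>2) = sqnorm n x"
proof -
  have "of_real (\<Sum>j<n. (cmod (inprod n x (u j)))\<^sup>2) = complex_of_real (sqnorm n x)"
    using parseval[OF assms, of x x] by (simp only: inprod_self of_real_sum complex_norm_square)
  then show ?thesis by (simp only: of_real_eq_iff)
qed

lemma spectral_dec_inprod_app:
  assumes "spectral_dec n M l u" "j < n"
  shows "inprod n (app n M x) (u j) = of_real (l j) * inprod n x (u j)"
proof -
  have "inprod n (app n M x) (u j) = inprod n (app n (synth n l u) x) (u j)"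
    using assms by (intro inprod_cong app_cong) (auto simp: spectral_dec_def)
  also have "\<dots> = (\<Sum>k<n. of_real (l k) * inprod n x (u k) * of_bool (j = k))"
    using assms by (auto simp: inprod_synth spectral_dec_def orthobasis_def intro!: sum.cong)
  also have "\<dots> = of_real (l j) * inprod n x (u j)"
    using assms(2) by (simp add: of_bool_def if_distrib if_distribR sum.delta cong: if_cong)
  finally show ?thesis .
qed

lemma spectral_dec_eigenvector:
  assumes "spectral_dec n M l u" "j < n" "i < n"
  shows "app n M (u j) i = of_real (l j) * u j i"
proof -
  have "app n M (u j) i = (\<Sum>k<n. \<Sum>m<n. of_real (l m) * u m i * (u j k * cnj (u m k)))"
    using assms by (auto simp: app_def spectral_dec_def synth_def sum_distrib_left sum_distrib_right mult_ac intro!: sum.cong)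
  also have "\<dots> = (\<Sum>m<n. of_real (l m) * u m i * inprod n (u j) (u m))"
    by (subst sum.swap) (simp add: inprod_def sum_distrib_left)
  also have "\<dots> = (\<Sum>m<n. of_real (l m) * u m i * of_bool (j = m))"
    using assms by (auto simp: spectral_dec_def orthobasis_def intro!: sum.cong)
  also have "\<dots> = of_real (l j) * u j i"
    using assms(2) by (simp add: of_bool_def if_distrib if_distribR sum.delta cong: if_cong)
  finally show ?thesis .
qed

lemma basis_expansion_zero:
  assumes "orthobasis n u" "\<And>j. j < n \<Longrightarrow> inprod n x (u j) = 0" "i < n"
  shows "x i = 0"
proof -
  have "sqnorm n x = 0"
    using parseval_sqnorm[OF assms(1), of x] assms(2) by simp
  then have "\<forall>i\<in>{..<n}. (cmod (x i))\<^sup>2 = 0"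
    unfolding sqnorm_def by (subst (asm) sum_nonneg_eq_0_iff) auto
  then show ?thesis
    using assms(3) by simp
qed

lemma to_mat_adjoint: "mat_adjoint (to_mat n M) = to_mat n (\<lambda>i j. cnj (M j i))"
proof (rule eq_matI)
  fix i j assume "i < dim_row (to_mat n (\<lambda>i j. cnj (M j i)))" "j < dim_col (to_mat n (\<lambda>i j. cnj (M j i)))"
  then have ij: "i < n" "j < n" by simp_all
  have "mat_adjoint (to_mat n M) $$ (i,j) = vec_index (map conjugate (cols (to_mat n M)) ! i) j"
    unfolding mat_adjoint_def using ij by (subst mat_of_rows_index) simp_all
  also have "\<dots> = cnj (M j i)"
    using ij by simp
  finally show "mat_adjoint (to_mat n M) $$ (i,j) = to_mat n (\<lambda>i j. cnj (M j i)) $$ (i,j)"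
    using ij by simp
qed (simp_all add: mat_adjoint_def)

lemma to_mat_eq_iff: "to_mat n M = to_mat n M' \<longleftrightarrow> (\<forall>i<n. \<forall>j<n. M i j = M' i j)"
  by (auto simp: mat_eq_iff)

lemma to_mat_entries: "A \<in> carrier_mat n n \<Longrightarrow> to_mat n (\<lambda>i j. A $$ (i,j)) = A"
  by (auto simp: mat_eq_iff)

lemma hermitian_mats_iff: "to_mat n M \<in> hermitian_mats n \<longleftrightarrow> herm n M"
proof -
  have "to_mat n M \<in> hermitian_mats n \<longleftrightarrow> (\<forall>i<n. \<forall>j<n. cnj (M j i) = M i j)"
    (is "_ \<longleftrightarrow> ?R")
    by (simp only: hermitian_mats_def to_mat_adjoint to_mat_eq_iff mem_Collect_eq mat_carrier simp_thms)
  also have "?R \<longleftrightarrow> herm n M"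
  proof
    assume R: ?R
    show "herm n M" unfolding herm_def using R by fastforce
  qed (simp add: hermD)
  finally show ?thesis .
qed

lemma to_mat_mult: "to_mat n M * to_mat n M' = to_mat n (\<lambda>i j. \<Sum>k<n. M i k * M' k j)"
  by (rule eq_matI) (auto simp: scalar_prod_def lessThan_atLeast0)

lemma synth_mat:
  "to_mat n (\<lambda>i j. u j i) * real_diag n l * mat_adjoint (to_mat n (\<lambda>i j. u j i)) = to_mat n (synth n l u)"
proof -
  have 1: "to_mat n (\<lambda>i j. u j i) * real_diag n l = to_mat n (\<lambda>i j. u j i * complex_of_real (l j))"
    by (subst mat_diag_mult_right[of _ n n]) auto
  show ?thesis
    unfolding 1 to_mat_adjoint to_mat_mult by (auto simp: to_mat_eq_iff synth_def mult_ac)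
qed

lemma unitary_of_orthobasis:
  assumes "orthobasis n u"
  shows "to_mat n (\<lambda>i j. u j i) \<in> unitary_mats n"
  using assms unfolding unitary_mats_def to_mat_adjoint to_mat_mult mem_Collect_eq
  by (auto simp: mat_eq_iff orthobasis_def inprod_def mult.commute of_bool_def)

lemma mat_fun_synth:
  assumes "spectral_dec n M l u"
  shows "mat_fun F (to_mat n M) = to_mat n (synth n (\<lambda>j. F (l j)) u)"
proof -
  have "to_mat n M = to_mat n (synth n l u)"
    using assms by (auto simp: to_mat_eq_iff spectral_dec_def)
  then have "to_mat n M = to_mat n (\<lambda>i j. u j i) * real_diag n l * mat_adjoint (to_mat n (\<lambda>i j. u j i))"
    by (simp add: synth_mat)
  from mat_fun_eq[OF unitary_of_orthobasis this] show ?thesis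
    using assms by (simp add: spectral_dec_def synth_mat)
qed

text \<open>The form \<open>\<langle>F(M) x, x\<rangle>\<close>. All inequalities between matrices \<open>F(M)\<close> are inequalities between these
  forms, and \<open>fform_eq\<close> evaluates them in any spectral decomposition.\<close>

definition fform :: "nat \<Rightarrow> (real \<Rightarrow> real) \<Rightarrow> (nat \<Rightarrow> nat \<Rightarrow> complex) \<Rightarrow> (nat \<Rightarrow> complex) \<Rightarrow> real" where
  "fform n F M x = hform n (\<lambda>i j. mat_fun F (to_mat n M) $$ (i,j)) x"

lemma fform_eq:
  assumes "spectral_dec n M l u"
  shows "fform n F M x = (\<Sum>j<n. F (l j) * (cmod (inprod n x (u j)))\<^sup>2)"
  unfolding fform_def mat_fun_synth[OF assms] hform_synth[symmetric] by (rule hform_cong) auto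

lemma hform_eq:
  assumes "spectral_dec n M l u"
  shows "hform n M x = (\<Sum>j<n. l j * (cmod (inprod n x (u j)))\<^sup>2)"
  unfolding hform_synth[symmetric] by (rule hform_cong) (use assms in \<open>auto simp: spectral_dec_def\<close>)

text \<open>A square matrix with a left inverse has a two-sided inverse, so orthonormality of \<open>n\<close> vectors
  gives the completeness relation.\<close>

lemma orthobasisI:
  assumes "\<And>j k. j < n \<Longrightarrow> k < n \<Longrightarrow> inprod n (u j) (u k) = of_bool (j = k)"
  shows "orthobasis n u"
proof -
  define U where "U = to_mat n (\<lambda>i j. u j i)"
  define U' where "U' = to_mat n (\<lambda>i j. cnj (u i j))"
  have "U' * U = 1\<^sub>m n"
    unfolding U_def U'_def to_mat_mult using assms
    by (auto simp: mat_eq_iff inprod_def mult.commute of_bool_def)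
  then have "U * U' = 1\<^sub>m n"
    by (rule mat_mult_left_right_inverse[rotated 2]) (auto simp: U_def U'_def)
  then show ?thesis
    using assms unfolding U_def U'_def to_mat_mult by (auto simp: mat_eq_iff orthobasis_def of_bool_def)
qed

lemma spectral_decI:
  assumes u: "orthobasis n u"
    and eig: "\<And>i j. i < n \<Longrightarrow> j < n \<Longrightarrow> app n M (u j) i = of_real (l j) * u j i"
  shows "spectral_dec n M l u"
  unfolding spectral_dec_def
proof (intro conjI u allI impI)
  fix i k assume ik: "i < n" "k < n"
  have "synth n l u i k = (\<Sum>j<n. app n M (u j) i * cnj (u j k))"
    using ik by (simp add: synth_def eig)
  also have "\<dots> = (\<Sum>m<n. M i m * (\<Sum>j<n. u j m * cnj (u j k)))"
    unfolding app_def sum_distrib_left sum_distrib_right by (subst sum.swap) (simp add: mult_ac)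
  also have "\<dots> = (\<Sum>m<n. M i m * of_bool (m = k))"
    using u ik by (auto simp: orthobasis_def intro!: sum.cong)
  also have "\<dots> = M i k"
    using ik by (simp add: of_bool_def if_distrib if_distribR sum.delta cong: if_cong)
  finally show "M i k = synth n l u i k" by simp
qed

lemma herm_inprod:
  assumes "herm n M"
  shows "inprod n (app n M x) y = inprod n x (app n M y)"
proof -
  have "inprod n (app n M x) y = (\<Sum>i<n. \<Sum>j<n. M i j * x j * cnj (y i))"
    by (simp add: inprod_def app_def sum_distrib_right)
  also have "\<dots> = (\<Sum>j<n. \<Sum>i<n. M i j * x j * cnj (y i))"
    by (rule sum.swap)
  also have "\<dots> = inprod n x (app n M y)"
    by (simp add: inprod_def app_def sum_distrib_left hermD[OF assms] mult_ac)
  finally show ?thesis .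
qed

definition coords :: "nat \<Rightarrow> (nat \<Rightarrow> nat \<Rightarrow> complex) \<Rightarrow> (nat \<Rightarrow> complex) \<Rightarrow> nat \<Rightarrow> complex" where
  "coords n u x i = inprod n x (u i)"

definition combine :: "nat \<Rightarrow> (nat \<Rightarrow> nat \<Rightarrow> complex) \<Rightarrow> (nat \<Rightarrow> complex) \<Rightarrow> nat \<Rightarrow> complex" where
  "combine n u y m = (\<Sum>i<n. y i * u i m)"

text \<open>The matrix \<open>U\<^sup>* M U\<close> in the orthonormal basis \<open>u\<close>.\<close>

definition conj_mat :: "nat \<Rightarrow> (nat \<Rightarrow> nat \<Rightarrow> complex) \<Rightarrow> (nat \<Rightarrow> nat \<Rightarrow> complex) \<Rightarrow> nat \<Rightarrow> nat \<Rightarrow> complex" where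
  "conj_mat n u M i j = inprod n (app n M (u j)) (u i)"

lemma inprod_combine: "inprod n x (combine n u y) = inprod n (coords n u x) y"
proof -
  have "inprod n x (combine n u y) = (\<Sum>m<n. \<Sum>i<n. x m * cnj (u i m) * cnj (y i))"
    by (simp add: inprod_def combine_def sum_distrib_left mult_ac)
  also have "\<dots> = (\<Sum>i<n. \<Sum>m<n. x m * cnj (u i m) * cnj (y i))"
    by (rule sum.swap)
  finally show ?thesis
    by (simp add: inprod_def coords_def sum_distrib_right)
qed

lemma coords_combine:
  assumes "orthobasis n u" "i < n"
  shows "coords n u (combine n u y) i = y i"
proof -
  have "coords n u (combine n u y) i = cnj (inprod n (u i) (combine n u y))"
    by (simp add: coords_def inprod_commute[of n "combine n u y"])
  also have "\<dots> = cnj (\<Sum>j<n. of_bool (i = j) * cnj (y j))"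
    unfolding inprod_combine using assms by (simp add: inprod_def[of n "coords n u (u i)" y] coords_def orthobasis_def)
  also have "\<dots> = y i"
    using assms(2) by (simp add: of_bool_def if_distrib if_distribR sum.delta cong: if_cong)
  finally show ?thesis .
qed

lemma combine_coords:
  assumes "orthobasis n u" "m < n"
  shows "combine n u (coords n u x) m = x m"
proof -
  have "combine n u (coords n u x) m = (\<Sum>i<n. \<Sum>k<n. x k * (u i m * cnj (u i k)))"
    by (simp add: combine_def coords_def inprod_def sum_distrib_left sum_distrib_right mult_ac)
  also have "\<dots> = (\<Sum>k<n. x k * (\<Sum>i<n. u i m * cnj (u i k)))"
    by (subst sum.swap) (simp add: sum_distrib_left)
  also have "\<dots> = (\<Sum>k<n. x k * of_bool (m = k))"
    using assms by (simp add: orthobasis_def)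
  also have "\<dots> = x m"
    using assms(2) by (simp add: of_bool_def if_distrib if_distribR sum.delta cong: if_cong)
  finally show ?thesis .
qed

lemma app_combine: "app n M (combine n u y) i = (\<Sum>j<n. y j * app n M (u j) i)"
proof -
  have "app n M (combine n u y) i = (\<Sum>k<n. \<Sum>j<n. y j * (M i k * u j k))"
    by (simp add: app_def combine_def sum_distrib_left mult_ac)
  also have "\<dots> = (\<Sum>j<n. \<Sum>k<n. y j * (M i k * u j k))"
    by (rule sum.swap)
  finally show ?thesis by (simp add: app_def sum_distrib_left)
qed

lemma coords_app_combine: "coords n u (app n M (combine n u y)) i = app n (conj_mat n u M) y i"
proof -
  have "coords n u (app n M (combine n u y)) i = (\<Sum>k<n. \<Sum>j<n. y j * app n M (u j) k * cnj (u i k))"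
    by (simp add: coords_def inprod_def app_combine sum_distrib_right)
  also have "\<dots> = (\<Sum>j<n. \<Sum>k<n. y j * app n M (u j) k * cnj (u i k))"
    by (rule sum.swap)
  also have "\<dots> = app n (conj_mat n u M) y i"
    by (simp add: app_def[of n "conj_mat n u M"] conj_mat_def inprod_def sum_distrib_left sum_distrib_right mult_ac)
  finally show ?thesis .
qed

lemma herm_conj_mat: "herm n M \<Longrightarrow> herm n (conj_mat n u M)"
  unfolding herm_def[of n "conj_mat n u M"] conj_mat_def
  by (metis inprod_commute herm_inprod)

lemma spectral_dec_conj_mat:
  assumes u: "orthobasis n u" and dec: "spectral_dec n (conj_mat n u M) l w"
  shows "spectral_dec n M l (\<lambda>k. combine n u (w k))"
proof (rule spectral_decI)
  show "orthobasis n (\<lambda>k. combine n u (w k))"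
  proof (rule orthobasisI)
    fix j k assume jk: "j < n" "k < n"
    have "inprod n (combine n u (w j)) (combine n u (w k)) = inprod n (w j) (w k)"
      unfolding inprod_combine by (intro inprod_cong coords_combine u) auto
    then show "inprod n (combine n u (w j)) (combine n u (w k)) = of_bool (j = k)"
      using dec jk by (simp add: spectral_dec_def orthobasis_def)
  qed
  fix i j assume ij: "i < n" "j < n"
  have "app n M (combine n u (w j)) i = combine n u (coords n u (app n M (combine n u (w j)))) i"
    using u ij by (simp add: combine_coords)
  also have "\<dots> = (\<Sum>k<n. app n (conj_mat n u M) (w j) k * u k i)"
    by (simp add: combine_def[of n u "coords n u _"] coords_app_combine)
  also have "\<dots> = of_real (l j) * combine n u (w j) i"
    using spectral_dec_eigenvector[OF dec ij(2)] by (simp add: combine_def sum_distrib_left mult_ac)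
  finally show "app n M (combine n u (w j)) i = of_real (l j) * combine n u (w j) i" .
qed

text \<open>Complete \<open>v\<close> to a basis, apply Gram-Schmidt, which keeps the first vector, and normalize.\<close>

lemma orthobasis_containing:
  fixes v :: "complex Matrix.vec"
  assumes v: "v \<in> carrier_vec n" and v0: "v \<noteq> 0\<^sub>v n"
  shows "\<exists>u c. orthobasis n u \<and> (\<forall>i<n. u 0 i = c * vec_index v i)"
proof -
  interpret cof_vec_space n "TYPE(complex)" .
  define b where "b = basis_completion v"
  define ws where "ws = gram_schmidt n b"
  from basis_completion[OF v v0, folded b_def]
  have dist_b: "distinct b" and indep: "\<not> lin_dep (set b)" and b: "set b \<subseteq> carrier_vec n"
    and hdb: "hd b = v" and len_b: "length b = n" by auto
  have n: "n \<noteq> 0" using v v0 by (metis carrier_vecD eq_vecI less_nat_zero_code zero_carrier_vec)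
  from hdb len_b n obtain vs where bv: "b = v # vs" by (cases b) auto
  from gram_schmidt_result[OF b dist_b indep refl, folded ws_def]
  have ws: "set ws \<subseteq> carrier_vec n" "corthogonal ws" "length ws = n" by (auto simp: len_b)
  from gram_schmidt_hd[OF v, of vs, folded bv] have hdws: "hd ws = v" unfolding ws_def .
  define w where "w j = vec_index (ws ! j)" for j
  have ip: "inprod n (w j) (w k) = ws ! j \<bullet>c ws ! k" if "j < n" "k < n" for j k
  proof -
    have "ws ! j \<in> carrier_vec n" "ws ! k \<in> carrier_vec n" using ws that by auto
    then show ?thesis by (simp add: inprod_def scalar_prod_def w_def lessThan_atLeast0)
  qed
  have orth: "inprod n (w j) (w k) = 0 \<longleftrightarrow> j \<noteq> k" if "j < n" "k < n" for j k
    using corthogonalD[OF ws(2)] ws(3) that by (simp add: ip)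
  define r where "r j = sqrt (sqnorm n (w j))" for j
  have r: "r j \<noteq> 0" "complex_of_real (r j) * complex_of_real (r j) = inprod n (w j) (w j)" if "j < n" for j
  proof -
    have nn: "sqnorm n (w j) \<ge> 0" by (simp add: sqnorm_def sum_nonneg)
    have "sqnorm n (w j) \<noteq> 0" using orth[OF that that] by (simp add: inprod_self)
    then show "r j \<noteq> 0" by (simp add: r_def)
    show "complex_of_real (r j) * complex_of_real (r j) = inprod n (w j) (w j)"
      unfolding inprod_self of_real_mult[symmetric] using nn by (simp add: r_def)
  qed
  define u where "u j i = w j i / of_real (r j)" for j i
  have "inprod n (u j) (u k) = inprod n (w j) (w k) / (of_real (r j) * of_real (r k))" for j k
    by (simp add: inprod_def u_def sum_divide_distrib)
  then have "orthobasis n u"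
    using orth r by (intro orthobasisI) (auto simp: of_bool_def)
  moreover have "\<forall>i<n. u 0 i = (1 / of_real (r 0)) * vec_index v i"
    using hdws n ws(3) by (cases ws) (auto simp: u_def w_def)
  ultimately show ?thesis by blast
qed

text \<open>A Hermitian matrix whose first column vanishes below the diagonal splits as a direct sum.\<close>

lemma spectral_dec_extend:
  assumes herm: "herm (Suc n) M" and col: "\<And>i. i < n \<Longrightarrow> M (Suc i) 0 = 0"
    and dec: "spectral_dec n (\<lambda>i j. M (Suc i) (Suc j)) l w"
  shows "spectral_dec (Suc n) M (case_nat (Re (M 0 0)) l)
           (case_nat (\<lambda>i. of_bool (i = 0)) (\<lambda>k. case_nat 0 (w k)))"
    (is "spectral_dec _ _ ?l ?u")
proof (rule spectral_decI)
  have row: "M 0 (Suc j) = 0" if "j < n" for j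
    using hermD[OF herm, of "Suc j" 0] col that by simp
  have M00: "complex_of_real (Re (M 0 0)) = M 0 0"
    using hermD[OF herm, of 0 0] by (simp add: complex_eq_iff)
  show "orthobasis (Suc n) ?u"
  proof (rule orthobasisI)
    fix j k assume jk: "j < Suc n" "k < Suc n"
    have *: "inprod (Suc n) x y = x 0 * cnj (y 0) + inprod n (\<lambda>i. x (Suc i)) (\<lambda>i. y (Suc i))" for x y
      by (simp add: inprod_def sum.lessThan_Suc_shift del: sum.lessThan_Suc)
    show "inprod (Suc n) (?u j) (?u k) = of_bool (j = k)"
      using dec jk unfolding * by (cases j; cases k) (auto simp: inprod_def spectral_dec_def orthobasis_def)
  qed
  fix i j assume ij: "i < Suc n" "j < Suc n"
  have *: "app (Suc n) M x i = M i 0 * x 0 + app n (\<lambda>i j. M i (Suc j)) (\<lambda>i. x (Suc i)) i" for x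
    by (simp add: app_def sum.lessThan_Suc_shift del: sum.lessThan_Suc)
  show "app (Suc n) M (?u j) i = of_real (?l j) * ?u j i"
  proof (cases j)
    case 0
    then show ?thesis unfolding * using ij by (cases i) (auto simp: M00 col app_def)
  next
    case (Suc j')
    show ?thesis
    proof (cases i)
      case 0
      then show ?thesis unfolding * using ij Suc by (auto simp: row app_def)
    next
      case (Suc i')
      have "app n (\<lambda>i j. M i (Suc j)) (w j') i = app n (\<lambda>i j. M (Suc i) (Suc j)) (w j') i'"
        using Suc by (simp add: app_def)
      then show ?thesis
        unfolding * using ij Suc \<open>j = Suc j'\<close> spectral_dec_eigenvector[OF dec, of j' i'] by simp
    qed
  qed
qed

text \<open>Induction on the dimension: in an orthonormal basis that starts with an eigenvector, the matrix
  splits off a one-dimensional block.\<close>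

theorem spectral_dec_exists: "herm n M \<Longrightarrow> \<exists>l u. spectral_dec n M l u"
proof (induction n arbitrary: M)
  case 0
  show ?case by (simp add: spectral_dec_def orthobasis_def)
next
  case (Suc n)
  define A where "A = to_mat (Suc n) M"
  have A: "A \<in> carrier_mat (Suc n) (Suc n)" by (simp add: A_def)
  obtain k where "eigenvalue A k"
    using spectrum_non_empty[OF A] by (auto simp: spectrum_def)
  then obtain v where v: "v \<in> carrier_vec (Suc n)" "v \<noteq> 0\<^sub>v (Suc n)" "A *\<^sub>v v = k \<cdot>\<^sub>v v"
    using A by (auto simp: eigenvalue_def eigenvector_def)
  from orthobasis_containing[OF v(1,2)] obtain u c
    where u: "orthobasis (Suc n) u" and c: "\<And>i. i < Suc n \<Longrightarrow> u 0 i = c * vec_index v i" by blast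
  have *: "app (Suc n) M (vec_index v) i = k * vec_index v i" if "i < Suc n" for i
  proof -
    have "vec_index (A *\<^sub>v v) i = k * vec_index v i" using v that by simp
    then show ?thesis
      using that v(1) by (simp add: A_def app_def scalar_prod_def lessThan_atLeast0 del: sum.op_ivl_Suc sum.lessThan_Suc)
  qed
  have ev: "app (Suc n) M (u 0) i = k * u 0 i" if "i < Suc n" for i
  proof -
    have "app (Suc n) M (u 0) i = (\<Sum>j<Suc n. c * (M i j * vec_index v j))"
      unfolding app_def by (rule sum.cong) (auto simp: c)
    also have "\<dots> = c * app (Suc n) M (vec_index v) i"
      by (simp only: sum_distrib_left app_def)
    finally show ?thesis using * that c by simp
  qed
  define M' where "M' = conj_mat (Suc n) u M"
  have M': "herm (Suc n) M'" unfolding M'_def by (rule herm_conj_mat) fact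
  have "M' (Suc i) 0 = 0" if "i < n" for i
  proof -
    have "M' (Suc i) 0 = inprod (Suc n) (\<lambda>m. k * u 0 m) (u (Suc i))"
      unfolding M'_def conj_mat_def by (rule inprod_cong) (auto simp: ev)
    also have "\<dots> = k * inprod (Suc n) (u 0) (u (Suc i))"
      by (simp add: inprod_def sum_distrib_left mult.assoc del: sum.lessThan_Suc)
    also have "\<dots> = 0" using u that by (simp add: orthobasis_def)
    finally show ?thesis .
  qed
  moreover have "herm n (\<lambda>i j. M' (Suc i) (Suc j))"
    unfolding herm_def by (intro allI impI, rule hermD[OF M', symmetric]) auto
  then obtain l w where "spectral_dec n (\<lambda>i j. M' (Suc i) (Suc j)) l w"
    using Suc.IH by blast
  ultimately have "\<exists>l w. spectral_dec (Suc n) M' l w"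
    using spectral_dec_extend[OF M'] by blast
  then show ?case
    using spectral_dec_conj_mat[OF u] unfolding M'_def by blast
qed

text \<open>All eigenvalues lie in \<open>I\<close>. Every spectral decomposition lists the same eigenvalues, see
  \<open>spectrum_to_mat\<close>.\<close>

definition spec_in :: "nat \<Rightarrow> (nat \<Rightarrow> nat \<Rightarrow> complex) \<Rightarrow> real set \<Rightarrow> bool" where
  "spec_in n M I \<longleftrightarrow> (\<forall>l u. spectral_dec n M l u \<longrightarrow> (\<forall>j<n. l j \<in> I))"

lemma spec_inD: "spec_in n M I \<Longrightarrow> spectral_dec n M l u \<Longrightarrow> j < n \<Longrightarrow> l j \<in> I"
  unfolding spec_in_def by blast

lemma spectrum_to_mat:
  assumes dec: "spectral_dec n M l u"
  shows "spectrum (to_mat n M) = complex_of_real ` l ` {..<n}"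
proof (intro equalityI subsetI)
  fix k assume "k \<in> spectrum (to_mat n M)"
  then obtain v where v: "v \<in> carrier_vec n" "v \<noteq> 0\<^sub>v n" "to_mat n M *\<^sub>v v = k \<cdot>\<^sub>v v"
    by (auto simp: spectrum_def eigenvalue_def eigenvector_def)
  have ev: "app n M (vec_index v) i = k * vec_index v i" if "i < n" for i
  proof -
    have "vec_index (to_mat n M *\<^sub>v v) i = k * vec_index v i" using v that by simp
    then show ?thesis
      using that v(1) by (simp add: app_def scalar_prod_def lessThan_atLeast0)
  qed
  have "\<exists>j<n. inprod n (vec_index v) (u j) \<noteq> 0"
  proof (rule ccontr)
    assume "\<not> ?thesis"
    then have "vec_index v i = 0" if "i < n" for i
      using basis_expansion_zero[of n u "vec_index v" i] dec that by (auto simp: spectral_dec_def)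
    then show False using v(1,2) by (auto simp: Matrix.vec_eq_iff)
  qed
  then obtain j where j: "j < n" "inprod n (vec_index v) (u j) \<noteq> 0" by blast
  have "inprod n (app n M (vec_index v)) (u j) = k * inprod n (vec_index v) (u j)"
    by (subst inprod_cong[of n _ "\<lambda>i. k * vec_index v i" _ "u j"])
      (auto simp: ev inprod_def sum_distrib_left mult.assoc)
  then have "k = of_real (l j)"
    using spectral_dec_inprod_app[OF dec j(1), of "vec_index v"] j(2) by simp
  then show "k \<in> complex_of_real ` l ` {..<n}" using j(1) by auto
next
  fix k assume "k \<in> complex_of_real ` l ` {..<n}"
  then obtain j where j: "j < n" "k = of_real (l j)" by auto
  have "Matrix.vec n (u j) \<noteq> 0\<^sub>v n"
  proof
    assume "Matrix.vec n (u j) = 0\<^sub>v n"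
    then have "u j i = 0" if "i < n" for i
      using that by (metis index_vec index_zero_vec(1))
    then have "inprod n (u j) (u j) = 0" by (simp add: inprod_def)
    then show False using dec j(1) by (simp add: spectral_dec_def orthobasis_def)
  qed
  moreover have "to_mat n M *\<^sub>v Matrix.vec n (u j) = k \<cdot>\<^sub>v Matrix.vec n (u j)"
  proof (rule eq_vecI)
    fix i assume "i < dim_vec (k \<cdot>\<^sub>v Matrix.vec n (u j))"
    then have i: "i < n" by simp
    have "vec_index (to_mat n M *\<^sub>v Matrix.vec n (u j)) i = app n M (u j) i"
      using i by (simp add: app_def scalar_prod_def lessThan_atLeast0)
    then show "vec_index (to_mat n M *\<^sub>v Matrix.vec n (u j)) i = vec_index (k \<cdot>\<^sub>v Matrix.vec n (u j)) i"
      using i spectral_dec_eigenvector[OF dec j(1) i] j(2) by simp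
  qed simp
  ultimately show "k \<in> spectrum (to_mat n M)"
    by (auto simp: spectrum_def eigenvalue_def eigenvector_def intro!: exI[of _ "Matrix.vec n (u j)"])
qed

lemma herm_mats_on_iff: "to_mat n M \<in> herm_mats_on n I \<longleftrightarrow> herm n M \<and> spec_in n M I"
proof -
  have "spectrum (to_mat n M) \<subseteq> complex_of_real ` I \<longleftrightarrow> (\<forall>j<n. l j \<in> I)" if "spectral_dec n M l u" for l u
    unfolding spectrum_to_mat[OF that] by (auto simp: image_subset_iff image_iff)
  then have "spectrum (to_mat n M) \<subseteq> complex_of_real ` I \<longleftrightarrow> spec_in n M I" if "herm n M"
    using spectral_dec_exists[OF that] unfolding spec_in_def by blast
  then show ?thesis
    unfolding herm_mats_on_def by (auto simp: hermitian_mats_iff)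
qed

lemma herm_diff: "herm n M \<Longrightarrow> herm n M' \<Longrightarrow> herm n (\<lambda>i j. M i j - M' i j)"
  by (simp add: herm_def[of n "\<lambda>i j. M i j - M' i j"] hermD)

lemma hform_diff: "hform n (\<lambda>i j. M i j - M' i j) x = hform n M x - hform n M' x"
  by (simp add: hform_def inprod_def app_def algebra_simps sum_subtractf)

lemma hform_combination:
  "hform n (\<lambda>i j. of_real t * M i j + of_real s * M' i j) x = t * hform n M x + s * hform n M' x"
  by (simp add: hform_def inprod_def app_def algebra_simps sum.distrib sum_distrib_left)

lemma herm_combination:
  assumes "herm n M" "herm n M'"
  shows "herm n (\<lambda>i j. of_real t * M i j + of_real s * M' i j)"
  unfolding herm_def by (simp add: hermD[OF assms(1)] hermD[OF assms(2)])

lemma hform_of_real: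
  assumes "herm n M"
  shows "inprod n (app n M x) x = of_real (hform n M x)"
proof -
  have "cnj (inprod n (app n M x) x) = inprod n (app n M x) x"
    using herm_inprod[OF assms, of x x] inprod_commute[of n x "app n M x"] by simp
  then show ?thesis
    unfolding hform_def by (metis Reals_cnj_iff of_real_Re)
qed

lemma loewner_le_to_mat:
  assumes "herm n R" "herm n R'"
  shows "loewner_le n (to_mat n R) (to_mat n R') \<longleftrightarrow> (\<forall>x. hform n R x \<le> hform n R' x)"
proof -
  define D where "D i j = R' i j - R i j" for i j
  have D: "herm n D" unfolding D_def by (rule herm_diff) (fact assms)+
  have eq: "to_mat n R' - to_mat n R = to_mat n D"
    by (auto simp: mat_eq_iff D_def)
  have q: "(to_mat n D *\<^sub>v v) \<bullet>c v = of_real (hform n D (vec_index v))" if "v \<in> carrier_vec n" for v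
  proof -
    have "(to_mat n D *\<^sub>v v) \<bullet>c v = inprod n (app n D (vec_index v)) (vec_index v)"
      using that by (auto simp: scalar_prod_def inprod_def app_def lessThan_atLeast0 intro!: sum.cong)
    then show ?thesis using hform_of_real[OF D] by simp
  qed
  have "loewner_le n (to_mat n R) (to_mat n R') \<longleftrightarrow> (\<forall>v\<in>carrier_vec n. hform n D (vec_index v) \<ge> 0)"
    unfolding loewner_le_def eq pos_semidef_mats_def using D q
    by (auto simp: hermitian_mats_iff less_eq_complex_def)
  also have "\<dots> \<longleftrightarrow> (\<forall>x. hform n D x \<ge> 0)"
  proof safe
    fix x assume "\<forall>v\<in>carrier_vec n. hform n D (vec_index v) \<ge> 0"
    then have "hform n D (vec_index (Matrix.vec n x)) \<ge> 0" by simp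
    also have "hform n D (vec_index (Matrix.vec n x)) = hform n D x"
      by (rule hform_cong) auto
    finally show "hform n D x \<ge> 0" .
  qed blast
  also have "\<dots> \<longleftrightarrow> (\<forall>x. hform n R x \<le> hform n R' x)"
    unfolding D_def hform_diff by auto
  finally show ?thesis .
qed

definition fmat :: "nat \<Rightarrow> (real \<Rightarrow> real) \<Rightarrow> (nat \<Rightarrow> nat \<Rightarrow> complex) \<Rightarrow> nat \<Rightarrow> nat \<Rightarrow> complex" where
  "fmat n F M i j = mat_fun F (to_mat n M) $$ (i,j)"

lemma fmat:
  assumes "herm n M"
  shows "mat_fun F (to_mat n M) = to_mat n (fmat n F M)" "herm n (fmat n F M)"
    "fform n F M x = hform n (fmat n F M) x"
proof -
  obtain l u where dec: "spectral_dec n M l u" using spectral_dec_exists[OF assms] by blast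
  show "mat_fun F (to_mat n M) = to_mat n (fmat n F M)"
    unfolding fmat_def mat_fun_synth[OF dec] by (auto simp: mat_eq_iff)
  have "fmat n F M i j = synth n (\<lambda>j. F (l j)) u i j" if "i < n" "j < n" for i j
    unfolding fmat_def mat_fun_synth[OF dec] using that by simp
  then show "herm n (fmat n F M)"
    unfolding herm_def by (simp add: hermD[OF herm_synth])
  show "fform n F M x = hform n (fmat n F M) x"
    unfolding fform_def fmat_def ..
qed

lemma ball_herm_mats_on:
  "(\<forall>A\<in>herm_mats_on n I. P A) \<longleftrightarrow> (\<forall>M. herm n M \<longrightarrow> spec_in n M I \<longrightarrow> P (to_mat n M))"
proof safe
  fix A assume A: "A \<in> herm_mats_on n I" and P: "\<forall>M. herm n M \<longrightarrow> spec_in n M I \<longrightarrow> P (to_mat n M)"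
  define M where "M = (\<lambda>i j. A $$ (i,j))"
  have eq: "to_mat n M = A"
    using A unfolding M_def by (intro to_mat_entries) (auto simp: herm_mats_on_def hermitian_mats_def)
  have "herm n M" "spec_in n M I"
    using herm_mats_on_iff[of n M I] A unfolding eq by blast+
  then have "P (to_mat n M)" using P by blast
  then show "P A" unfolding eq .
qed (auto simp: herm_mats_on_iff)

text \<open>From here on only quadratic forms of matrices given by entries occur.\<close>

lemma n_monotone_iff:
  "n_monotone n I f \<longleftrightarrow>
    (\<forall>M M'. herm n M \<longrightarrow> herm n M' \<longrightarrow> spec_in n M I \<longrightarrow> spec_in n M' I \<longrightarrow>
       (\<forall>x. hform n M x \<le> hform n M' x) \<longrightarrow> (\<forall>x. fform n f M x \<le> fform n f M' x))"
proof -
  show ?thesis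
    unfolding n_monotone_def ball_herm_mats_on
    by (simp add: loewner_le_to_mat fmat cong: imp_cong) blast
qed

lemma n_convex_iff:
  "n_convex n I f \<longleftrightarrow>
    (\<forall>t\<in>{0..1}. \<forall>M M'. herm n M \<longrightarrow> herm n M' \<longrightarrow> spec_in n M I \<longrightarrow> spec_in n M' I \<longrightarrow>
       (\<forall>x. fform n f (\<lambda>i j. of_real t * M i j + of_real (1 - t) * M' i j) x
          \<le> t * fform n f M x + (1 - t) * fform n f M' x))"
proof -
  have comb: "of_real t \<cdot>\<^sub>m to_mat n R + of_real s \<cdot>\<^sub>m to_mat n R'
      = to_mat n (\<lambda>i j. of_real t * R i j + of_real s * R' i j)" for t s :: real and R R' :: "nat \<Rightarrow> nat \<Rightarrow> complex"
    by (auto simp: mat_eq_iff)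
  have hc: "herm n (\<lambda>i j. of_real t * R i j + of_real s * R' i j)" if "herm n R" "herm n R'" for t s R R'
    by (rule herm_combination) (fact that)+
  have key: "loewner_le n (mat_fun f (of_real t \<cdot>\<^sub>m to_mat n M + of_real (1 - t) \<cdot>\<^sub>m to_mat n M'))
        (of_real t \<cdot>\<^sub>m mat_fun f (to_mat n M) + of_real (1 - t) \<cdot>\<^sub>m mat_fun f (to_mat n M'))
     \<longleftrightarrow> (\<forall>x. fform n f (\<lambda>i j. of_real t * M i j + of_real (1 - t) * M' i j) x
          \<le> t * fform n f M x + (1 - t) * fform n f M' x)" if h: "herm n M" "herm n M'" for t M M'
    unfolding comb fmat(1)[OF h(1)] fmat(1)[OF h(2)] fmat(1)[OF hc[OF h]]
    by (subst loewner_le_to_mat) (simp_all only: fmat[OF h(1)] fmat[OF h(2)] fmat[OF hc[OF h]] hc hform_combination)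
  have swap: "(\<forall>M. h M \<longrightarrow> s M \<longrightarrow> (\<forall>M'. h M' \<longrightarrow> s M' \<longrightarrow> L M M'))
      \<longleftrightarrow> (\<forall>M M'. h M \<longrightarrow> h M' \<longrightarrow> s M \<longrightarrow> s M' \<longrightarrow> R M M')"
    if "\<And>M M'. h M \<Longrightarrow> h M' \<Longrightarrow> L M M' \<longleftrightarrow> R M M'" for h s :: "'x \<Rightarrow> bool" and L R
    using that by blast
  show ?thesis
    unfolding n_convex_def ball_herm_mats_on by (rule ball_cong[OF refl], rule swap, rule key)
qed

section \<open>Divided differences and derivatives\<close>

text \<open>Interpolation with prescribed values and first two derivatives, one node at a time: add a
  correction that is divisible by the cube of the product of the old factors, and choose its three
  free coefficients by solving a triangular system.\<close>

lemma hermite_interpolation: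
  fixes a b c :: "real \<Rightarrow> real"
  assumes "finite S"
  shows "\<exists>p. \<forall>s\<in>S. poly p s = a s \<and> poly (pderiv p) s = b s \<and> poly (pderiv (pderiv p)) s = c s"
  using assms
proof (induction S)
  case empty
  show ?case by simp
next
  case (insert z S)
  then obtain p where p: "\<And>s. s \<in> S \<Longrightarrow> poly p s = a s \<and> poly (pderiv p) s = b s \<and> poly (pderiv (pderiv p)) s = c s"
    by blast
  define W where "W = (\<Prod>s\<in>S. [:- s, 1:] ^ 3)"
  have W0: "poly W z \<noteq> 0"
    using insert.hyps by (auto simp: W_def poly_prod)
  have WS: "poly W s = 0 \<and> poly (pderiv W) s = 0 \<and> poly (pderiv (pderiv W)) s = 0" if s: "s \<in> S" for s
  proof -
    define L where "L = [:- s, 1:]"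
    have "W = L ^ 3 * (\<Prod>t\<in>S - {s}. [:- t, 1:] ^ 3)"
      unfolding W_def L_def by (rule prod.remove) (use insert.hyps s in auto)
    moreover have "poly L s = 0" by (simp add: L_def)
    ultimately show ?thesis
      by (simp add: pderiv_mult pderiv_add power3_eq_cube)
  qed
  define w0 w1 w2 where "w0 = poly W z" and "w1 = poly (pderiv W) z" and "w2 = poly (pderiv (pderiv W)) z"
  \<comment> \<open>values and derivatives of the correction at the new node: \<open>r0\<close>, \<open>r1\<close>, \<open>r2\<close> solve a triangular system\<close>
  define r0 where "r0 = (a z - poly p z) / w0"
  define r1 where "r1 = (b z - poly (pderiv p) z - w1 * r0) / w0"
  define r2 where "r2 = (c z - poly (pderiv (pderiv p)) z - w2 * r0 - 2 * w1 * r1) / (2 * w0)"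
  define r where "r = [:r0:] + [:- z, 1:] * ([:r1:] + [:- z, 1:] * [:r2:])"
  have r: "poly r z = r0" "poly (pderiv r) z = r1" "poly (pderiv (pderiv r)) z = 2 * r2"
    by (simp_all add: r_def pderiv_mult pderiv_add pderiv_pCons)
  have w0: "w0 \<noteq> 0" using W0 by (simp add: w0_def)
  have "poly (p + W * r) s = a s \<and> poly (pderiv (p + W * r)) s = b s \<and> poly (pderiv (pderiv (p + W * r))) s = c s"
    if s: "s \<in> insert z S" for s
  proof (cases "s = z")
    case False
    then have "s \<in> S" using s by simp
    then show ?thesis
      using p WS by (simp add: pderiv_mult pderiv_add)
  next
    case True
    have "poly (p + W * r) z = a z"
      using w0 by (simp add: r r0_def flip: w0_def)
    moreover have "poly (pderiv (p + W * r)) z = b z"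
      using w0 by (simp add: pderiv_mult pderiv_add r r1_def field_simps flip: w0_def w1_def)
    moreover have "poly (pderiv (pderiv (p + W * r))) z = c z"
      using w0 by (simp add: pderiv_mult pderiv_add r r2_def field_simps flip: w0_def w1_def w2_def)
    ultimately show ?thesis using True by simp
  qed
  then show ?case by blast
qed

lemma common_radius:
  fixes l :: "nat \<Rightarrow> real"
  assumes "\<And>k. k < n \<Longrightarrow> \<exists>d>0. \<forall>y. \<bar>y - l k\<bar> < d \<longrightarrow> P k y"
  shows "\<exists>\<delta>>0. \<forall>k<n. \<forall>y. \<bar>y - l k\<bar> < \<delta> \<longrightarrow> P k y"
proof -
  obtain d where d: "\<And>k. k < n \<Longrightarrow> d k > 0" "\<And>k y. k < n \<Longrightarrow> \<bar>y - l k\<bar> < d k \<Longrightarrow> P k y"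
    using assms by metis
  define \<delta> where "\<delta> = Min (insert 1 (d ` {..<n}))"
  have "\<delta> > 0" "\<And>k. k < n \<Longrightarrow> \<delta> \<le> d k" using d(1) by (auto simp: \<delta>_def)
  then show ?thesis using d(2) by (meson less_le_trans)
qed

lemma poly_second_order:
  fixes \<psi> :: "complex poly"
  assumes "\<epsilon> > 0"
  shows "\<forall>\<^sub>F h in at (0::real).
    cmod (poly \<psi> (of_real h) - coeff \<psi> 0 - of_real h * coeff \<psi> 1 - of_real (h\<^sup>2) * coeff \<psi> 2) \<le> \<epsilon> * h\<^sup>2"
proof -
  obtain c0 c1 c2 \<rho> where \<psi>: "\<psi> = pCons c0 (pCons c1 (pCons c2 \<rho>))"
    by (metis pCons_cases)
  have "((\<lambda>h::real. of_real h * poly \<rho> (of_real h)) \<longlongrightarrow> of_real 0 * poly \<rho> (of_real 0)) (at 0)"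
    by (intro tendsto_intros)
  then have "((\<lambda>h::real. cmod (of_real h * poly \<rho> (of_real h))) \<longlongrightarrow> 0) (at 0)"
    by (simp add: tendsto_norm_zero)
  then have "\<forall>\<^sub>F h in at (0::real). cmod (of_real h * poly \<rho> (of_real h)) < \<epsilon>"
    using assms by (rule order_tendstoD(2))
  then show ?thesis
  proof eventually_elim
    case (elim h)
    have "poly \<psi> (of_real h) - coeff \<psi> 0 - of_real h * coeff \<psi> 1 - of_real (h\<^sup>2) * coeff \<psi> 2
        = of_real (h\<^sup>2) * (of_real h * poly \<rho> (of_real h))"
      by (simp add: \<psi> power2_eq_square numeral_2_eq_2 algebra_simps)
    then have "cmod (poly \<psi> (of_real h) - coeff \<psi> 0 - of_real h * coeff \<psi> 1 - of_real (h\<^sup>2) * coeff \<psi> 2)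
        = h\<^sup>2 * cmod (of_real h * poly \<rho> (of_real h))"
      by (simp only: norm_mult) (simp add: norm_power)
    also have "\<dots> \<le> \<epsilon> * h\<^sup>2"
      using elim by (subst mult.commute) (intro mult_right_mono, auto)
    finally show ?case .
  qed
qed

lemma second_order_remainder:
  fixes G G' G'' :: "real \<Rightarrow> real"
  assumes G: "\<And>x. (G has_real_derivative G' x) (at x)" and G': "\<And>x. (G' has_real_derivative G'' x) (at x)"
    and cont: "isCont G'' z" and zero: "G z = 0" "G' z = 0" "G'' z = 0" and "\<epsilon> > 0"
  shows "\<exists>\<delta>>0. \<forall>x. \<bar>x - z\<bar> < \<delta> \<longrightarrow> \<bar>G x\<bar> \<le> \<epsilon> * (x - z)\<^sup>2"
proof -
  obtain \<delta> where \<delta>: "\<delta> > 0" "\<And>x. \<bar>x - z\<bar> < \<delta> \<Longrightarrow> \<bar>G'' x\<bar> < \<epsilon>"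
    using cont \<open>\<epsilon> > 0\<close> unfolding continuous_at_real_range zero by auto
  have seg: "\<bar>t - z\<bar> \<le> \<bar>x - z\<bar>" if "t \<in> closed_segment z x" for t x :: real
    using that by (auto simp: closed_segment_eq_real_ivl split: if_splits)
  have 1: "\<bar>G' x\<bar> \<le> \<epsilon> * \<bar>x - z\<bar>" if x: "\<bar>x - z\<bar> < \<delta>" for x
  proof -
    have "norm (G' x - G' z) \<le> \<epsilon> * norm (x - z)"
    proof (rule field_differentiable_bound[of "closed_segment z x" G' G''])
      fix t assume t: "t \<in> closed_segment z x"
      show "(G' has_field_derivative G'' t) (at t within closed_segment z x)"
        using G' by (rule DERIV_subset) simp
      show "norm (G'' t) \<le> \<epsilon>" using \<delta>(2)[of t] seg[OF t] x by simp
    qed auto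
    then show ?thesis using zero by simp
  qed
  have "\<bar>G x\<bar> \<le> \<epsilon> * (x - z)\<^sup>2" if x: "\<bar>x - z\<bar> < \<delta>" for x
  proof -
    have "norm (G x - G z) \<le> (\<epsilon> * \<bar>x - z\<bar>) * norm (x - z)"
    proof (rule field_differentiable_bound[of "closed_segment z x" G G'])
      fix t assume t: "t \<in> closed_segment z x"
      show "(G has_field_derivative G' t) (at t within closed_segment z x)"
        using G by (rule DERIV_subset) simp
      have "norm (G' t) \<le> \<epsilon> * \<bar>t - z\<bar>" using 1[of t] seg[OF t] x by simp
      also have "\<dots> \<le> \<epsilon> * \<bar>x - z\<bar>" using seg[OF t] \<open>\<epsilon> > 0\<close> by (intro mult_left_mono) auto
      finally show "norm (G' t) \<le> \<epsilon> * \<bar>x - z\<bar>" .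
    qed auto
    then show ?thesis using zero by (simp add: power2_eq_square mult.assoc abs_mult_self_eq)
  qed
  then show ?thesis using \<delta>(1) by blast
qed

text \<open>Continuously differentiable \<open>k\<close> times on the whole line.\<close>

primrec Ck :: "nat \<Rightarrow> (real \<Rightarrow> real) \<Rightarrow> bool" where
  "Ck 0 f \<longleftrightarrow> continuous_on UNIV f"
| "Ck (Suc k) f \<longleftrightarrow> (\<exists>f'. (\<forall>x. (f has_real_derivative f' x) (at x)) \<and> Ck k f')"

lemma Ck_imp_continuous: "Ck k f \<Longrightarrow> continuous_on UNIV f"
  by (cases k) (auto intro: DERIV_isCont continuous_at_imp_continuous_on)

lemma Ck_Suc_D: "Ck (Suc k) f \<Longrightarrow> Ck k f"
proof (induction k arbitrary: f)
  case 0
  then show ?case using Ck_imp_continuous[of "Suc 0" f] by simp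
next
  case (Suc k)
  then show ?case by auto
qed

lemma Ck_mono: "j \<le> k \<Longrightarrow> Ck k f \<Longrightarrow> Ck j f"
  by (induction rule: dec_induct) (blast dest: Ck_Suc_D)+

lemma Ck_add: "Ck k f \<Longrightarrow> Ck k g \<Longrightarrow> Ck k (\<lambda>x. f x + g x)"
proof (induction k arbitrary: f g)
  case 0
  then show ?case by (auto intro: continuous_on_add)
next
  case (Suc k)
  then obtain f' g' where "\<And>x. (f has_real_derivative f' x) (at x)" "Ck k f'"
    "\<And>x. (g has_real_derivative g' x) (at x)" "Ck k g'" by auto
  then show ?case
    using Suc.IH[of f' g'] by (auto intro!: exI[of _ "\<lambda>x. f' x + g' x"] DERIV_add)
qed

lemma Ck_mult: "Ck k f \<Longrightarrow> Ck k g \<Longrightarrow> Ck k (\<lambda>x. f x * g x)"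
proof (induction k arbitrary: f g)
  case 0
  then show ?case by (auto intro: continuous_on_mult)
next
  case (Suc k)
  then obtain f' g' where fg: "\<And>x. (f has_real_derivative f' x) (at x)" "Ck k f'"
    "\<And>x. (g has_real_derivative g' x) (at x)" "Ck k g'" by auto
  have "Ck k (\<lambda>x. f' x * g x + g' x * f x)"
    using fg(2,4) Suc.prems[THEN Ck_Suc_D] by (intro Ck_add Suc.IH)
  then show ?case
    using fg(1,3) by (auto intro!: exI[of _ "\<lambda>x. f' x * g x + g' x * f x"] DERIV_mult)
qed

lemma Ck_poly: "Ck k (poly p)"
proof (induction k arbitrary: p)
  case (Suc k)
  then show ?case by (auto intro!: exI[of _ "poly (pderiv p)"] poly_DERIV)
qed (auto intro: continuous_on_poly)

lemma Ck_Suc_deriv: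
  assumes "Ck (Suc k) f"
  shows "(f has_real_derivative deriv f x) (at x)" "Ck k (deriv f)"
proof -
  obtain f' where f': "\<And>x. (f has_real_derivative f' x) (at x)" "Ck k f'" using assms by auto
  then have "deriv f = f'" by (auto simp: fun_eq_iff intro: DERIV_imp_deriv)
  then show "(f has_real_derivative deriv f x) (at x)" "Ck k (deriv f)" using f' by auto
qed

lemma Ck_deriv_pow: "Ck (k + m) f \<Longrightarrow> Ck k ((deriv ^^ m) f)"
  by (induction m arbitrary: k) (auto simp flip: add_Suc dest!: Ck_Suc_deriv(2))

lemma deriv_poly: "deriv (poly p) = poly (pderiv p)" for p :: "real poly"
  by (auto simp: fun_eq_iff intro!: DERIV_imp_deriv poly_DERIV)

lemma deriv_pow_diff:
  "Ck k f \<Longrightarrow> Ck k g \<Longrightarrow> (deriv ^^ k) (\<lambda>x. f x - g x) = (\<lambda>x. (deriv ^^ k) f x - (deriv ^^ k) g x)"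
proof (induction k arbitrary: f g)
  case (Suc k)
  have "deriv (\<lambda>x. f x - g x) = (\<lambda>x. deriv f x - deriv g x)"
    using Suc.prems[THEN Ck_Suc_deriv(1)] by (auto simp: fun_eq_iff intro!: DERIV_imp_deriv DERIV_diff)
  then show ?case
    using Suc.IH[of "deriv f" "deriv g"] Suc.prems[THEN Ck_Suc_deriv(2)]
    by (simp add: funpow_Suc_right del: funpow.simps)
qed simp

lemma deriv_pow_poly:
  fixes p :: "real poly"
  assumes "degree p \<le> k"
  shows "(deriv ^^ k) (poly p) = (\<lambda>_. fact k * coeff p k)"
  using assms
proof (induction k arbitrary: p)
  case 0
  then obtain c where "p = [:c:]" by (auto elim: degree_eq_zeroE)
  then show ?case by (simp add: fun_eq_iff)
next
  case (Suc k)
  have "degree (pderiv p) \<le> k" using Suc.prems by (simp add: degree_pderiv)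
  from Suc.IH[OF this] show ?case
    by (simp add: funpow_Suc_right deriv_poly coeff_pderiv mult_ac del: funpow.simps)
qed

lemma rolle_zeros:
  fixes e :: "real \<Rightarrow> real"
  assumes e: "\<And>x. (e has_real_derivative e' x) (at x)"
  shows "finite Y \<Longrightarrow> card Y = Suc m \<Longrightarrow> (\<And>y. y \<in> Y \<Longrightarrow> e y = 0) \<Longrightarrow>
    \<exists>Z. finite Z \<and> card Z = m \<and> (\<forall>z\<in>Z. e' z = 0) \<and> Z \<subseteq> {Min Y..Max Y}"
proof (induction m arbitrary: Y)
  case 0
  show ?case by (rule exI[of _ "{}"]) auto
next
  case (Suc m)
  define b where "b = Max Y"
  define Y' where "Y' = Y - {b}"
  have Yne: "Y \<noteq> {}" using Suc.prems by auto
  have b: "b \<in> Y" unfolding b_def using Suc.prems Yne by simp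
  have Y': "finite Y'" "card Y' = Suc m" "Y' \<noteq> {}" "Y' \<subseteq> Y"
  proof -
    show "finite Y'" "Y' \<subseteq> Y" using Suc.prems by (auto simp: Y'_def)
    show "card Y' = Suc m" using Suc.prems b by (simp add: Y'_def)
    then show "Y' \<noteq> {}" by auto
  qed
  obtain Z where Z: "finite Z" "card Z = m" "\<forall>z\<in>Z. e' z = 0" "Z \<subseteq> {Min Y'..Max Y'}"
    using Suc.IH[OF Y'(1,2)] Suc.prems(3) Y'(4) by blast
  have "Max Y' \<in> Y'" using Y' by simp
  then have lt: "Max Y' < b" using Suc.prems(1) unfolding Y'_def b_def by (metis DiffE Max_ge insertCI order_less_le)
  have "\<exists>z>Max Y'. z < b \<and> e' z = 0"
  proof -
    have "e (Max Y') = e b" using Suc.prems(3) b \<open>Max Y' \<in> Y'\<close> Y'(4) by auto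
    from Rolle[OF lt this] show ?thesis
      using e by (metis DERIV_isCont DERIV_unique continuous_at_imp_continuous_on real_differentiable_def)
  qed
  then obtain z where z: "Max Y' < z" "z < b" "e' z = 0" by blast
  have "z \<notin> Z" using z Z(4) by auto
  moreover have "Min Y \<le> Min Y'" using Y' Suc.prems(1) by (intro Min_antimono) auto
  moreover have "Min Y' \<le> Max Y'" using Y' by simp
  ultimately show ?case
    using Z z by (intro exI[of _ "insert z Z"]) (force simp flip: b_def)
qed

text \<open>A function with \<open>k + 1\<close> zeros has a zero of its \<open>k\<close>-th derivative between them.\<close>

lemma rolle_iterated:
  fixes e :: "real \<Rightarrow> real"
  assumes "Ck k e" "finite Y" "card Y = Suc k" "\<And>y. y \<in> Y \<Longrightarrow> e y = 0"
  shows "\<exists>t\<in>{Min Y..Max Y}. (deriv ^^ k) e t = 0"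
  using assms
proof (induction k arbitrary: e Y)
  case 0
  then obtain y where "Y = {y}" by (auto simp: card_1_singleton_iff)
  with 0 show ?case by auto
next
  case (Suc k)
  obtain Z where Z: "finite Z" "card Z = Suc k" "\<forall>z\<in>Z. deriv e z = 0" "Z \<subseteq> {Min Y..Max Y}"
    using rolle_zeros[OF Ck_Suc_deriv(1)[OF Suc.prems(1)] Suc.prems(2,3,4)] by auto
  obtain t where t: "t \<in> {Min Z..Max Z}" "(deriv ^^ k) (deriv e) t = 0"
    using Suc.IH[OF Ck_Suc_deriv(2)[OF Suc.prems(1)] Z(1,2)] Z(3) by blast
  have "Z \<noteq> {}" using Z(2) by auto
  then have "Min Z \<in> {Min Y..Max Y}" "Max Z \<in> {Min Y..Max Y}" using Z(1,4) by (meson Max_in Min_in subsetD)+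
  then show ?case using t by (intro bexI[of _ t]) (auto simp: funpow_Suc_right simp del: funpow.simps)
qed

text \<open>The divided difference of \<open>g\<close> at the distinct nodes \<open>Y\<close>, in its symmetric form.\<close>

definition divdiff :: "real set \<Rightarrow> (real \<Rightarrow> real) \<Rightarrow> real" where
  "divdiff Y g = (\<Sum>y\<in>Y. g y / (\<Prod>z\<in>Y - {y}. y - z))"

definition lagrange_poly :: "real set \<Rightarrow> (real \<Rightarrow> real) \<Rightarrow> real poly" where
  "lagrange_poly Y g = (\<Sum>y\<in>Y. Polynomial.smult (g y / (\<Prod>z\<in>Y - {y}. y - z)) (\<Prod>z\<in>Y - {y}. [:- z, 1:]))"

lemma degree_prod_linear: "finite Z \<Longrightarrow> degree (\<Prod>z\<in>Z. [:- z, 1:] :: real poly) = card Z"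
  by (subst degree_prod_sum_eq) auto

lemma monic_prod_linear: "coeff (\<Prod>z\<in>Z. [:- z, 1:] :: real poly) (card Z) = 1" if "finite Z"
proof -
  have "lead_coeff (\<Prod>z\<in>Z. [:- z, 1:] :: real poly) = 1"
    by (simp add: lead_coeff_prod)
  then show ?thesis using degree_prod_linear[OF that] by simp
qed

lemma poly_lagrange_poly:
  assumes "finite Y" "x \<in> Y"
  shows "poly (lagrange_poly Y g) x = g x"
proof -
  have "poly (lagrange_poly Y g) x = (\<Sum>y\<in>Y. g y / (\<Prod>z\<in>Y - {y}. y - z) * (\<Prod>z\<in>Y - {y}. x - z))"
    by (simp add: lagrange_poly_def poly_sum poly_prod)
  also have "\<dots> = (\<Sum>y\<in>Y. if y = x then g x else 0)"
  proof (rule sum.cong[OF refl])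
    fix y assume y: "y \<in> Y"
    show "g y / (\<Prod>z\<in>Y - {y}. y - z) * (\<Prod>z\<in>Y - {y}. x - z) = (if y = x then g x else 0)"
    proof (cases "y = x")
      case True
      have "(\<Prod>z\<in>Y - {x}. x - z) \<noteq> 0" using assms by auto
      then show ?thesis using True by simp
    next
      case False
      have "(\<Prod>z\<in>Y - {y}. x - z) = 0" using assms False by (intro prod_zero) auto
      then show ?thesis using False by simp
    qed
  qed
  also have "\<dots> = g x" using assms by simp
  finally show ?thesis .
qed

lemma degree_lagrange_poly: "finite Y \<Longrightarrow> degree (lagrange_poly Y g) \<le> card Y - 1"
  unfolding lagrange_poly_def
  by (rule degree_sum_le) (auto intro!: order.trans[OF degree_smult_le] simp: degree_prod_linear)

lemma coeff_lagrange_poly: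
  assumes "finite Y"
  shows "coeff (lagrange_poly Y g) (card Y - 1) = divdiff Y g"
  unfolding lagrange_poly_def divdiff_def coeff_sum
proof (rule sum.cong[OF refl])
  fix y assume y: "y \<in> Y"
  have "card Y - 1 = card (Y - {y})" using assms y by simp
  then show "coeff (Polynomial.smult (g y / (\<Prod>z\<in>Y - {y}. y - z)) (\<Prod>z\<in>Y - {y}. [:- z, 1:])) (card Y - 1)
      = g y / (\<Prod>z\<in>Y - {y}. y - z)"
    using monic_prod_linear[of "Y - {y}"] assms by simp
qed

text \<open>Subtract the interpolation polynomial, whose leading coefficient is the divided difference, and
  apply Rolle repeatedly.\<close>

lemma divdiff_mean_value:
  assumes g: "Ck k g" and Y: "finite Y" "card Y = Suc k"
  shows "\<exists>t\<in>{Min Y..Max Y}. divdiff Y g = (deriv ^^ k) g t / fact k"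
proof -
  define P where "P = lagrange_poly Y g"
  have P: "(deriv ^^ k) (poly P) = (\<lambda>_. fact k * divdiff Y g)"
    using deriv_pow_poly[of P k] degree_lagrange_poly[OF Y(1), of g] coeff_lagrange_poly[OF Y(1), of g] Y(2)
    by (simp add: P_def)
  have e: "Ck k (\<lambda>x. g x - poly P x)"
    using Ck_add[OF g Ck_poly[of k "- P"]] by simp
  obtain t where t: "t \<in> {Min Y..Max Y}" "(deriv ^^ k) (\<lambda>x. g x - poly P x) t = 0"
    using rolle_iterated[OF e Y] Y(1) by (auto simp: P_def poly_lagrange_poly)
  then have "(deriv ^^ k) g t = fact k * divdiff Y g"
    unfolding deriv_pow_diff[OF g Ck_poly] P by simp
  then show ?thesis using t(1) by (intro bexI[of _ t]) auto
qed

section \<open>Second differences and Steklov averages\<close>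

text \<open>If the chord were exceeded, subtracting a suitable multiple of \<open>s(1 - s)\<close> would leave a function
  with a positive interior maximum; there its second differences are nonpositive, which forces those
  of \<open>\<phi>\<close> below \<open>- 2 D h\<^sup>2\<close>.\<close>

lemma convex_from_second_differences:
  fixes \<phi> :: "real \<Rightarrow> real"
  assumes cont: "continuous_on {0..1} \<phi>"
    and sd: "\<And>s \<epsilon>. 0 < s \<Longrightarrow> s < 1 \<Longrightarrow> 0 < \<epsilon> \<Longrightarrow>
      \<forall>\<^sub>F h in at_right 0. \<phi> (s + h) + \<phi> (s - h) - 2 * \<phi> s \<ge> - \<epsilon> * h\<^sup>2"
    and t: "t \<in> {0..1}"
  shows "\<phi> t \<le> (1 - t) * \<phi> 0 + t * \<phi> 1"
proof (rule ccontr)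
  assume neg: "\<not> ?thesis"
  define D where "D = \<phi> t - ((1 - t) * \<phi> 0 + t * \<phi> 1)"
  have D: "D > 0" using neg by (simp add: D_def)
  \<comment> \<open>the parabola vanishes at both ends and stays below \<open>D\<close>, so \<open>\<psi> t\<close> remains positive\<close>
  define \<psi> where "\<psi> s = \<phi> s - ((1 - s) * \<phi> 0 + s * \<phi> 1) - D * (s * (1 - s))" for s
  have "continuous_on {0..1} \<psi>"
    unfolding \<psi>_def by (intro continuous_intros cont)
  then obtain z where z: "z \<in> {0..1}" "\<And>s. s \<in> {0..1} \<Longrightarrow> \<psi> s \<le> \<psi> z"
    using continuous_attains_sup[of "{0..1::real}" \<psi>] by auto
  have "t * (1 - t) < 1"
  proof -
    have "t * (1 - t) = 1 / 4 - (t - 1 / 2)\<^sup>2" by (simp add: power2_eq_square field_simps)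
    then show ?thesis using zero_le_power2[of "t - 1 / 2"] by linarith
  qed
  then have "\<psi> t > 0"
    using D by (simp add: \<psi>_def flip: D_def)
  then have "\<psi> z > 0" using z(2)[OF t] by simp
  moreover have "\<psi> 0 = 0" "\<psi> 1 = 0" by (simp_all add: \<psi>_def)
  ultimately have z01: "0 < z" "z < 1" using z(1) by (auto simp: less_le)
  have "\<forall>\<^sub>F h in at_right 0. h < min z (1 - z) \<and> 0 < h"
    using z01 by (auto simp: eventually_at_right_less eventually_at_right intro!: exI[of _ "min z (1 - z)"])
  from eventually_happens'[OF _ eventually_conj[OF this sd[OF z01 D]]]
  obtain h where h: "0 < h" "h < z" "h < 1 - z" "\<phi> (z + h) + \<phi> (z - h) - 2 * \<phi> z \<ge> - D * h\<^sup>2"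
    by auto
  have "\<psi> (z + h) \<le> \<psi> z" "\<psi> (z - h) \<le> \<psi> z" using h z01 by (auto intro!: z(2))
  then have "\<psi> (z + h) + \<psi> (z - h) - 2 * \<psi> z \<le> 0" by simp
  moreover have "\<psi> (z + h) + \<psi> (z - h) - 2 * \<psi> z = \<phi> (z + h) + \<phi> (z - h) - 2 * \<phi> z + 2 * D * h\<^sup>2"
    by (simp add: \<psi>_def algebra_simps power2_eq_square)
  ultimately have "D * h\<^sup>2 \<le> 0" using h(4) by simp
  then show False using D h(1) by (simp add: mult_le_0_iff)
qed

text \<open>The Steklov average: the mean of \<open>f\<close> over \<open>[x, x + h]\<close>. Each application gains one derivative.\<close>

definition steklov :: "real \<Rightarrow> (real \<Rightarrow> real) \<Rightarrow> real \<Rightarrow> real" where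
  "steklov h f x = (1 / h) * integral {0..h} (\<lambda>s. f (x + s))"

lemma steklov_DERIV:
  assumes f: "continuous_on UNIV f" and h: "h > 0"
  shows "(steklov h f has_real_derivative (f (x + h) - f x) / h) (at x)"
proof -
  obtain g where g: "\<And>t. t \<in> {x - 1..x + h + 1} \<Longrightarrow> (g has_vector_derivative f t) (at t within {x - 1..x + h + 1})"
    using antiderivative_continuous[of "x - 1" "x + h + 1" f] continuous_on_subset[OF f] by blast
  have eq: "(g (y + h) - g y) / h = steklov h f y" if y: "y \<in> ball x 1" for y
  proof -
    have sub: "{y..y + h} \<subseteq> {x - 1..x + h + 1}" using y h by (auto simp: dist_real_def)
    have "(f has_integral (g (y + h) - g y)) {y..y + h}"
    proof (rule fundamental_theorem_of_calculus)
      fix t assume "t \<in> {y..y + h}"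
      then show "(g has_vector_derivative f t) (at t within {y..y + h})"
        using g sub by (meson has_vector_derivative_within_subset subsetD)
    qed (use h in simp)
    then have "integral {y..y + h} f = g (y + h) - g y" by (rule integral_unique)
    moreover have "integral {0..h} (\<lambda>s. f (y + s)) = integral {y..y + h} f"
      using integral_shift[of 0 y h f] continuous_on_subset[OF f]
      by (simp add: o_def add.commute)
    ultimately show ?thesis by (simp add: steklov_def)
  qed
  have d: "(g has_real_derivative f t) (at t)" if "x - 1 < t" "t < x + h + 1" for t
  proof -
    have "(g has_vector_derivative f t) (at t within {x - 1..x + h + 1})" using g that by auto
    then have "(g has_real_derivative f t) (at t within {x - 1..x + h + 1})"
      by (simp add: has_real_derivative_iff_has_vector_derivative)
    then show ?thesis
      using that by (simp add: at_within_Icc_at)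
  qed
  have "((\<lambda>y. (g (y + h) - g y) / h) has_real_derivative (f (x + h) - f x) / h) (at x)"
  proof (intro DERIV_cdivide DERIV_diff)
    show "(g has_real_derivative f x) (at x)" using d[of x] h by simp
    show "((\<lambda>y. g (y + h)) has_real_derivative f (x + h)) (at x)"
      using d[of "x + h"] h by (simp add: DERIV_shift[symmetric])
  qed
  then show ?thesis
    by (rule has_field_derivative_transform_within_open[of _ _ _ "ball x 1"]) (auto simp: eq)
qed

lemma Ck_shift: "Ck k f \<Longrightarrow> Ck k (\<lambda>x. f (x + h))"
proof (induction k arbitrary: f)
  case 0
  then show ?case by (auto intro!: continuous_on_compose2[of UNIV f] continuous_intros)
next
  case (Suc k)
  then obtain f' where "\<And>x. (f has_real_derivative f' x) (at x)" "Ck k f'" by auto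
  then show ?case
    using Suc.IH[of f'] by (auto intro!: exI[of _ "\<lambda>x. f' (x + h)"] simp: DERIV_shift[symmetric])
qed

lemma Ck_cmult: "Ck k f \<Longrightarrow> Ck k (\<lambda>x. c * f x)"
  using Ck_mult[OF Ck_poly[of k "[:c:]"], of f] by simp

lemma Ck_steklov:
  assumes "Ck k f" "h > 0"
  shows "Ck (Suc k) (steklov h f)"
proof -
  have "Ck k (\<lambda>x. (1 / h) * (f (x + h) + (- 1) * f x))"
    using assms(1) by (intro Ck_cmult Ck_add Ck_shift)
  moreover have "(steklov h f has_real_derivative (1 / h) * (f (x + h) + (- 1) * f x)) (at x)" for x
    using steklov_DERIV[OF Ck_imp_continuous[OF assms(1)] assms(2), of x] by (simp add: field_simps)
  ultimately show ?thesis
    unfolding Ck.simps by (intro exI[of _ "\<lambda>x. (1 / h) * (f (x + h) + (- 1) * f x)"]) blast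
qed

lemma Ck_steklov_pow:
  assumes "continuous_on UNIV f" "h > 0"
  shows "Ck k ((steklov h ^^ k) f)"
  by (induction k) (use assms Ck_steklov in auto)

lemma steklov_near:
  assumes f: "continuous_on UNIV f" and h: "h > 0"
    and near: "\<And>y. x \<le> y \<Longrightarrow> y \<le> x + h \<Longrightarrow> \<bar>f y - c\<bar> \<le> \<epsilon>"
  shows "\<bar>steklov h f x - c\<bar> \<le> \<epsilon>"
proof -
  have int: "(\<lambda>s. f (x + s)) integrable_on {0..h}"
    by (intro integrable_continuous_real continuous_on_compose2[OF f] continuous_intros) auto
  have "integral {0..h} (\<lambda>s. f (x + s)) \<le> integral {0..h} (\<lambda>s. c + \<epsilon>)"
    using near by (intro integral_le int) (auto simp: abs_le_iff algebra_simps)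
  moreover have "integral {0..h} (\<lambda>s. f (x + s)) \<ge> integral {0..h} (\<lambda>s. c - \<epsilon>)"
    using near by (intro integral_le int) (fastforce simp: abs_le_iff algebra_simps)+
  ultimately have "integral {0..h} (\<lambda>s. f (x + s)) \<le> h * (c + \<epsilon>)" "integral {0..h} (\<lambda>s. f (x + s)) \<ge> h * (c - \<epsilon>)"
    using h by simp_all
  then show ?thesis
    using h by (simp add: steklov_def abs_le_iff field_simps)
qed

lemma steklov_pow_near:
  assumes f: "continuous_on UNIV f" and h: "h > 0"
  shows "(\<And>y. x \<le> y \<Longrightarrow> y \<le> x + real k * h \<Longrightarrow> \<bar>f y - c\<bar> \<le> \<epsilon>) \<Longrightarrow> \<bar>(steklov h ^^ k) f x - c\<bar> \<le> \<epsilon>"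
proof (induction k arbitrary: x)
  case (Suc k)
  have "\<bar>steklov h ((steklov h ^^ k) f) x - c\<bar> \<le> \<epsilon>"
  proof (rule steklov_near[OF Ck_imp_continuous[OF Ck_steklov_pow[OF f h]] h])
    fix y assume y: "x \<le> y" "y \<le> x + h"
    show "\<bar>(steklov h ^^ k) f y - c\<bar> \<le> \<epsilon>"
      by (rule Suc.IH, rule Suc.prems) (use y in \<open>auto simp: algebra_simps\<close>)
  qed
  then show ?case by simp
qed simp

lemma steklov_pow_tendsto:
  assumes f: "continuous_on UNIV f"
  shows "((\<lambda>h. (steklov h ^^ k) f x) \<longlongrightarrow> f x) (at_right 0)"
  unfolding tendsto_iff
proof (intro allI impI)
  fix e :: real assume "e > 0"
  then have e2: "e / 2 > 0" by simp
  have "isCont f x" using f by (simp add: continuous_on_eq_continuous_at)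
  from this[unfolded continuous_at_real_range, rule_format, OF e2]
  obtain \<delta> where \<delta>: "\<delta> > 0" "\<And>y. \<bar>y - x\<bar> < \<delta> \<Longrightarrow> \<bar>f y - f x\<bar> < e / 2"
    by auto
  have "\<forall>\<^sub>F h in at_right 0. 0 < h \<and> h < \<delta> / (real k + 1)"
    using \<delta>(1) unfolding eventually_at_right_field by (intro exI[of _ "\<delta> / (real k + 1)"]) auto
  then show "\<forall>\<^sub>F h in at_right 0. dist ((steklov h ^^ k) f x) (f x) < e"
  proof eventually_elim
    case (elim h)
    have "\<bar>(steklov h ^^ k) f x - f x\<bar> \<le> e / 2"
    proof (rule steklov_pow_near[OF f])
      fix y assume y: "x \<le> y" "y \<le> x + real k * h"
      have "real k * h < \<delta>"
        using elim \<delta>(1) by (simp add: field_simps)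
      then show "\<bar>f y - f x\<bar> \<le> e / 2" using \<delta>(2)[of y] y by simp
    qed (use elim in simp)
    then show ?case using \<open>e > 0\<close> by (simp add: dist_real_def)
  qed
qed

section \<open>The quadratic form of f(M)\<close>

lemma spectral_dec_parseval:
  "spectral_dec n M l u \<Longrightarrow> (\<Sum>j<n. (cmod (inprod n x (u j)))\<^sup>2) = sqnorm n x"
  by (rule parseval_sqnorm) (simp add: spectral_dec_def)

lemma sqnorm_nonneg: "sqnorm n x \<ge> 0"
  by (simp add: sqnorm_def sum_nonneg)

lemma hform_eq_fform: "herm n M \<Longrightarrow> hform n M x = fform n (\<lambda>t. t) M x"
  using spectral_dec_exists[of n M] by (auto simp: hform_eq fform_eq)

lemma fform_linear:
  "herm n M \<Longrightarrow> fform n (\<lambda>t. c * F t + d * G t) M x = c * fform n F M x + d * fform n G M x"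
  using spectral_dec_exists[of n M]
  by (auto simp: fform_eq sum.distrib sum_distrib_left algebra_simps)

lemma fform_diff:
  "herm n M \<Longrightarrow> fform n (\<lambda>t. F t - G t) M x = fform n F M x - fform n G M x"
  using fform_linear[of n M 1 F "-1" G x] by simp

lemma fform_abs_le:
  assumes dec: "spectral_dec n M l u" and F: "\<And>j. j < n \<Longrightarrow> \<bar>F (l j)\<bar> \<le> K"
  shows "\<bar>fform n F M x\<bar> \<le> K * sqnorm n x"
proof -
  have "\<bar>fform n F M x\<bar> \<le> (\<Sum>j<n. \<bar>F (l j) * (cmod (inprod n x (u j)))\<^sup>2\<bar>)"
    unfolding fform_eq[OF dec] by (rule sum_abs)
  also have "\<dots> \<le> (\<Sum>j<n. K * (cmod (inprod n x (u j)))\<^sup>2)"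
    by (rule sum_mono) (auto simp: abs_mult F intro!: mult_right_mono)
  also have "\<dots> = K * sqnorm n x"
    by (simp add: spectral_dec_parseval[OF dec] flip: sum_distrib_left)
  finally show ?thesis .
qed

text \<open>An eigenvector of \<open>M\<close> is one of \<open>F(M)\<close>; used to evaluate \<open>F(M)\<close> on explicit test vectors
  without diagonalizing \<open>M\<close> completely.\<close>

lemma fform_eigenvector:
  assumes herm: "herm n M" and ev: "\<And>i. i < n \<Longrightarrow> app n M x i = of_real r * x i"
  shows "fform n F M x = F r * sqnorm n x"
proof -
  obtain l u where dec: "spectral_dec n M l u" using spectral_dec_exists[OF herm] by blast
  have "F (l j) * (cmod (inprod n x (u j)))\<^sup>2 = F r * (cmod (inprod n x (u j)))\<^sup>2" if "j < n" for j
  proof -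
    have "of_real (l j) * inprod n x (u j) = inprod n (app n M x) (u j)"
      using spectral_dec_inprod_app[OF dec that] by simp
    also have "\<dots> = inprod n (\<lambda>i. of_real r * x i) (u j)" by (rule inprod_cong) (auto simp: ev)
    also have "\<dots> = of_real r * inprod n x (u j)" by (simp add: inprod_def sum_distrib_left mult.assoc)
    finally have "l j = r \<or> inprod n x (u j) = 0" by auto
    then show ?thesis by auto
  qed
  then have "fform n F M x = (\<Sum>j<n. F r * (cmod (inprod n x (u j)))\<^sup>2)"
    unfolding fform_eq[OF dec] by (intro sum.cong refl) blast+
  then show ?thesis
    by (simp add: spectral_dec_parseval[OF dec] flip: sum_distrib_left)
qed

definition diagm :: "(nat \<Rightarrow> real) \<Rightarrow> nat \<Rightarrow> nat \<Rightarrow> complex" where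
  "diagm \<gamma> i j = (if i = j then of_real (\<gamma> i) else 0)"

lemma inprod_unit:
  assumes "j < n"
  shows "inprod n x (\<lambda>i. of_bool (i = j)) = x j"
proof -
  have "x i * cnj (of_bool (i = j)) = (if i = j then x j else 0)" for i by auto
  then show ?thesis using assms by (simp add: inprod_def)
qed

lemma spectral_dec_diagm: "spectral_dec n (diagm \<gamma>) \<gamma> (\<lambda>j i. of_bool (i = j))"
proof (rule spectral_decI)
  show "orthobasis n (\<lambda>j i. of_bool (i = j))"
    by (rule orthobasisI) (auto simp: inprod_unit)
  fix i j assume ij: "i < n" "j < n"
  have "diagm \<gamma> i m * of_bool (m = j) = (if m = j then diagm \<gamma> i j else 0)" for m by auto
  then show "app n (diagm \<gamma>) (\<lambda>i. of_bool (i = j)) i = of_real (\<gamma> j) * of_bool (i = j)"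
    using ij by (simp add: app_def diagm_def)
qed

lemma fform_diagm: "fform n F (diagm \<gamma>) x = (\<Sum>i<n. F (\<gamma> i) * (cmod (x i))\<^sup>2)"
  unfolding fform_eq[OF spectral_dec_diagm] by (rule sum.cong) (auto simp: inprod_unit)

lemma herm_diagm: "herm n (diagm \<gamma>)"
  using spectral_dec_diagm by (rule spectral_dec_herm)

lemma spec_inI:
  assumes dec: "spectral_dec n M l u" and I: "\<And>j. j < n \<Longrightarrow> l j \<in> I"
  shows "spec_in n M I"
  unfolding spec_in_def
proof (intro allI impI)
  fix l' u' j assume "spectral_dec n M l' u'" "j < n"
  then have "complex_of_real (l' j) \<in> complex_of_real ` l ` {..<n}"
    using spectrum_to_mat[OF dec] spectrum_to_mat[of n M l' u'] by auto
  then show "l' j \<in> I" using I by auto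
qed

lemma spec_in_diagm: "spec_in n (diagm \<gamma>) I \<longleftrightarrow> (\<forall>i<n. \<gamma> i \<in> I)"
  using spec_inI[OF spectral_dec_diagm, of n \<gamma> I] spec_inD[OF _ spectral_dec_diagm, of n \<gamma> I] by blast

lemma spec_in_mono: "spec_in n M I \<Longrightarrow> I \<subseteq> J \<Longrightarrow> spec_in n M J"
  unfolding spec_in_def by blast

lemma fform_conj_mat:
  assumes u: "orthobasis n u" and herm: "herm n M"
  shows "fform n F (conj_mat n u M) (coords n u x) = fform n F M x"
proof -
  obtain l w where dec: "spectral_dec n (conj_mat n u M) l w"
    using spectral_dec_exists[OF herm_conj_mat[OF herm]] by blast
  show ?thesis
    unfolding fform_eq[OF dec] fform_eq[OF spectral_dec_conj_mat[OF u dec]] inprod_combine ..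
qed

lemma spec_in_conj_mat:
  assumes u: "orthobasis n u" and herm: "herm n M" and "spec_in n M I"
  shows "spec_in n (conj_mat n u M) I"
  using spectral_dec_conj_mat[OF u] assms(3) unfolding spec_in_def by blast

lemma conj_mat_eigenbasis:
  assumes dec: "spectral_dec n M l u" and "i < n" "j < n"
  shows "conj_mat n u M i j = diagm l i j"
proof -
  have "conj_mat n u M i j = of_real (l i) * inprod n (u j) (u i)"
    unfolding conj_mat_def using dec assms(2) by (rule spectral_dec_inprod_app)
  then show ?thesis using assms by (simp add: diagm_def spectral_dec_def orthobasis_def)
qed

lemma to_mat_cong: "(\<And>i j. i < n \<Longrightarrow> j < n \<Longrightarrow> M i j = M' i j) \<Longrightarrow> to_mat n M = to_mat n M'"
  by (auto simp: to_mat_eq_iff)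

lemma fform_mat_cong:
  assumes "\<And>i j. i < n \<Longrightarrow> j < n \<Longrightarrow> M i j = M' i j" "\<And>i. i < n \<Longrightarrow> x i = x' i"
  shows "fform n F M x = fform n F M' x'"
proof -
  have eq: "to_mat n M = to_mat n M'" by (rule to_mat_cong) (rule assms(1))
  show ?thesis unfolding fform_def eq by (rule hform_cong) (auto simp: assms(2))
qed

lemma spec_in_cong: "(\<And>i j. i < n \<Longrightarrow> j < n \<Longrightarrow> M i j = M' i j) \<Longrightarrow> spec_in n M I = spec_in n M' I"
proof -
  assume eq: "\<And>i j. i < n \<Longrightarrow> j < n \<Longrightarrow> M i j = M' i j"
  have "spectral_dec n M l u = spectral_dec n M' l u" for l u
    unfolding spectral_dec_def using eq by (intro conj_cong refl iff_allI imp_cong) auto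
  then show ?thesis unfolding spec_in_def by simp
qed

definition frob :: "nat \<Rightarrow> (nat \<Rightarrow> nat \<Rightarrow> complex) \<Rightarrow> real" where
  "frob n E = (\<Sum>i<n. \<Sum>j<n. (cmod (E i j))\<^sup>2)"

lemma frob_nonneg: "frob n E \<ge> 0"
  by (simp add: frob_def sum_nonneg)

lemma frob_scale: "frob n (\<lambda>i j. of_real h * E i j) = h\<^sup>2 * frob n E"
  by (simp add: frob_def norm_mult power_mult_distrib sum_distrib_left)

lemma sqnorm_app_le: "sqnorm n (app n E x) \<le> frob n E * sqnorm n x"
proof -
  have "(cmod (app n E x i))\<^sup>2 \<le> (\<Sum>j<n. (cmod (E i j))\<^sup>2) * sqnorm n x" for i
  proof -
    have "cmod (app n E x i) \<le> (\<Sum>j<n. cmod (E i j) * cmod (x j))"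
      unfolding app_def by (rule order.trans[OF norm_sum]) (simp add: norm_mult)
    then have "(cmod (app n E x i))\<^sup>2 \<le> (\<Sum>j<n. cmod (E i j) * cmod (x j))\<^sup>2"
      by (rule power_mono) simp
    also have "\<dots> \<le> (\<Sum>j<n. (cmod (E i j))\<^sup>2) * (\<Sum>j<n. (cmod (x j))\<^sup>2)"
      by (rule Cauchy_Schwarz_ineq_sum)
    finally show ?thesis by (simp add: sqnorm_def)
  qed
  then show ?thesis
    unfolding sqnorm_def[of n "app n E x"] frob_def sum_distrib_right by (intro sum_mono)
qed

text \<open>If \<open>w\<close> is a unit eigenvector of \<open>M'\<close> for \<open>l'\<close>, then \<open>(M' - M) w\<close> has coordinates
  \<open>(l' - l\<^sub>k) w\<^sub>k\<close> in the eigenbasis of \<open>M\<close>. If all these differences were large, its norm would exceed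
  the Frobenius norm of \<open>M' - M\<close>.\<close>

lemma eigenvalue_perturbation:
  assumes dec: "spectral_dec n M l u" and dec': "spectral_dec n M' l' u'" and j: "j < n"
  shows "\<exists>k<n. (l' j - l k)\<^sup>2 \<le> frob n (\<lambda>i j. M' i j - M i j)"
proof (rule ccontr)
  define E where "E = (\<lambda>i j. M' i j - M i j)"
  assume "\<not> ?thesis"
  then have far: "frob n E < (l' j - l k)\<^sup>2" if "k < n" for k
    using that unfolding E_def by (meson not_le)
  define w where "w = u' j"
  have nw: "sqnorm n w = 1"
  proof -
    have "complex_of_real (sqnorm n w) = 1"
      using dec' j by (simp add: spectral_dec_def orthobasis_def w_def flip: inprod_self)
    then show ?thesis by simp
  qed
  have eq: "inprod n (app n E w) (u k) = of_real (l' j - l k) * inprod n w (u k)" if "k < n" for k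
  proof -
    have "inprod n (app n E w) (u k) = inprod n (app n M' w) (u k) - inprod n (app n M w) (u k)"
      by (simp add: inprod_def app_def E_def algebra_simps sum_subtractf)
    also have "inprod n (app n M' w) (u k) = inprod n (\<lambda>i. of_real (l' j) * w i) (u k)"
      by (rule inprod_cong) (auto simp: w_def spectral_dec_eigenvector[OF dec' j])
    also have "\<dots> = of_real (l' j) * inprod n w (u k)"
      by (simp add: inprod_def sum_distrib_left mult.assoc)
    finally show ?thesis
      using spectral_dec_inprod_app[OF dec that] by (simp add: algebra_simps)
  qed
  have "sqnorm n (app n E w) = (\<Sum>k<n. (l' j - l k)\<^sup>2 * (cmod (inprod n w (u k)))\<^sup>2)"
    unfolding spectral_dec_parseval[OF dec, symmetric]
    by (rule sum.cong) (auto simp: eq norm_mult power_mult_distrib simp del: of_real_diff)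
  moreover have "(\<Sum>k<n. (l' j - l k)\<^sup>2 * (cmod (inprod n w (u k)))\<^sup>2) > (\<Sum>k<n. frob n E * (cmod (inprod n w (u k)))\<^sup>2)"
  proof (rule sum_strict_mono_ex1)
    show "\<forall>k\<in>{..<n}. frob n E * (cmod (inprod n w (u k)))\<^sup>2 \<le> (l' j - l k)\<^sup>2 * (cmod (inprod n w (u k)))\<^sup>2"
      by (intro ballI mult_right_mono less_imp_le[OF far]) auto
    have "\<exists>k<n. inprod n w (u k) \<noteq> 0"
    proof (rule ccontr)
      assume "\<not> ?thesis"
      then have "sqnorm n w = 0" using spectral_dec_parseval[OF dec, of w] by simp
      then show False using nw by simp
    qed
    then obtain k where k: "k < n" "inprod n w (u k) \<noteq> 0" by blast
    then have "frob n E * (cmod (inprod n w (u k)))\<^sup>2 < (l' j - l k)\<^sup>2 * (cmod (inprod n w (u k)))\<^sup>2"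
      by (intro mult_strict_right_mono far) auto
    then show "\<exists>k\<in>{..<n}. frob n E * (cmod (inprod n w (u k)))\<^sup>2 < (l' j - l k)\<^sup>2 * (cmod (inprod n w (u k)))\<^sup>2"
      using k(1) by blast
  qed simp
  moreover have "(\<Sum>k<n. frob n E * (cmod (inprod n w (u k)))\<^sup>2) = frob n E"
    using spectral_dec_parseval[OF dec, of w] nw by (simp flip: sum_distrib_left)
  ultimately show False
    using sqnorm_app_le[of n E w] nw by simp
qed

lemma fform_near_spectrum:
  assumes dec: "spectral_dec n M l u" and herm: "herm n M'"
    and G: "\<And>k y. k < n \<Longrightarrow> (y - l k)\<^sup>2 \<le> frob n (\<lambda>i j. M' i j - M i j) \<Longrightarrow> \<bar>G y\<bar> \<le> K"
  shows "\<bar>fform n G M' x\<bar> \<le> K * sqnorm n x"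
proof -
  obtain l' u' where dec': "spectral_dec n M' l' u'" using spectral_dec_exists[OF herm] by blast
  show ?thesis
  proof (rule fform_abs_le[OF dec'])
    fix j assume "j < n"
    then show "\<bar>G (l' j)\<bar> \<le> K"
      using eigenvalue_perturbation[OF dec dec', of j] G by blast
  qed
qed

lemma spec_in_near:
  assumes dec: "spectral_dec n M l u"
    and I: "\<And>k y. k < n \<Longrightarrow> (y - l k)\<^sup>2 \<le> frob n (\<lambda>i j. M' i j - M i j) \<Longrightarrow> y \<in> I"
  shows "spec_in n M' I"
  unfolding spec_in_def using eigenvalue_perturbation[OF dec] I by blast

lemma inprod_app_pow:
  assumes dec: "spectral_dec n M l u"
  shows "j < n \<Longrightarrow> inprod n ((app n M ^^ m) x) (u j) = of_real (l j ^ m) * inprod n x (u j)"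
  by (induction m) (auto simp: spectral_dec_inprod_app[OF dec])

text \<open>For polynomials \<open>F\<close> the form is an explicit polynomial expression in the entries of \<open>M\<close>; this is
  the source of continuity and of the second order expansion.\<close>

lemma fform_poly:
  assumes herm: "herm n M"
  shows "fform n (poly p) M x = (\<Sum>m\<le>degree p. coeff p m * Re (inprod n ((app n M ^^ m) x) x))"
proof -
  obtain l u where dec: "spectral_dec n M l u" using spectral_dec_exists[OF herm] by blast
  have u: "orthobasis n u" using dec by (simp add: spectral_dec_def)
  have pw: "Re (inprod n ((app n M ^^ m) x) x) = (\<Sum>j<n. l j ^ m * (cmod (inprod n x (u j)))\<^sup>2)" for m
  proof -
    have "inprod n ((app n M ^^ m) x) x = (\<Sum>j<n. of_real (l j ^ m) * (inprod n x (u j) * cnj (inprod n x (u j))))"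
      by (rule trans[OF parseval[OF u, symmetric]], rule sum.cong) (simp_all add: inprod_app_pow[OF dec])
    also have "\<dots> = of_real (\<Sum>j<n. l j ^ m * (cmod (inprod n x (u j)))\<^sup>2)"
      by (simp only: complex_norm_square of_real_sum of_real_mult)
    finally show ?thesis by simp
  qed
  have "fform n (poly p) M x = (\<Sum>j<n. \<Sum>m\<le>degree p. coeff p m * (l j ^ m * (cmod (inprod n x (u j)))\<^sup>2))"
    unfolding fform_eq[OF dec] by (simp add: poly_altdef sum_distrib_right mult.assoc)
  also have "\<dots> = (\<Sum>m\<le>degree p. \<Sum>j<n. coeff p m * (l j ^ m * (cmod (inprod n x (u j)))\<^sup>2))"
    by (rule sum.swap)
  finally show ?thesis
    by (simp add: pw sum_distrib_left)
qed

lemma interpolating_poly: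
  fixes F :: "real \<Rightarrow> real"
  assumes "finite S"
  shows "\<exists>p. \<forall>s\<in>S. poly p s = F s"
  using hermite_interpolation[OF assms, of F] by blast

lemma near_spectrum_eventually:
  assumes conv: "\<And>i j. i < n \<Longrightarrow> j < n \<Longrightarrow> ((\<lambda>t. M t i j) \<longlongrightarrow> M0 i j) \<F>"
    and P: "\<And>k. k < n \<Longrightarrow> \<exists>d>0. \<forall>y. \<bar>y - l k\<bar> < d \<longrightarrow> P y"
  shows "\<forall>\<^sub>F t in \<F>. \<forall>k<n. \<forall>y. (y - l k)\<^sup>2 \<le> frob n (\<lambda>i j. M t i j - M0 i j) \<longrightarrow> P y"
proof -
  obtain \<delta> where \<delta>: "\<delta> > 0" "\<forall>k<n. \<forall>y. \<bar>y - l k\<bar> < \<delta> \<longrightarrow> P y"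
    using common_radius[of n l "\<lambda>_. P"] P by blast
  have "((\<lambda>t. frob n (\<lambda>i j. M t i j - M0 i j)) \<longlongrightarrow> frob n (\<lambda>i j. M0 i j - M0 i j)) \<F>"
    unfolding frob_def by (intro tendsto_intros conv) auto
  then have "\<forall>\<^sub>F t in \<F>. frob n (\<lambda>i j. M t i j - M0 i j) < \<delta>\<^sup>2"
    by (rule order_tendstoD(2)) (use \<delta>(1) in \<open>simp add: frob_def\<close>)
  then show ?thesis
  proof eventually_elim
    case (elim t)
    show ?case
    proof (intro allI impI)
      fix k y assume k: "k < n" "(y - l k)\<^sup>2 \<le> frob n (\<lambda>i j. M t i j - M0 i j)"
      then have "\<bar>y - l k\<bar>\<^sup>2 < \<delta>\<^sup>2" using elim by simp
      then have "\<bar>y - l k\<bar> < \<delta>" by (rule power_less_imp_less_base) (use \<delta>(1) in simp)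
      then show "P y" using \<delta>(2) k(1) by blast
    qed
  qed
qed

text \<open>Continuity of the functional calculus in the matrix: split \<open>F\<close> into a polynomial that agrees with
  it on the spectrum of the limit and a remainder that is small near that spectrum.\<close>

lemma fform_tendsto:
  assumes herm: "\<And>t. herm n (M t)" and herm0: "herm n M0" and F: "continuous_on UNIV F"
    and conv: "\<And>i j. i < n \<Longrightarrow> j < n \<Longrightarrow> ((\<lambda>t. M t i j) \<longlongrightarrow> M0 i j) \<F>"
  shows "((\<lambda>t. fform n F (M t) x) \<longlongrightarrow> fform n F M0 x) \<F>"
proof -
  obtain l u where dec: "spectral_dec n M0 l u" using spectral_dec_exists[OF herm0] by blast
  obtain p where p: "\<And>k. k < n \<Longrightarrow> poly p (l k) = F (l k)"
    using interpolating_poly[of "l ` {..<n}" F] by auto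
  define G where "G t = F t - poly p t" for t
  have G0: "G (l k) = 0" if "k < n" for k using p that by (simp add: G_def)
  have contG: "continuous_on UNIV G" unfolding G_def by (intro continuous_intros F)
  have "((\<lambda>t. fform n G (M t) x) \<longlongrightarrow> 0) \<F>"
    unfolding tendsto_iff
  proof (intro allI impI)
    fix e :: real assume "e > 0"
    define e' where "e' = e / (sqnorm n x + 1)"
    have sq: "sqnorm n x + 1 > 0" using sqnorm_nonneg[of n x] by linarith
    have e': "e' > 0" using \<open>e > 0\<close> sq by (simp add: e'_def)
    have small: "\<exists>d>0. \<forall>y. \<bar>y - l k\<bar> < d \<longrightarrow> \<bar>G y\<bar> < e'" if "k < n" for k
    proof -
      have "isCont G (l k)" using contG by (simp add: continuous_on_eq_continuous_at)
      from this[unfolded continuous_at_real_range, rule_format, OF e'] show ?thesis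
        using G0[OF that] by simp
    qed
    have "\<forall>\<^sub>F t in \<F>. \<forall>k<n. \<forall>y. (y - l k)\<^sup>2 \<le> frob n (\<lambda>i j. M t i j - M0 i j) \<longrightarrow> \<bar>G y\<bar> < e'"
      by (rule near_spectrum_eventually[OF conv small])
    then show "\<forall>\<^sub>F t in \<F>. dist (fform n G (M t) x) 0 < e"
    proof eventually_elim
      case (elim t)
      have "\<bar>fform n G (M t) x\<bar> \<le> e' * sqnorm n x"
        by (rule fform_near_spectrum[OF dec herm]) (use elim in \<open>blast intro: less_imp_le\<close>)
      also have "\<dots> < e" using \<open>e > 0\<close> sq by (simp add: e'_def field_simps)
      finally show ?case by (simp add: dist_real_def)
    qed
  qed
  moreover have "((\<lambda>t. fform n (poly p) (M t) x) \<longlongrightarrow> fform n (poly p) M0 x) \<F>"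
  proof -
    have "((\<lambda>t. (app n (M t) ^^ m) x i) \<longlongrightarrow> (app n M0 ^^ m) x i) \<F>" if "i < n" for m i
      using that
    proof (induction m arbitrary: i)
      case (Suc m)
      then show ?case by (simp add: app_def) (intro tendsto_intros conv; simp)
    qed simp
    then show ?thesis
      unfolding fform_poly[OF herm] fform_poly[OF herm0] inprod_def
      by (intro tendsto_intros) auto
  qed
  ultimately have "((\<lambda>t. fform n G (M t) x + fform n (poly p) (M t) x) \<longlongrightarrow> 0 + fform n (poly p) M0 x) \<F>"
    by (rule tendsto_add)
  moreover have "fform n G (M t) x + fform n (poly p) (M t) x = fform n F (M t) x" for t
    unfolding G_def using fform_diff[OF herm] by simp
  moreover have "fform n (poly p) M0 x = fform n F M0 x"
    using p unfolding fform_eq[OF dec] by simp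
  ultimately show ?thesis by simp
qed

text \<open>Bounds on the spectrum are bounds on the quadratic form, hence are inherited by everything in
  between and by convex combinations.\<close>

lemma spec_in_interval_iff:
  assumes herm: "herm n M"
  shows "spec_in n M {lo..hi} \<longleftrightarrow> (\<forall>x. lo * sqnorm n x \<le> hform n M x \<and> hform n M x \<le> hi * sqnorm n x)"
proof -
  obtain l u where dec: "spectral_dec n M l u" using spectral_dec_exists[OF herm] by blast
  show ?thesis
  proof
    assume s: "spec_in n M {lo..hi}"
    have b: "lo \<le> l j" "l j \<le> hi" if "j < n" for j
      using spec_inD[OF s dec that] by simp_all
    show "\<forall>x. lo * sqnorm n x \<le> hform n M x \<and> hform n M x \<le> hi * sqnorm n x"
      unfolding hform_eq[OF dec] spectral_dec_parseval[OF dec, symmetric] sum_distrib_left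
      by (intro allI conjI sum_mono mult_right_mono b) auto
  next
    assume b: "\<forall>x. lo * sqnorm n x \<le> hform n M x \<and> hform n M x \<le> hi * sqnorm n x"
    show "spec_in n M {lo..hi}"
    proof (rule spec_inI[OF dec])
      fix j assume j: "j < n"
      have 1: "inprod n (u j) (u k) = of_bool (j = k)" if "k < n" for k
        using dec j that by (simp add: spectral_dec_def orthobasis_def)
      have "complex_of_real (sqnorm n (u j)) = 1"
        using 1[OF j] by (simp flip: inprod_self)
      then have "sqnorm n (u j) = 1" by simp
      moreover have "hform n M (u j) = l j * sqnorm n (u j)"
        unfolding hform_eq_fform[OF herm]
        by (rule fform_eigenvector[OF herm]) (rule spectral_dec_eigenvector[OF dec j])
      ultimately show "l j \<in> {lo..hi}" using b[rule_format, of "u j"] by simp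
    qed
  qed
qed

section \<open>Secular equations and divided differences\<close>

definition nodal :: "(nat \<Rightarrow> real) \<Rightarrow> nat set \<Rightarrow> real poly" where
  "nodal a I = (\<Prod>i\<in>I. [:- a i, 1:])"

lemma poly_nodal: "poly (nodal a I) t = (\<Prod>i\<in>I. t - a i)"
  by (simp add: nodal_def poly_prod)

lemma degree_nodal: "finite I \<Longrightarrow> degree (nodal a I) = card I"
  unfolding nodal_def by (subst degree_prod_sum_eq) auto

lemma lead_coeff_nodal: "lead_coeff (nodal a I) = 1"
  unfolding nodal_def by (simp add: lead_coeff_prod)

lemma nodal_remove: "finite I \<Longrightarrow> i \<in> I \<Longrightarrow> nodal a I = [:- a i, 1:] * nodal a (I - {i})"
  unfolding nodal_def by (rule prod.remove)

lemma poly_nodal_remove: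
  "finite I \<Longrightarrow> i \<in> I \<Longrightarrow> poly (nodal a I) t = (t - a i) * poly (nodal a (I - {i})) t"
  unfolding poly_nodal by (rule prod.remove)

lemma poly_eq_zero_if_many_roots:
  fixes p :: "real poly"
  assumes "finite S" "\<And>s. s \<in> S \<Longrightarrow> poly p s = 0" "degree p < card S"
  shows "p = 0"
proof (rule ccontr)
  assume p: "p \<noteq> 0"
  have "card S \<le> card {x. poly p x = 0}"
    using assms(1,2) by (intro card_mono poly_roots_finite p) auto
  also have "\<dots> \<le> degree p" using p by (rule card_poly_roots_bound)
  finally show False using assms(3) by simp
qed

lemma monic_eq_nodal:
  fixes p :: "real poly"
  assumes p: "degree p = N" "lead_coeff p = 1" and l: "inj_on l {..<N}" "\<And>j. j < N \<Longrightarrow> poly p (l j) = 0"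
  shows "p = nodal l {..<N}"
proof (cases "N = 0")
  case True
  then obtain c where "p = [:c:]" using p(1) by (auto elim: degree_eq_zeroE)
  then show ?thesis using p True by (simp add: nodal_def one_pCons)
next
  case False
  define D where "D = p - nodal l {..<N}"
  have dn: "degree (nodal l {..<N}) = N" by (simp add: degree_nodal)
  have "coeff D N = 0"
    using p lead_coeff_nodal[of l "{..<N}"] dn by (simp add: D_def)
  moreover have "degree D \<le> N" unfolding D_def using degree_diff_le_max[of p "nodal l {..<N}"] p dn by simp
  ultimately have "degree D < N"
    using False by (metis le_neq_implies_less leading_coeff_0_iff degree_0 neq0_conv)
  moreover have "card (l ` {..<N}) = N" using l(1) by (simp add: card_image)
  ultimately have "D = 0"
    using l(2) by (intro poly_eq_zero_if_many_roots[of "l ` {..<N}"]) (auto simp: D_def poly_nodal)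
  then show ?thesis by (simp add: D_def)
qed

lemma poly_ext_real: "(\<And>t. poly p t = poly q t) \<Longrightarrow> p = q" for p q :: "real poly"
  using poly_eq_poly_eq_iff[of p q] by (simp add: fun_eq_iff)

text \<open>The numerator polynomial of \<open>\<Sum>\<^sub>i x\<^sub>i cnj v\<^sub>i / (t - a\<^sub>i)\<close> over the common denominator
  \<open>\<Prod>\<^sub>i (t - a\<^sub>i)\<close>.\<close>

definition numer :: "nat \<Rightarrow> (nat \<Rightarrow> real) \<Rightarrow> (nat \<Rightarrow> complex) \<Rightarrow> (nat \<Rightarrow> complex) \<Rightarrow> real \<Rightarrow> complex" where
  "numer n a v x t = (\<Sum>i<n. x i * cnj (v i) * of_real (poly (nodal a ({..<n} - {i})) t))"

text \<open>The common algebra of the rank one perturbation and of the bordered matrix. The vectors \<open>w j\<close> are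
  the first \<open>n\<close> entries of the eigenvectors of the larger or perturbed matrix. For \<open>diag a + v v\<^sup>*\<close>
  (\<open>e = 0\<close>, \<open>c = 1\<close>) the number \<open>s j\<close> is \<open>\<langle>w j, v\<rangle>\<close>; for the bordered matrix with corner entry \<open>g\<close>
  (\<open>e = 1\<close>, \<open>c = - g\<close>) it is the last entry of the eigenvector. In both cases the eigenvalues \<open>l\<close> are
  the roots of \<open>c + e t = \<Sum>\<^sub>i |v\<^sub>i|\<^sup>2 / (t - a\<^sub>i)\<close>.\<close>

locale secular =
  fixes n N :: nat and a l :: "nat \<Rightarrow> real" and v :: "nat \<Rightarrow> complex"
    and w :: "nat \<Rightarrow> nat \<Rightarrow> complex" and s :: "nat \<Rightarrow> complex" and c e :: real
  assumes a: "inj_on a {..<n}" and v: "\<And>i. i < n \<Longrightarrow> v i \<noteq> 0"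
    and ce: "e = 0 \<and> c = 1 \<and> N = n \<or> e = 1 \<and> N = Suc n"
    and ev1: "\<And>i j. j < N \<Longrightarrow> i < n \<Longrightarrow> of_real (l j - a i) * w j i = v i * s j"
    and ev2: "\<And>j. j < N \<Longrightarrow> (\<Sum>i<n. cnj (v i) * w j i) = of_real (c + e * l j) * s j"
    and orth: "\<And>j k. j < N \<Longrightarrow> k < N \<Longrightarrow> (\<Sum>i<n. w j i * cnj (w k i)) + of_real e * s j * cnj (s k) = of_bool (j = k)"
begin

lemma s_nz: "j < N \<Longrightarrow> s j \<noteq> 0"
proof
  assume j: "j < N" and s0: "s j = 0"
  have w0: "w j i = 0 \<or> l j = a i" if "i < n" for i using ev1[OF j that] s0 by auto
  have "w j i = 0" if i: "i < n" for i
  proof (rule ccontr)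
    assume nz: "w j i \<noteq> 0"
    have "w j k = 0" if "k < n" "k \<noteq> i" for k
      using w0[OF i] w0[OF that(1)] nz inj_onD[OF a, of i k] i that by auto
    then have "(\<Sum>k<n. cnj (v k) * w j k) = (\<Sum>k<n. if k = i then cnj (v i) * w j i else 0)"
      by (intro sum.cong) auto
    then have "cnj (v i) * w j i = 0" using ev2[OF j] s0 i by simp
    then show False using nz v[OF i] by simp
  qed
  then show False using orth[OF j j] s0 by simp
qed

lemma l_neq_a: "j < N \<Longrightarrow> i < n \<Longrightarrow> l j \<noteq> a i"
  using ev1[of j i] s_nz[of j] v[of i] by auto

lemma w_eq: "j < N \<Longrightarrow> i < n \<Longrightarrow> w j i = v i * s j / of_real (l j - a i)"
  using ev1[of j i] l_neq_a[of j i] by (simp add: field_simps del: of_real_diff)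

lemma l_inj: "inj_on l {..<N}"
proof (rule inj_onI, rule ccontr)
  fix j k assume jk: "j \<in> {..<N}" "k \<in> {..<N}" "l j = l k" "j \<noteq> k"
  then have j: "j < N" and k: "k < N" by auto
  define r where "r = s j / s k"
  have sj: "s j = r * s k" using s_nz[OF k] by (simp add: r_def)
  have "w j i = r * w k i" if "i < n" for i
    using w_eq[OF j that] w_eq[OF k that] jk(3) sj by simp
  then have "(\<Sum>i<n. w j i * cnj (w k i)) + of_real e * s j * cnj (s k)
      = r * ((\<Sum>i<n. w k i * cnj (w k i)) + of_real e * s k * cnj (s k))"
    by (simp add: sj sum_distrib_left algebra_simps)
  then have "r = 0" using orth[OF j k] orth[OF k k] jk(4) by simp
  then show False using s_nz[OF j] sj by simp
qed

abbreviation "v2 i \<equiv> (cmod (v i))\<^sup>2"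

definition T :: "real poly" where
  "T = [:c, e:] * nodal a {..<n} - (\<Sum>i<n. Polynomial.smult (v2 i) (nodal a ({..<n} - {i})))"

lemma secular_eq:
  assumes j: "j < N"
  shows "c + e * l j = (\<Sum>i<n. v2 i / (l j - a i))"
proof -
  have "of_real (c + e * l j) * s j = (\<Sum>i<n. cnj (v i) * (v i * s j / of_real (l j - a i)))"
    unfolding ev2[OF j, symmetric] by (intro sum.cong refl) (simp add: w_eq[OF j])
  also have "\<dots> = (\<Sum>i<n. of_real (v2 i / (l j - a i)) * s j)"
    by (intro sum.cong refl) (simp only: of_real_divide complex_norm_square, simp)
  also have "\<dots> = of_real (\<Sum>i<n. v2 i / (l j - a i)) * s j"
    by (simp add: sum_distrib_right)
  finally have "complex_of_real (c + e * l j) = of_real (\<Sum>i<n. v2 i / (l j - a i))"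
    using s_nz[OF j] by (simp del: of_real_add of_real_sum)
  then show ?thesis by (simp only: of_real_eq_iff)
qed

text \<open>The secular polynomial vanishes at every eigenvalue \<open>l j\<close>, with an explicit cofactor. Evaluating
  the cofactor at \<open>l j\<close> gives the product \<open>\<Prod>\<^sub>k (l j - l k)\<close> without differentiating.\<close>

lemma T_factor:
  assumes j: "j < N"
  shows "T = [:- l j, 1:] * (Polynomial.smult e (nodal a {..<n}) + (\<Sum>i<n. Polynomial.smult (v2 i / (l j - a i)) (nodal a ({..<n} - {i}))))"
proof (rule poly_ext_real)
  fix t
  have nod: "poly (nodal a {..<n}) t = (t - a i) * poly (nodal a ({..<n} - {i})) t" if "i < n" for i
    using poly_nodal_remove[of "{..<n}" i a] that by simp
  define P where "P i = poly (nodal a ({..<n} - {i})) t" for i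
  define X where "X = poly (nodal a {..<n}) t"
  have "(\<Sum>i<n. v2 i / (l j - a i) * ((t - l j) * P i)) = (\<Sum>i<n. v2 i / (l j - a i) * X - v2 i * P i)"
  proof (intro sum.cong refl)
    fix i assume i: "i \<in> {..<n}"
    have "X = (t - a i) * P i" using nod[of i] i by (simp add: X_def P_def)
    then have "(t - l j) * P i = X - (l j - a i) * P i" by (simp add: algebra_simps)
    then show "v2 i / (l j - a i) * ((t - l j) * P i) = v2 i / (l j - a i) * X - v2 i * P i"
      using l_neq_a[OF j, of i] i by (simp add: field_simps)
  qed
  also have "\<dots> = (c + e * l j) * X - (\<Sum>i<n. v2 i * P i)"
    unfolding secular_eq[OF j] by (simp add: sum_subtractf sum_distrib_right)
  finally have "(c + e * l j) * X - (\<Sum>i<n. v2 i * P i) = (t - l j) * (\<Sum>i<n. v2 i / (l j - a i) * P i)"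
    by (simp add: sum_distrib_left mult_ac)
  moreover have "poly T t = (c + e * t) * X - (\<Sum>i<n. v2 i * P i)"
    by (simp add: T_def X_def P_def poly_sum algebra_simps)
  ultimately show "poly T t = poly ([:- l j, 1:] * (Polynomial.smult e (nodal a {..<n}) + (\<Sum>i<n. Polynomial.smult (v2 i / (l j - a i)) (nodal a ({..<n} - {i}))))) t"
    by (simp add: poly_sum X_def P_def algebra_simps)
qed

lemma T_monic: "degree T = N" "lead_coeff T = 1"
proof -
  define S where "S = (\<Sum>i<n. Polynomial.smult (v2 i) (nodal a ({..<n} - {i})))"
  have L: "[:c, e:] \<noteq> 0" "degree [:c, e:] + n = N" "lead_coeff [:c, e:] = 1" using ce by auto
  have dn: "degree (nodal a {..<n}) = n" by (simp add: degree_nodal)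
  have nz: "nodal a {..<n} \<noteq> 0" using lead_coeff_nodal[of a "{..<n}"] by auto
  have dL: "degree ([:c, e:] * nodal a {..<n}) = N" using L dn nz by (subst degree_mult_eq) auto
  have lL: "lead_coeff ([:c, e:] * nodal a {..<n}) = 1" using L(3) lead_coeff_nodal[of a "{..<n}"] by (simp only: lead_coeff_mult)
  have "degree T = N \<and> lead_coeff T = 1"
  proof (cases "n = 0")
    case True
    then have "S = 0" by (simp add: S_def)
    then have "T = [:c, e:] * nodal a {..<n}" unfolding T_def S_def[symmetric] by simp
    then show ?thesis using dL lL by simp_all
  next
    case False
    have "degree S \<le> n - 1" unfolding S_def
      by (rule degree_sum_le) (auto intro!: order.trans[OF degree_smult_le] simp: degree_nodal)
    then have dS: "degree S < N" using False ce by auto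
    then have dT: "degree T = N"
      unfolding T_def S_def[symmetric] diff_conv_add_uminus using dL by (subst degree_add_eq_left) simp_all
    moreover have "lead_coeff T = 1"
      using lL dL dS unfolding dT unfolding T_def S_def[symmetric] by (simp add: coeff_eq_0)
    ultimately show ?thesis ..
  qed
  then show "degree T = N" "lead_coeff T = 1" by auto
qed

lemma T_eq_nodal: "T = nodal l {..<N}"
  using T_monic l_inj by (rule monic_eq_nodal) (simp add: T_factor)

lemma prod_l: "j < N \<Longrightarrow> (\<Prod>k\<in>{..<N} - {j}. l j - l k)
   = (\<Prod>i<n. l j - a i) * (e + (\<Sum>i<n. v2 i / (l j - a i)\<^sup>2))"
proof -
  assume j: "j < N"
  have "[:- l j, 1:] * nodal l ({..<N} - {j})
     = [:- l j, 1:] * (Polynomial.smult e (nodal a {..<n}) + (\<Sum>i<n. Polynomial.smult (v2 i / (l j - a i)) (nodal a ({..<n} - {i}))))"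
    using T_factor[OF j] T_eq_nodal nodal_remove[of "{..<N}" j l] j by simp
  then have eq: "nodal l ({..<N} - {j}) = Polynomial.smult e (nodal a {..<n}) + (\<Sum>i<n. Polynomial.smult (v2 i / (l j - a i)) (nodal a ({..<n} - {i})))"
    by (subst (asm) mult_left_cancel) auto
  have nod: "poly (nodal a ({..<n} - {i})) (l j) = (\<Prod>i<n. l j - a i) / (l j - a i)" if "i < n" for i
    using poly_nodal_remove[of "{..<n}" i a "l j"] that l_neq_a[OF j that]
    by (simp add: poly_nodal)
  show ?thesis
    using arg_cong[OF eq, of "\<lambda>p. poly p (l j)"]
    by (simp add: poly_sum nod poly_nodal[of l] poly_nodal[of a "{..<n}"] algebra_simps sum_distrib_left power2_eq_square)
qed

lemma prod_a: "i < n \<Longrightarrow> (\<Prod>j<N. a i - l j) = - v2 i * (\<Prod>k\<in>{..<n} - {i}. a i - a k)"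
proof -
  assume i: "i < n"
  have "(\<Prod>j<N. a i - l j) = poly T (a i)" by (simp add: T_eq_nodal poly_nodal)
  also have "\<dots> = - (\<Sum>k<n. v2 k * poly (nodal a ({..<n} - {k})) (a i))"
  proof -
    have "poly (nodal a {..<n}) (a i) = 0" using i by (auto simp: poly_nodal)
    then show ?thesis by (simp add: T_def poly_sum)
  qed
  also have "(\<Sum>k<n. v2 k * poly (nodal a ({..<n} - {k})) (a i))
     = (\<Sum>k<n. if k = i then v2 i * poly (nodal a ({..<n} - {i})) (a i) else 0)"
  proof (intro sum.cong refl)
    fix k assume "k \<in> {..<n}"
    have "poly (nodal a ({..<n} - {k})) (a i) = 0" if "k \<noteq> i"
      using i that unfolding poly_nodal by (intro prod_zero) auto
    then show "v2 k * poly (nodal a ({..<n} - {k})) (a i) = (if k = i then v2 i * poly (nodal a ({..<n} - {i})) (a i) else 0)"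
      by auto
  qed
  finally show ?thesis using i by (simp add: poly_nodal)
qed

definition nodes :: "real set" where
  "nodes = a ` {..<n} \<union> l ` {..<N}"

lemma nodes_disjoint: "a ` A \<inter> l ` B = {}" if "A \<subseteq> {..<n}" "B \<subseteq> {..<N}"
  using l_neq_a that by fastforce

lemma finite_nodes: "finite nodes" and card_nodes: "card nodes = n + N"
  unfolding nodes_def using nodes_disjoint[of "{..<n}" "{..<N}"] a l_inj
  by (auto simp: card_Un_disjoint card_image)

lemma divdiff_nodes:
  "divdiff nodes g =
    (\<Sum>i<n. g (a i) / ((\<Prod>k\<in>{..<n} - {i}. a i - a k) * (\<Prod>j<N. a i - l j))) +
    (\<Sum>j<N. g (l j) / ((\<Prod>i<n. l j - a i) * (\<Prod>k\<in>{..<N} - {j}. l j - l k)))"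
proof -
  have pr: "(\<Prod>z\<in>a ` A \<union> l ` B. y - z) = (\<Prod>i\<in>A. y - a i) * (\<Prod>j\<in>B. y - l j)"
    if AB: "A \<subseteq> {..<n}" "B \<subseteq> {..<N}" for A B y
  proof -
    have "(\<Prod>z\<in>a ` A \<union> l ` B. y - z) = (\<Prod>z\<in>a ` A. y - z) * (\<Prod>z\<in>l ` B. y - z)"
      using nodes_disjoint[OF AB] AB by (intro prod.union_disjoint) (auto intro: finite_subset)
    then show ?thesis
      using inj_on_subset[OF a AB(1)] inj_on_subset[OF l_inj AB(2)] by (simp add: prod.reindex)
  qed
  have na: "nodes - {a i} = a ` ({..<n} - {i}) \<union> l ` {..<N}" if "i < n" for i
    using that nodes_disjoint[of "{i}" "{..<N}"] inj_onD[OF a, of i] unfolding nodes_def by auto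
  have nl: "nodes - {l j} = a ` {..<n} \<union> l ` ({..<N} - {j})" if "j < N" for j
    using that nodes_disjoint[of "{..<n}" "{j}"] inj_onD[OF l_inj, of j] unfolding nodes_def by auto
  have "divdiff nodes g = (\<Sum>y\<in>a ` {..<n}. g y / (\<Prod>z\<in>nodes - {y}. y - z)) + (\<Sum>y\<in>l ` {..<N}. g y / (\<Prod>z\<in>nodes - {y}. y - z))"
    unfolding divdiff_def using nodes_disjoint[of "{..<n}" "{..<N}"]
    by (subst (1) nodes_def, subst sum.union_disjoint) auto
  also have "\<dots> = (\<Sum>i<n. g (a i) / (\<Prod>z\<in>nodes - {a i}. a i - z)) + (\<Sum>j<N. g (l j) / (\<Prod>z\<in>nodes - {l j}. l j - z))"
    using a l_inj by (simp add: sum.reindex)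
  finally show ?thesis by (simp add: na nl pr)
qed

text \<open>The weights match node by node. At \<open>a i\<close> the denominator of the divided difference is
  \<open>- |v\<^sub>i|\<^sup>2 \<Prod>\<^sub>k (a i - a k)\<^sup>2\<close>, and at \<open>l j\<close> it is \<open>\<Prod>\<^sub>i (l j - a i)\<^sup>2 / |s j|\<^sup>2\<close>; the factors
  besides \<open>|x\<^sub>i|\<^sup>2\<close> and \<open>|\<langle>x, w j\<rangle>|\<^sup>2\<close> cancel against \<open>|q|\<^sup>2\<close>.\<close>

theorem spectral_difference_eq_divdiff:
  "(\<Sum>j<N. F (l j) * (cmod (\<Sum>i<n. x i * cnj (w j i)))\<^sup>2) - (\<Sum>i<n. F (a i) * (cmod (x i))\<^sup>2)
    = divdiff nodes (\<lambda>t. F t * (cmod (numer n a v x t))\<^sup>2)"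
proof -
  have A: "F (a i) * (cmod (numer n a v x (a i)))\<^sup>2 / ((\<Prod>k\<in>{..<n} - {i}. a i - a k) * (\<Prod>j<N. a i - l j))
      = - (F (a i) * (cmod (x i))\<^sup>2)" if i: "i < n" for i
  proof -
    define p where "p = (\<Prod>k\<in>{..<n} - {i}. a i - a k)"
    have p: "p \<noteq> 0" unfolding p_def using i inj_onD[OF a, of i] by auto
    have "numer n a v x (a i) = (\<Sum>k<n. if k = i then x i * cnj (v i) * of_real p else 0)"
      unfolding numer_def
    proof (intro sum.cong refl)
      fix k assume "k \<in> {..<n}"
      have "poly (nodal a ({..<n} - {k})) (a i) = 0" if "k \<noteq> i"
        using i that unfolding poly_nodal by (intro prod_zero) auto
      then show "x k * cnj (v k) * of_real (poly (nodal a ({..<n} - {k})) (a i)) = (if k = i then x i * cnj (v i) * of_real p else 0)"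
        by (auto simp: poly_nodal p_def)
    qed
    then have "(cmod (numer n a v x (a i)))\<^sup>2 = (cmod (x i))\<^sup>2 * v2 i * p\<^sup>2"
      using i by (simp add: norm_mult power_mult_distrib)
    then show ?thesis
      using prod_a[OF i] v[OF i] p by (simp add: p_def[symmetric] power2_eq_square field_simps)
  qed
  have L: "F (l j) * (cmod (numer n a v x (l j)))\<^sup>2 / ((\<Prod>i<n. l j - a i) * (\<Prod>k\<in>{..<N} - {j}. l j - l k))
      = F (l j) * (cmod (\<Sum>i<n. x i * cnj (w j i)))\<^sup>2" if j: "j < N" for j
  proof -
    define X where "X = (\<Prod>i<n. l j - a i)"
    define Q where "Q = e + (\<Sum>i<n. v2 i / (l j - a i)\<^sup>2)"
    have X: "X \<noteq> 0" unfolding X_def using l_neq_a[OF j] by auto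
    have Q: "(cmod (s j))\<^sup>2 * Q = 1"
    proof -
      have "w j i * cnj (w j i) = of_real ((cmod (s j))\<^sup>2 * (v2 i / (l j - a i)\<^sup>2))" if "i < n" for i
        unfolding complex_norm_square[symmetric] of_real_eq_iff
        by (simp add: w_eq[OF j that] norm_mult norm_divide power_mult_distrib power_divide del: of_real_diff)
      then have "complex_of_real ((cmod (s j))\<^sup>2 * Q) = 1"
        using orth[OF j j] complex_norm_square[of "s j"]
        by (simp add: Q_def distrib_left sum_distrib_left mult_ac add_ac)
      then show ?thesis by (simp only: of_real_eq_1_iff)
    qed
    have "(\<Sum>i<n. x i * cnj (w j i)) = cnj (s j) / of_real X * numer n a v x (l j)"
      unfolding numer_def sum_distrib_left
    proof (intro sum.cong refl)
      fix i assume "i \<in> {..<n}"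
      then have i: "i < n" by simp
      define P where "P = poly (nodal a ({..<n} - {i})) (l j)"
      have XP: "X = (l j - a i) * P"
        using poly_nodal_remove[of "{..<n}" i a "l j"] i by (simp add: X_def P_def poly_nodal)
      then have P: "P \<noteq> 0" using X by auto
      show "x i * cnj (w j i) = cnj (s j) / of_real X * (x i * cnj (v i) * of_real (poly (nodal a ({..<n} - {i})) (l j)))"
        unfolding P_def[symmetric] XP of_real_mult
        using P l_neq_a[OF j i] by (simp add: w_eq[OF j i] field_simps del: of_real_diff)
    qed
    then have "(cmod (\<Sum>i<n. x i * cnj (w j i)))\<^sup>2 = (cmod (s j))\<^sup>2 / X\<^sup>2 * (cmod (numer n a v x (l j)))\<^sup>2"
      by (simp add: norm_mult norm_divide power_mult_distrib power_divide)
    moreover have "(cmod (s j))\<^sup>2 = 1 / Q" using Q by (metis eq_divide_eq mult_zero_right zero_neq_one)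
    ultimately show ?thesis
      unfolding prod_l[OF j] X_def[symmetric] Q_def[symmetric] by (simp add: power2_eq_square)
  qed
  show ?thesis
    unfolding divdiff_nodes using A L by (simp add: sum_negf)
qed

end

definition rank1 :: "(nat \<Rightarrow> real) \<Rightarrow> (nat \<Rightarrow> complex) \<Rightarrow> nat \<Rightarrow> nat \<Rightarrow> complex" where
  "rank1 a v i j = diagm a i j + v i * cnj (v j)"

text \<open>The matrix of order \<open>n + 1\<close> with blocks \<open>diag a, v, v\<^sup>*, g\<close>.\<close>

definition bordered :: "nat \<Rightarrow> (nat \<Rightarrow> real) \<Rightarrow> (nat \<Rightarrow> complex) \<Rightarrow> real \<Rightarrow> nat \<Rightarrow> nat \<Rightarrow> complex" where
  "bordered n a v g i j =
    (if i < n \<and> j < n then diagm a i j else if i < n then v i else if j < n then cnj (v j) else of_real g)"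

definition pad :: "nat \<Rightarrow> (nat \<Rightarrow> complex) \<Rightarrow> nat \<Rightarrow> complex" where
  "pad n x i = (if i < n then x i else 0)"

lemma herm_rank1: "herm n (rank1 a v)"
  by (simp add: herm_def rank1_def diagm_def)

lemma herm_bordered: "herm (Suc n) (bordered n a v g)"
  by (simp add: herm_def bordered_def diagm_def)

lemma app_diagm: "i < n \<Longrightarrow> app n (diagm a) x i = of_real (a i) * x i"
proof -
  assume i: "i < n"
  have "app n (diagm a) x i = (\<Sum>j<n. if j = i then of_real (a i) * x i else 0)"
    unfolding app_def by (rule sum.cong) (auto simp: diagm_def)
  then show ?thesis using i by simp
qed

lemma app_rank1: "i < n \<Longrightarrow> app n (rank1 a v) x i = of_real (a i) * x i + v i * inprod n x v"
proof -
  assume i: "i < n"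
  have "app n (rank1 a v) x i = app n (diagm a) x i + v i * inprod n x v"
    by (simp add: app_def rank1_def inprod_def distrib_right distrib_left sum.distrib sum_distrib_left mult_ac)
  then show ?thesis using i by (simp add: app_diagm)
qed

lemma app_bordered:
  "i < n \<Longrightarrow> app (Suc n) (bordered n a v g) x i = of_real (a i) * x i + v i * x n"
  "app (Suc n) (bordered n a v g) x n = (\<Sum>i<n. cnj (v i) * x i) + of_real g * x n"
proof -
  assume i: "i < n"
  have "(\<Sum>j<n. bordered n a v g i j * x j) = app n (diagm a) x i"
    unfolding app_def by (rule sum.cong) (auto simp: bordered_def i)
  then show "app (Suc n) (bordered n a v g) x i = of_real (a i) * x i + v i * x n"
    using i by (simp add: app_def[of "Suc n"] app_diagm) (simp add: bordered_def)
next
  have "(\<Sum>j<n. bordered n a v g n j * x j) = (\<Sum>i<n. cnj (v i) * x i)"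
    by (rule sum.cong) (auto simp: bordered_def)
  then show "app (Suc n) (bordered n a v g) x n = (\<Sum>i<n. cnj (v i) * x i) + of_real g * x n"
    by (simp add: app_def) (simp add: bordered_def)
qed

theorem rank1_divdiff:
  assumes inj: "inj_on a {..<n}" and aJ: "\<And>i. i < n \<Longrightarrow> a i \<in> J" and v: "\<And>i. i < n \<Longrightarrow> v i \<noteq> 0"
    and spec: "spec_in n (rank1 a v) J"
  shows "\<exists>Y. finite Y \<and> Y \<subseteq> J \<and> card Y = 2 * n \<and>
    (\<forall>F x. fform n F (rank1 a v) x - fform n F (diagm a) x = divdiff Y (\<lambda>t. F t * (cmod (numer n a v x t))\<^sup>2))"
proof -
  obtain l u where dec: "spectral_dec n (rank1 a v) l u" using spectral_dec_exists[OF herm_rank1] by blast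
  define s where "s j = inprod n (u j) v" for j
  interpret secular n n a l v u s 1 0
  proof
    fix i j assume "j < n" "i < n"
    then show "of_real (l j - a i) * u j i = v i * s j"
      using spectral_dec_eigenvector[OF dec, of j i] by (simp add: app_rank1 s_def algebra_simps)
  next
    fix j k assume "j < n" "k < n"
    then show "(\<Sum>i<n. u j i * cnj (u k i)) + of_real 0 * s j * cnj (s k) = of_bool (j = k)"
      using dec by (simp add: spectral_dec_def orthobasis_def inprod_def)
  qed (use inj v in \<open>auto simp: s_def inprod_def mult.commute\<close>)
  have "nodes \<subseteq> J" using aJ spec_inD[OF spec dec] by (auto simp: nodes_def)
  moreover have "fform n F (rank1 a v) x - fform n F (diagm a) x = divdiff nodes (\<lambda>t. F t * (cmod (numer n a v x t))\<^sup>2)" for F x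
    unfolding spectral_difference_eq_divdiff[symmetric] fform_eq[OF dec] fform_diagm inprod_def ..
  ultimately show ?thesis
    using finite_nodes card_nodes by (intro exI[of _ nodes]) auto
qed

theorem bordered_divdiff:
  assumes inj: "inj_on a {..<n}" and aJ: "\<And>i. i < n \<Longrightarrow> a i \<in> J" and v: "\<And>i. i < n \<Longrightarrow> v i \<noteq> 0"
    and spec: "spec_in (Suc n) (bordered n a v g) J"
  shows "\<exists>Y. finite Y \<and> Y \<subseteq> J \<and> card Y = Suc (2 * n) \<and>
    (\<forall>F x. fform (Suc n) F (bordered n a v g) (pad n x) - fform n F (diagm a) x
       = divdiff Y (\<lambda>t. F t * (cmod (numer n a v x t))\<^sup>2))"
proof -
  obtain l u where dec: "spectral_dec (Suc n) (bordered n a v g) l u"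
    using spectral_dec_exists[OF herm_bordered] by blast
  define s where "s j = u j n" for j
  interpret secular n "Suc n" a l v u s "- g" 1
  proof
    fix i j assume "j < Suc n" "i < n"
    then show "of_real (l j - a i) * u j i = v i * s j"
      using spectral_dec_eigenvector[OF dec, of j i] by (simp add: app_bordered s_def algebra_simps)
  next
    fix j assume "j < Suc n"
    then show "(\<Sum>i<n. cnj (v i) * u j i) = of_real (- g + 1 * l j) * s j"
      using spectral_dec_eigenvector[OF dec, of j n] by (simp add: app_bordered s_def algebra_simps)
  next
    fix j k assume "j < Suc n" "k < Suc n"
    then have "inprod (Suc n) (u j) (u k) = of_bool (j = k)"
      using dec by (simp add: spectral_dec_def orthobasis_def)
    then show "(\<Sum>i<n. u j i * cnj (u k i)) + of_real 1 * s j * cnj (s k) = of_bool (j = k)"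
      by (simp add: inprod_def s_def)
  qed (use inj v in auto)
  have "nodes \<subseteq> J" using aJ spec_inD[OF spec dec] by (auto simp: nodes_def)
  moreover have "fform (Suc n) F (bordered n a v g) (pad n x) - fform n F (diagm a) x
      = divdiff nodes (\<lambda>t. F t * (cmod (numer n a v x t))\<^sup>2)" for F x
  proof -
    have "inprod (Suc n) (pad n x) (u j) = (\<Sum>i<n. x i * cnj (u j i))" for j
      by (simp add: inprod_def pad_def)
    then show ?thesis
      unfolding spectral_difference_eq_divdiff[symmetric] fform_eq[OF dec] fform_diagm by simp
  qed
  ultimately show ?thesis
    using finite_nodes card_nodes by (intro exI[of _ nodes]) auto
qed

definition numer_part :: "nat \<Rightarrow> (nat \<Rightarrow> real) \<Rightarrow> (nat \<Rightarrow> real) \<Rightarrow> real poly" where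
  "numer_part n a c = (\<Sum>i<n. Polynomial.smult (c i) (nodal a ({..<n} - {i})))"

lemma degree_numer_part: "n > 0 \<Longrightarrow> degree (numer_part n a c) < n"
proof -
  assume n: "n > 0"
  have "degree (numer_part n a c) \<le> n - 1" unfolding numer_part_def
    by (rule degree_sum_le) (auto intro!: order.trans[OF degree_smult_le] simp: degree_nodal)
  then show ?thesis using n by simp
qed

lemma cmod_numer_sq:
  "(cmod (numer n a v x t))\<^sup>2 = (poly (numer_part n a (\<lambda>i. Re (x i * cnj (v i)))) t)\<^sup>2
     + (poly (numer_part n a (\<lambda>i. Im (x i * cnj (v i)))) t)\<^sup>2"
proof -
  have "Re (numer n a v x t) = poly (numer_part n a (\<lambda>i. Re (x i * cnj (v i)))) t"
    by (simp add: numer_def numer_part_def poly_sum)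
  moreover have "Im (numer n a v x t) = poly (numer_part n a (\<lambda>i. Im (x i * cnj (v i)))) t"
    by (simp add: numer_def numer_part_def poly_sum)
  ultimately show ?thesis by (simp add: cmod_power2)
qed

text \<open>Lagrange interpolation: every real polynomial of degree less than \<open>n\<close> occurs as a numerator, for
  a suitable choice of the test vector.\<close>

lemma interpolation_at_nodes:
  assumes a: "inj_on a {..<n}" and q: "degree q < n"
  shows "numer_part n a (\<lambda>i. poly q (a i) / (\<Prod>k\<in>{..<n} - {i}. a i - a k)) = q" (is "?p = q")
proof -
  have "?p - q = 0"
  proof (rule poly_eq_zero_if_many_roots)
    show "finite (a ` {..<n})" by simp
    show "degree (?p - q) < card (a ` {..<n})"
    proof -
      have "degree ?p < n" using degree_numer_part q by simp
      then have "degree (?p - q) < n"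
        using q by (intro le_less_trans[OF degree_diff_le_max]) simp
      then show ?thesis using a by (simp add: card_image)
    qed
    fix s assume "s \<in> a ` {..<n}"
    then obtain i where i: "i < n" "s = a i" by auto
    have "poly ?p (a i) = (\<Sum>k<n. if k = i then poly q (a i) else 0)"
      unfolding numer_part_def poly_sum
    proof (intro sum.cong refl)
      fix k assume k: "k \<in> {..<n}"
      define P where "P = (\<Prod>m\<in>{..<n} - {k}. a k - a m)"
      have "P \<noteq> 0" unfolding P_def using k inj_onD[OF a, of k] by auto
      moreover have "poly (nodal a ({..<n} - {k})) (a i) = (if k = i then P else 0)"
        using i unfolding poly_nodal P_def by (auto intro!: prod_zero)
      ultimately show "poly (Polynomial.smult (poly q (a k) / (\<Prod>m\<in>{..<n} - {k}. a k - a m)) (nodal a ({..<n} - {k}))) (a i) = (if k = i then poly q (a i) else 0)"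
        by (simp add: P_def[symmetric])
    qed
    then show "poly (?p - q) s = 0" using i by simp
  qed
  then show ?thesis by simp
qed

lemma divdiff_add: "divdiff Y (\<lambda>t. f t + g t) = divdiff Y f + divdiff Y g"
  by (simp add: divdiff_def add_divide_distrib sum.distrib)

lemma divdiff_cmult: "divdiff Y (\<lambda>t. c * f t) = c * divdiff Y f"
  by (simp add: divdiff_def sum_distrib_left)

definition local_cond :: "nat \<Rightarrow> nat \<Rightarrow> real set \<Rightarrow> (real \<Rightarrow> real) \<Rightarrow> bool" where
  "local_cond n k J F \<longleftrightarrow> (\<forall>q t. degree q < n \<longrightarrow> t \<in> J \<longrightarrow> (deriv ^^ k) (\<lambda>t. F t * (poly q t)\<^sup>2) t \<ge> 0)"

lemma Ck_times_square: "Ck k F \<Longrightarrow> Ck k (\<lambda>t. F t * (poly q t)\<^sup>2)"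
  unfolding power2_eq_square by (intro Ck_mult Ck_poly)

lemma is_interval_Min_Max:
  fixes J :: "real set"
  assumes "is_interval J" "finite Y" "Y \<noteq> {}" "Y \<subseteq> J" "t \<in> {Min Y..Max Y}"
  shows "t \<in> J"
proof -
  have "Min Y \<in> J" "Max Y \<in> J" using assms by (meson Min_in Max_in subsetD)+
  then show ?thesis using mem_is_interval_1_I[OF assms(1), of "Min Y" "Max Y" t] assms(5) by simp
qed

text \<open>By the mean value theorem, applied to the squares of the real and imaginary part of the
  numerator polynomial.\<close>

lemma local_cond_divdiff:
  assumes F: "Ck k F" and lc: "local_cond n k J F" and J: "is_interval J" and n: "n > 0"
    and Y: "finite Y" "Y \<subseteq> J" "card Y = Suc k"
  shows "divdiff Y (\<lambda>t. F t * (cmod (numer n a v x t))\<^sup>2) \<ge> 0"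
proof -
  have *: "divdiff Y (\<lambda>t. F t * (poly (numer_part n a c) t)\<^sup>2) \<ge> 0" for c
  proof -
    obtain t where t: "t \<in> {Min Y..Max Y}"
      "divdiff Y (\<lambda>t. F t * (poly (numer_part n a c) t)\<^sup>2) = (deriv ^^ k) (\<lambda>t. F t * (poly (numer_part n a c) t)\<^sup>2) t / fact k"
      using divdiff_mean_value[OF Ck_times_square[OF F] Y(1,3)] by blast
    have "Y \<noteq> {}" using Y(3) by auto
    then have "t \<in> J" using is_interval_Min_Max[OF J Y(1) _ Y(2) t(1)] by blast
    then show ?thesis using lc degree_numer_part[OF n] t(2) by (simp add: local_cond_def)
  qed
  show ?thesis
    unfolding cmod_numer_sq distrib_left divdiff_add using * by (intro add_nonneg_nonneg)
qed

section \<open>Second order comparison\<close>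

definition pencil :: "(nat \<Rightarrow> nat \<Rightarrow> complex) \<Rightarrow> (nat \<Rightarrow> nat \<Rightarrow> complex) \<Rightarrow> real \<Rightarrow> nat \<Rightarrow> nat \<Rightarrow> complex" where
  "pencil M E h i j = M i j + of_real h * E i j"

lemma app_pencil: "app n (pencil M E h) x i = app n M x i + of_real h * app n E x i"
  by (simp add: app_def pencil_def algebra_simps sum.distrib sum_distrib_left)

lemma herm_pencil: "herm n M \<Longrightarrow> herm n E \<Longrightarrow> herm n (pencil M E h)"
  unfolding herm_def[of n "pencil M E h"] pencil_def by (simp add: hermD)

text \<open>The vector \<open>(M + h E)\<^sup>m x\<close>, entry by entry a polynomial in \<open>h\<close>.\<close>

primrec pencil_pow ::
  "nat \<Rightarrow> (nat \<Rightarrow> nat \<Rightarrow> complex) \<Rightarrow> (nat \<Rightarrow> nat \<Rightarrow> complex) \<Rightarrow> (nat \<Rightarrow> complex) \<Rightarrow> nat \<Rightarrow> nat \<Rightarrow> complex poly" where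
  "pencil_pow n M E x 0 = (\<lambda>i. [:x i:])"
| "pencil_pow n M E x (Suc m) = (\<lambda>i. (\<Sum>j<n. Polynomial.smult (M i j) (pencil_pow n M E x m j))
     + pCons 0 (\<Sum>j<n. Polynomial.smult (E i j) (pencil_pow n M E x m j)))"

lemma poly_pencil_pow: "i < n \<Longrightarrow> (app n (pencil M E h) ^^ m) x i = poly (pencil_pow n M E x m i) (of_real h)"
proof (induction m arbitrary: i)
  case (Suc m)
  have "(app n (pencil M E h) ^^ Suc m) x i = app n (pencil M E h) (\<lambda>i. poly (pencil_pow n M E x m i) (of_real h)) i"
    using Suc by (auto intro!: app_cong)
  also have "\<dots> = poly (pencil_pow n M E x (Suc m) i) (of_real h)"
    unfolding app_pencil by (simp add: app_def poly_sum)
  finally show ?case .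
qed simp

lemma coeff_pencil_pow:
  "coeff (pencil_pow n M E x 0 i) 0 = x i"
  "coeff (pencil_pow n M E x 0 i) (Suc k) = 0"
  "coeff (pencil_pow n M E x (Suc m) i) 0 = app n M (\<lambda>j. coeff (pencil_pow n M E x m j) 0) i"
  "coeff (pencil_pow n M E x (Suc m) i) (Suc k) =
     app n M (\<lambda>j. coeff (pencil_pow n M E x m j) (Suc k)) i + app n E (\<lambda>j. coeff (pencil_pow n M E x m j) k) i"
  by (simp_all add: app_def coeff_sum)

definition pencil_poly ::
  "nat \<Rightarrow> real poly \<Rightarrow> (nat \<Rightarrow> nat \<Rightarrow> complex) \<Rightarrow> (nat \<Rightarrow> nat \<Rightarrow> complex) \<Rightarrow> (nat \<Rightarrow> complex) \<Rightarrow> complex poly" where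
  "pencil_poly n p M E x = (\<Sum>m\<le>degree p. \<Sum>i<n. Polynomial.smult (of_real (coeff p m) * cnj (x i)) (pencil_pow n M E x m i))"

lemma fform_pencil_poly:
  assumes "herm n M" "herm n E"
  shows "fform n (poly p) (pencil M E h) x = Re (poly (pencil_poly n p M E x) (of_real h))"
proof -
  have "complex_of_real (coeff p m) * inprod n ((app n (pencil M E h) ^^ m) x) x
     = (\<Sum>i<n. poly (Polynomial.smult (of_real (coeff p m) * cnj (x i)) (pencil_pow n M E x m i)) (of_real h))" for m
    unfolding inprod_def sum_distrib_left by (rule sum.cong) (simp_all add: poly_pencil_pow)
  then have "poly (pencil_poly n p M E x) (of_real h)
     = (\<Sum>m\<le>degree p. complex_of_real (coeff p m) * inprod n ((app n (pencil M E h) ^^ m) x) x)"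
    unfolding pencil_poly_def poly_sum by simp
  then show ?thesis
    by (simp add: fform_poly[OF herm_pencil[OF assms]])
qed

lemma coeff_pencil_poly:
  "coeff (pencil_poly n p M E x) k =
    (\<Sum>m\<le>degree p. \<Sum>i<n. of_real (coeff p m) * cnj (x i) * coeff (pencil_pow n M E x m i) k)"
  by (simp add: pencil_poly_def coeff_sum)

text \<open>The \<open>h\<^sup>2\<close>-term of \<open>(C + h H)\<^sup>m\<close> sums the products \<open>C\<^sup>i H C\<^sup>j H C\<^sup>k\<close> with \<open>i + j + k = m - 2\<close>. Inserting
  \<open>\<Sum>\<^sub>l e\<^sub>l e\<^sub>l\<^sup>*\<close> between the two factors \<open>H\<close> (the middle power acts on \<open>e\<^sub>l\<close> as \<open>a\<^sub>l\<close> to the \<open>j\<close>)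
  writes it as a sum over \<open>l\<close>, and the \<open>l\<close>-th summand is the \<open>h\<^sup>2\<close>-term of the compressed power of the
  matrix bordered by \<open>h H e\<^sub>l\<close> and \<open>a\<^sub>l\<close>: there a path must leave through the border and return.\<close>

lemma second_order_coeffs:
  fixes a :: "nat \<Rightarrow> real" and x :: "nat \<Rightarrow> complex"
  assumes H: "herm n H"
  defines "P \<equiv> pencil_pow n (diagm a) H x"
  defines "B \<equiv> (\<lambda>l. pencil_pow (Suc n) (bordered n a (\<lambda>_. 0) (a l)) (bordered n (\<lambda>_. 0) (\<lambda>i. H i l) 0) (pad n x))"
  shows "(\<forall>i<n. \<forall>l<n. coeff (B l m i) 0 = coeff (P m i) 0 \<and>
           coeff (B l m i) 1 = 0 \<and>
           coeff (B l m n) 0 = 0 \<and> coeff (B l m n) 1 = coeff (P m l) 1) \<and>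
         (\<forall>i<n. (\<Sum>l<n. coeff (B l m i) 2) = coeff (P m i) 2)"
proof (induction m)
  case 0
  show ?case by (simp add: P_def B_def pad_def numeral_2_eq_2)
next
  case (Suc m)
  have P0: "coeff (P (Suc m) i) 0 = of_real (a i) * coeff (P m i) 0"
    and P: "coeff (P (Suc m) i) (Suc k) = of_real (a i) * coeff (P m i) (Suc k)
            + (\<Sum>j<n. H i j * coeff (P m j) k)" if "i < n" for i k
    unfolding P_def coeff_pencil_pow using that by (simp_all add: app_diagm) (simp add: app_def)
  have B0: "coeff (B l (Suc m) i) 0 = of_real (a i) * coeff (B l m i) 0"
    and B: "coeff (B l (Suc m) i) (Suc k) = of_real (a i) * coeff (B l m i) (Suc k)
            + H i l * coeff (B l m n) k" if "i < n" for i l k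
    unfolding B_def coeff_pencil_pow using that by (simp_all add: app_bordered)
  have Bn0: "coeff (B l (Suc m) n) 0 = of_real (a l) * coeff (B l m n) 0"
    and Bn: "coeff (B l (Suc m) n) (Suc k) = of_real (a l) * coeff (B l m n) (Suc k)
            + (\<Sum>i<n. H l i * coeff (B l m i) k)" if "l < n" for l k
    unfolding B_def coeff_pencil_pow using that by (simp_all add: app_bordered hermD[OF H])
  have IH: "coeff (B l m i) 0 = coeff (P m i) 0" "coeff (B l m i) 1 = 0"
    "coeff (B l m n) 0 = 0" "coeff (B l m n) 1 = coeff (P m l) 1" if "i < n" "l < n" for i l
    using Suc.IH that by auto
  have IH2: "(\<Sum>l<n. coeff (B l m i) 2) = coeff (P m i) 2" if "i < n" for i
    using Suc.IH that by auto
  show ?case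
  proof (intro conjI allI impI)
    fix i l assume il: "i < n" "l < n"
    show "coeff (B l (Suc m) i) 0 = coeff (P (Suc m) i) 0"
      using il by (simp add: B0 P0 IH)
    show "coeff (B l (Suc m) i) 1 = 0"
      using il IH by (simp add: B)
    show "coeff (B l (Suc m) n) 0 = 0"
      using il IH by (simp add: Bn0)
    show "coeff (B l (Suc m) n) 1 = coeff (P (Suc m) l) 1"
      using il IH by (simp add: Bn P)
  next
    fix i assume i: "i < n"
    have "(\<Sum>l<n. coeff (B l (Suc m) i) 2) = (\<Sum>l<n. of_real (a i) * coeff (B l m i) 2 + H i l * coeff (P m l) 1)"
      using i IH by (intro sum.cong refl) (simp add: numeral_2_eq_2 B)
    also have "\<dots> = coeff (P (Suc m) i) 2"
      using i by (simp add: sum.distrib IH2 numeral_2_eq_2 P flip: sum_distrib_left) (simp add: IH2[unfolded numeral_2_eq_2])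
    finally show "(\<Sum>l<n. coeff (B l (Suc m) i) 2) = coeff (P (Suc m) i) 2" .
  qed
qed

lemma second_order_coeffs_form:
  fixes a :: "nat \<Rightarrow> real" and x :: "nat \<Rightarrow> complex" and p :: "real poly"
  assumes H: "herm n H"
  defines "\<psi> \<equiv> pencil_poly n p (diagm a) H x"
  defines "\<theta> \<equiv> (\<lambda>l. pencil_poly (Suc n) p (bordered n a (\<lambda>_. 0) (a l)) (bordered n (\<lambda>_. 0) (\<lambda>i. H i l) 0) (pad n x))"
  shows "l < n \<Longrightarrow> coeff (\<theta> l) 0 = coeff \<psi> 0"
    and "l < n \<Longrightarrow> coeff (\<theta> l) 1 = 0"
    and "(\<Sum>l<n. coeff (\<theta> l) 2) = coeff \<psi> 2"
proof -
  note so = second_order_coeffs[OF H, of a x]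
  have th: "coeff (\<theta> l) k = (\<Sum>m\<le>degree p. \<Sum>i<n. of_real (coeff p m) * cnj (x i) *
      coeff (pencil_pow (Suc n) (bordered n a (\<lambda>_. 0) (a l)) (bordered n (\<lambda>_. 0) (\<lambda>i. H i l) 0) (pad n x) m i) k)" for l k
    unfolding \<theta>_def coeff_pencil_poly by (simp add: pad_def)
  show "l < n \<Longrightarrow> coeff (\<theta> l) 0 = coeff \<psi> 0"
    unfolding th \<psi>_def coeff_pencil_poly using so by (intro sum.cong refl) simp
  show "l < n \<Longrightarrow> coeff (\<theta> l) 1 = 0"
    unfolding th using so by (intro sum.neutral ballI) simp
  have "(\<Sum>l<n. coeff (\<theta> l) 2) = (\<Sum>m\<le>degree p. \<Sum>i<n. \<Sum>l<n. of_real (coeff p m) * cnj (x i) *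
      coeff (pencil_pow (Suc n) (bordered n a (\<lambda>_. 0) (a l)) (bordered n (\<lambda>_. 0) (\<lambda>i. H i l) 0) (pad n x) m i) 2)"
    unfolding th by (rule trans[OF sum.swap sum.cong[OF refl sum.swap]])
  also have "\<dots> = coeff \<psi> 2"
    unfolding \<psi>_def coeff_pencil_poly using so by (intro sum.cong refl) (simp flip: sum_distrib_left)
  finally show "(\<Sum>l<n. coeff (\<theta> l) 2) = coeff \<psi> 2" .
qed

lemma pencil_diag_bordered:
  "pencil (bordered n a (\<lambda>_. 0) g) (bordered n (\<lambda>_. 0) v 0) h = bordered n a (\<lambda>i. of_real h * v i) g"
  by (auto simp: fun_eq_iff pencil_def bordered_def diagm_def)

definition second_diff ::
  "nat \<Rightarrow> (real \<Rightarrow> real) \<Rightarrow> (nat \<Rightarrow> nat \<Rightarrow> complex) \<Rightarrow> (nat \<Rightarrow> nat \<Rightarrow> complex) \<Rightarrow> (nat \<Rightarrow> complex) \<Rightarrow> real \<Rightarrow> real" where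
  "second_diff n F M H x h = fform n F (pencil M H h) x + fform n F (pencil M H (- h)) x - 2 * fform n F M x"

text \<open>The sum over \<open>l\<close> of \<open>\<langle>F(A\<^sub>l) x, x\<rangle> - \<langle>F(C) x, x\<rangle>\<close>, where \<open>C = diag a\<close> and \<open>A\<^sub>l\<close> is \<open>C\<close>
  bordered by the \<open>l\<close>-th column of \<open>h H\<close> and by \<open>a\<^sub>l\<close>, with \<open>x\<close> padded by a zero.\<close>

definition border_excess ::
  "nat \<Rightarrow> (real \<Rightarrow> real) \<Rightarrow> (nat \<Rightarrow> real) \<Rightarrow> (nat \<Rightarrow> nat \<Rightarrow> complex) \<Rightarrow> (nat \<Rightarrow> complex) \<Rightarrow> real \<Rightarrow> real" where
  "border_excess n F a H x h =
    (\<Sum>l<n. fform (Suc n) F (bordered n a (\<lambda>i. of_real h * H i l) (a l)) (pad n x) - fform n F (diagm a) x)"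

lemma second_order_poly:
  assumes H: "herm n H" and \<epsilon>: "\<epsilon> > 0"
  shows "\<forall>\<^sub>F h in at 0. \<bar>second_diff n (poly p) (diagm a) H x h - 2 * border_excess n (poly p) a H x h\<bar> \<le> \<epsilon> * h\<^sup>2"
proof -
  define \<psi> where "\<psi> = pencil_poly n p (diagm a) H x"
  define \<theta> where "\<theta> = (\<lambda>l. pencil_poly (Suc n) p (bordered n a (\<lambda>_. 0) (a l)) (bordered n (\<lambda>_. 0) (\<lambda>i. H i l) 0) (pad n x))"
  have psi: "fform n (poly p) (pencil (diagm a) H h) x = Re (poly \<psi> (of_real h))" for h
    unfolding \<psi>_def by (rule fform_pencil_poly[OF herm_diagm H])
  have theta: "fform (Suc n) (poly p) (bordered n a (\<lambda>i. of_real h * H i l) (a l)) (pad n x) = Re (poly (\<theta> l) (of_real h))" for h l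
    unfolding \<theta>_def pencil_diag_bordered[symmetric] by (rule fform_pencil_poly[OF herm_bordered herm_bordered])
  define c0 c1 c2 where "c0 = coeff \<psi> 0" and "c1 = coeff \<psi> 1" and "c2 = coeff \<psi> 2"
  define d where "d l = coeff (\<theta> l) 2" for l
  have th01: "coeff (\<theta> l) 0 = c0" "coeff (\<theta> l) 1 = 0" if "l < n" for l
    using second_order_coeffs_form[OF H] that unfolding \<psi>_def \<theta>_def c0_def by auto
  have sd: "(\<Sum>l<n. d l) = c2"
    using second_order_coeffs_form(3)[OF H] unfolding \<psi>_def \<theta>_def c2_def d_def by auto
  have d0: "fform n (poly p) (diagm a) x = Re c0"
  proof -
    have "pencil (diagm a) H 0 = diagm a" by (simp add: fun_eq_iff pencil_def)
    then show ?thesis using psi[of 0] by (simp add: c0_def poly_0_coeff_0)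
  qed
  define \<epsilon>' where "\<epsilon>' = \<epsilon> / (2 * (real n + 1))"
  have \<epsilon>': "\<epsilon>' > 0" "2 * (real n + 1) * \<epsilon>' = \<epsilon>" using \<epsilon> by (simp_all add: \<epsilon>'_def)
  have e1: "\<forall>\<^sub>F h in at (0::real). cmod (poly \<psi> (of_real h) - c0 - of_real h * c1 - of_real (h\<^sup>2) * c2) \<le> \<epsilon>' * h\<^sup>2"
    using poly_second_order[OF \<epsilon>'(1), of \<psi>] unfolding c0_def c1_def c2_def .
  have e2: "\<forall>\<^sub>F h in at (0::real). cmod (poly \<psi> (of_real (- h)) - c0 - of_real (- h) * c1 - of_real ((- h)\<^sup>2) * c2) \<le> \<epsilon>' * (- h)\<^sup>2"
  proof -
    obtain r where r: "r > 0" "\<And>h. h \<noteq> 0 \<Longrightarrow> \<bar>h\<bar> < r \<Longrightarrow>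
        cmod (poly \<psi> (of_real h) - c0 - of_real h * c1 - of_real (h\<^sup>2) * c2) \<le> \<epsilon>' * h\<^sup>2"
      using e1 unfolding eventually_at by auto
    show ?thesis
      unfolding eventually_at
    proof (intro exI[of _ r] conjI ballI impI)
      fix h :: real assume "h \<noteq> 0 \<and> dist h 0 < r"
      then show "cmod (poly \<psi> (of_real (- h)) - c0 - of_real (- h) * c1 - of_real ((- h)\<^sup>2) * c2) \<le> \<epsilon>' * (- h)\<^sup>2"
        by (intro r(2)) auto
    qed (fact r(1))
  qed
  have e3: "\<forall>\<^sub>F h in at (0::real). \<forall>l\<in>{..<n}. cmod (poly (\<theta> l) (of_real h) - c0 - of_real (h\<^sup>2) * d l) \<le> \<epsilon>' * h\<^sup>2"
  proof (subst eventually_ball_finite_distrib)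
    show "\<forall>l\<in>{..<n}. \<forall>\<^sub>F h in at (0::real). cmod (poly (\<theta> l) (of_real h) - c0 - of_real (h\<^sup>2) * d l) \<le> \<epsilon>' * h\<^sup>2"
    proof
      fix l assume "l \<in> {..<n}"
      then show "\<forall>\<^sub>F h in at (0::real). cmod (poly (\<theta> l) (of_real h) - c0 - of_real (h\<^sup>2) * d l) \<le> \<epsilon>' * h\<^sup>2"
        using poly_second_order[OF \<epsilon>'(1), of "\<theta> l"] th01[of l] by (simp add: d_def)
    qed
  qed simp
  from e1 e2 e3 show ?thesis
  proof eventually_elim
    case (elim h)
    define r1 where "r1 = poly \<psi> (of_real h) - c0 - of_real h * c1 - of_real (h\<^sup>2) * c2"
    define r2 where "r2 = poly \<psi> (of_real (- h)) - c0 - of_real (- h) * c1 - of_real ((- h)\<^sup>2) * c2"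
    define r3 where "r3 l = poly (\<theta> l) (of_real h) - c0 - of_real (h\<^sup>2) * d l" for l
    have b: "\<bar>Re r1\<bar> \<le> \<epsilon>' * h\<^sup>2" "\<bar>Re r2\<bar> \<le> \<epsilon>' * h\<^sup>2" "l < n \<Longrightarrow> \<bar>Re (r3 l)\<bar> \<le> \<epsilon>' * h\<^sup>2" for l
      using elim unfolding r1_def[symmetric] r2_def[symmetric] r3_def[symmetric]
      by (auto intro: order.trans[OF abs_Re_le_cmod])
    have "(\<Sum>l<n. r3 l) = (\<Sum>l<n. poly (\<theta> l) (of_real h) - c0) - of_real (h\<^sup>2) * c2"
      unfolding r3_def sum_subtractf sd[symmetric] sum_distrib_left by simp
    then have S: "(\<Sum>l<n. poly (\<theta> l) (of_real h) - c0) = (\<Sum>l<n. r3 l) + of_real (h\<^sup>2) * c2"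
      by simp
    have "poly \<psi> (of_real h) + poly \<psi> (of_real (- h)) - 2 * c0 - 2 * (\<Sum>l<n. poly (\<theta> l) (of_real h) - c0)
       = r1 + r2 - 2 * (\<Sum>l<n. r3 l)"
      unfolding S by (simp add: r1_def r2_def algebra_simps)
    then have "Re (poly \<psi> (of_real h)) + Re (poly \<psi> (of_real (- h))) - 2 * Re c0 - 2 * (\<Sum>l<n. Re (poly (\<theta> l) (of_real h)) - Re c0)
       = Re r1 + Re r2 - 2 * (\<Sum>l<n. Re (r3 l))"
      by (simp add: complex_eq_iff)
    moreover have "\<bar>\<Sum>l<n. Re (r3 l)\<bar> \<le> (\<Sum>l<n. \<epsilon>' * h\<^sup>2)"
      by (rule order.trans[OF sum_abs sum_mono]) (use b in auto)
    ultimately have "\<bar>Re (poly \<psi> (of_real h)) + Re (poly \<psi> (of_real (- h))) - 2 * Re c0 - 2 * (\<Sum>l<n. Re (poly (\<theta> l) (of_real h)) - Re c0)\<bar>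
       \<le> 2 * (\<epsilon>' * h\<^sup>2) + 2 * (real n * (\<epsilon>' * h\<^sup>2))"
      using b(1,2) unfolding sum_constant card_lessThan by linarith
    also have "\<dots> = \<epsilon> * h\<^sup>2" by (simp add: \<epsilon>'(2)[symmetric] algebra_simps)
    finally show ?case unfolding second_diff_def border_excess_def psi theta d0 .
  qed
qed

text \<open>The eigenvalues of \<open>diag a + h E\<close> stay within \<open>O(h)\<close> of the \<open>a\<^sub>i\<close>, so a function that vanishes
  to second order there contributes \<open>o(h\<^sup>2)\<close>.\<close>

lemma remainder_pencil:
  assumes E: "herm N E"
    and G: "\<delta> > 0" "\<And>i t. i < N \<Longrightarrow> \<bar>t - a i\<bar> < \<delta> \<Longrightarrow> \<bar>G t\<bar> \<le> \<epsilon>' * (t - a i)\<^sup>2" and \<epsilon>': "\<epsilon>' > 0"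
  shows "\<forall>\<^sub>F h in at 0. \<bar>fform N G (pencil (diagm a) E h) x\<bar> \<le> \<epsilon>' * (h\<^sup>2 * frob N E) * sqnorm N x"
proof -
  have "((\<lambda>h::real. h\<^sup>2 * frob N E) \<longlongrightarrow> 0\<^sup>2 * frob N E) (at 0)"
    by (intro tendsto_intros)
  then have "\<forall>\<^sub>F h in at (0::real). h\<^sup>2 * frob N E < \<delta>\<^sup>2"
    by (rule order_tendstoD(2)) (use G(1) in simp)
  then show ?thesis
  proof eventually_elim
    case (elim h)
    have fr: "frob N (\<lambda>i j. pencil (diagm a) E h i j - diagm a i j) = h\<^sup>2 * frob N E"
      by (simp add: pencil_def frob_scale)
    show ?case
    proof (rule fform_near_spectrum[OF spectral_dec_diagm herm_pencil[OF herm_diagm E]])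
      fix k t assume k: "k < N" "(t - a k)\<^sup>2 \<le> frob N (\<lambda>i j. pencil (diagm a) E h i j - diagm a i j)"
      then have "\<bar>t - a k\<bar>\<^sup>2 < \<delta>\<^sup>2" using elim fr by simp
      then have "\<bar>t - a k\<bar> < \<delta>" by (rule power_less_imp_less_base) (use G(1) in simp)
      then have "\<bar>G t\<bar> \<le> \<epsilon>' * (t - a k)\<^sup>2" using G(2) k(1) by blast
      also have "\<dots> \<le> \<epsilon>' * (h\<^sup>2 * frob N E)" using k(2) fr \<epsilon>' by (intro mult_left_mono) auto
      finally show "\<bar>G t\<bar> \<le> \<epsilon>' * (h\<^sup>2 * frob N E)" .
    qed
  qed
qed

text \<open>For polynomials this is the comparison of coefficients above. In general subtract a polynomial
  that agrees with \<open>F\<close> to second order at all \<open>a\<^sub>i\<close>; the spectra of \<open>C \<plusminus> h H\<close> and of the bordered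
  matrices all tend to \<open>{a\<^sub>i}\<close>, because the border carries one of the \<open>a\<^sub>i\<close> as its corner entry.\<close>

theorem second_order_comparison:
  assumes F: "Ck 2 F" and H: "herm n H" and \<epsilon>: "\<epsilon> > 0"
  shows "\<forall>\<^sub>F h in at 0. \<bar>second_diff n F (diagm a) H x h - 2 * border_excess n F a H x h\<bar> \<le> \<epsilon> * h\<^sup>2"
proof -
  obtain F' F'' where F': "\<And>t. (F has_real_derivative F' t) (at t)" "\<And>t. (F' has_real_derivative F'' t) (at t)"
    and F'': "continuous_on UNIV F''"
    using F by (auto simp: numeral_2_eq_2)
  obtain p where p: "\<And>i. i < n \<Longrightarrow> poly p (a i) = F (a i)" "\<And>i. i < n \<Longrightarrow> poly (pderiv p) (a i) = F' (a i)"
    "\<And>i. i < n \<Longrightarrow> poly (pderiv (pderiv p)) (a i) = F'' (a i)"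
    using hermite_interpolation[of "a ` {..<n}" F F' F''] by auto
  define G where "G t = F t - poly p t" for t
  define El where "El l = bordered n (\<lambda>_. 0) (\<lambda>i. H i l) 0" for l
  \<comment> \<open>the bordered matrix with zero border is diagonal with entries \<open>a\<close> followed by \<open>a l\<close>\<close>
  define al where "al l i = (if i < n then a i else a l)" for l i
  define K where "K = sqnorm n x * (2 * frob n H + 2 * (\<Sum>l<n. frob (Suc n) (El l)))"
  have K: "K \<ge> 0"
    unfolding K_def by (intro mult_nonneg_nonneg add_nonneg_nonneg sqnorm_nonneg frob_nonneg sum_nonneg) auto
  define \<epsilon>' where "\<epsilon>' = \<epsilon> / 2 / (K + 1)"
  have \<epsilon>': "\<epsilon>' > 0" using \<epsilon> K by (simp add: \<epsilon>'_def)
  have "\<exists>\<delta>>0. \<forall>t. \<bar>t - a i\<bar> < \<delta> \<longrightarrow> \<bar>G t\<bar> \<le> \<epsilon>' * (t - a i)\<^sup>2" if i: "i < n" for i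
  proof (rule second_order_remainder)
    show "(G has_real_derivative F' t - poly (pderiv p) t) (at t)" for t
      unfolding G_def by (intro DERIV_diff F' poly_DERIV)
    show "((\<lambda>t. F' t - poly (pderiv p) t) has_real_derivative F'' t - poly (pderiv (pderiv p)) t) (at t)" for t
      by (intro DERIV_diff F' poly_DERIV)
    show "isCont (\<lambda>t. F'' t - poly (pderiv (pderiv p)) t) (a i)"
      using F'' by (intro continuous_intros) (simp add: continuous_on_eq_continuous_at)
  qed (use p i \<epsilon>' in \<open>auto simp: G_def\<close>)
  then have "\<exists>\<delta>>0. \<forall>i<n. \<forall>t. \<bar>t - a i\<bar> < \<delta> \<longrightarrow> \<bar>G t\<bar> \<le> \<epsilon>' * (t - a i)\<^sup>2"
    by (rule common_radius)
  then obtain \<delta> where \<delta>: "\<delta> > 0" and Gd: "\<And>i t. i < n \<Longrightarrow> \<bar>t - a i\<bar> < \<delta> \<Longrightarrow> \<bar>G t\<bar> \<le> \<epsilon>' * (t - a i)\<^sup>2"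
    by blast
  have G0: "fform n G (diagm a) x = 0"
    using p(1) by (simp add: fform_diagm G_def)
  have G1: "\<forall>\<^sub>F h in at 0. \<bar>fform n G (pencil (diagm a) H h) x\<bar> \<le> \<epsilon>' * (h\<^sup>2 * frob n H) * sqnorm n x"
    using remainder_pencil[OF H \<delta> _ \<epsilon>', of a G x] Gd by blast
  have hm: "herm n (\<lambda>i j. - H i j)" unfolding herm_def[of n "\<lambda>i j. - H i j"] by (simp add: hermD[OF H])
  have G2: "\<forall>\<^sub>F h in at 0. \<bar>fform n G (pencil (diagm a) H (- h)) x\<bar> \<le> \<epsilon>' * (h\<^sup>2 * frob n H) * sqnorm n x"
  proof -
    have "pencil (diagm a) H (- h) = pencil (diagm a) (\<lambda>i j. - H i j) h" for h
      by (simp add: fun_eq_iff pencil_def)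
    moreover have "frob n (\<lambda>i j. - H i j) = frob n H" by (simp add: frob_def)
    ultimately show ?thesis using remainder_pencil[OF hm \<delta> _ \<epsilon>', of a G x] Gd by simp
  qed
  have G3: "\<forall>\<^sub>F h in at 0. \<forall>l\<in>{..<n}. \<bar>fform (Suc n) G (bordered n a (\<lambda>i. of_real h * H i l) (a l)) (pad n x)\<bar>
      \<le> \<epsilon>' * (h\<^sup>2 * frob (Suc n) (El l)) * sqnorm n x"
  proof (subst eventually_ball_finite_distrib)
    show "\<forall>l\<in>{..<n}. \<forall>\<^sub>F h in at 0. \<bar>fform (Suc n) G (bordered n a (\<lambda>i. of_real h * H i l) (a l)) (pad n x)\<bar>
      \<le> \<epsilon>' * (h\<^sup>2 * frob (Suc n) (El l)) * sqnorm n x"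
    proof
      fix l assume l: "l \<in> {..<n}"
      have Gl: "\<bar>G t\<bar> \<le> \<epsilon>' * (t - al l i)\<^sup>2" if "i < Suc n" "\<bar>t - al l i\<bar> < \<delta>" for i t
        using that Gd l by (auto simp: al_def split: if_splits)
      have "fform (Suc n) G (pencil (diagm (al l)) (El l) h) (pad n x)
          = fform (Suc n) G (bordered n a (\<lambda>i. of_real h * H i l) (a l)) (pad n x)" for h
        by (rule fform_mat_cong) (auto simp: pencil_def El_def bordered_def diagm_def al_def)
      moreover have "sqnorm (Suc n) (pad n x) = sqnorm n x" by (simp add: sqnorm_def pad_def)
      moreover have "herm (Suc n) (El l)" unfolding El_def by (rule herm_bordered)
      ultimately show "\<forall>\<^sub>F h in at 0. \<bar>fform (Suc n) G (bordered n a (\<lambda>i. of_real h * H i l) (a l)) (pad n x)\<bar>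
          \<le> \<epsilon>' * (h\<^sup>2 * frob (Suc n) (El l)) * sqnorm n x"
        using remainder_pencil[of "Suc n" "El l" \<delta> "al l" G \<epsilon>' "pad n x"] \<delta> Gl \<epsilon>' by simp
    qed
  qed simp
  have dec: "fform N F M y = fform N (poly p) M y + fform N G M y" if "herm N M" for N M y
    unfolding G_def fform_diff[OF that] by simp
  have second_diff_split: "second_diff n F (diagm a) H x h = second_diff n (poly p) (diagm a) H x h + second_diff n G (diagm a) H x h" for h
    by (simp add: second_diff_def dec[OF herm_pencil[OF herm_diagm H]] dec[OF herm_diagm])
  have border_excess_split: "border_excess n F a H x h = border_excess n (poly p) a H x h + border_excess n G a H x h" for h
    unfolding border_excess_def sum.distrib[symmetric]
    by (intro sum.cong refl) (simp add: dec[OF herm_bordered] dec[OF herm_diagm])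
  from second_order_poly[OF H half_gt_zero[OF \<epsilon>], of p a x] G1 G2 G3
  show ?thesis
  proof eventually_elim
    case (elim h)
    define S where "S = (\<Sum>l<n. fform (Suc n) G (bordered n a (\<lambda>i. of_real h * H i l) (a l)) (pad n x))"
    have "\<bar>S\<bar> \<le> (\<Sum>l<n. \<epsilon>' * (h\<^sup>2 * frob (Suc n) (El l)) * sqnorm n x)"
      unfolding S_def by (rule order.trans[OF sum_abs sum_mono]) (use elim(4) in auto)
    also have "\<dots> = \<epsilon>' * h\<^sup>2 * (sqnorm n x * (\<Sum>l<n. frob (Suc n) (El l)))"
      by (simp add: sum_distrib_left mult_ac)
    finally have S: "\<bar>S\<bar> \<le> \<epsilon>' * h\<^sup>2 * (sqnorm n x * (\<Sum>l<n. frob (Suc n) (El l)))" .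
    have "second_diff n G (diagm a) H x h
        = fform n G (pencil (diagm a) H h) x + fform n G (pencil (diagm a) H (- h)) x"
      and "border_excess n G a H x h = S"
      by (simp_all add: second_diff_def border_excess_def S_def G0)
    then have eq: "second_diff n F (diagm a) H x h - 2 * border_excess n F a H x h
      = (second_diff n (poly p) (diagm a) H x h - 2 * border_excess n (poly p) a H x h)
      + (fform n G (pencil (diagm a) H h) x + fform n G (pencil (diagm a) H (- h)) x - 2 * S)" (is "_ = ?R")
      unfolding second_diff_split border_excess_split by simp
    have "\<bar>?R\<bar> \<le> \<epsilon> / 2 * h\<^sup>2 + (\<epsilon>' * (h\<^sup>2 * frob n H) * sqnorm n x + \<epsilon>' * (h\<^sup>2 * frob n H) * sqnorm n x
        + 2 * (\<epsilon>' * h\<^sup>2 * (sqnorm n x * (\<Sum>l<n. frob (Suc n) (El l)))))"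
      using elim(1,2,3) S by linarith
    also have "\<dots> = \<epsilon> / 2 * h\<^sup>2 + \<epsilon>' * K * h\<^sup>2"
    proof -
      have "A + (q * (k * f) * s + q * (k * f) * s + 2 * (q * k * (s * W))) = A + q * (s * (2 * f + 2 * W)) * k"
        for A q k f s W :: real by (simp add: algebra_simps)
      then show ?thesis unfolding K_def .
    qed
    also have "\<dots> \<le> \<epsilon> / 2 * h\<^sup>2 + \<epsilon> / 2 * h\<^sup>2"
    proof -
      have "\<epsilon>' * K \<le> \<epsilon>' * (K + 1)" using \<epsilon>' by simp
      also have "\<dots> = \<epsilon> / 2"
      proof -
        have "u / v * v = u" if "v \<noteq> 0" for u v :: real using that by simp
        then show ?thesis using K unfolding \<epsilon>'_def by (metis add_nonneg_eq_0_iff zero_le_one zero_neq_one)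
      qed
      finally show ?thesis by (intro add_left_mono mult_right_mono) auto
    qed
    finally have "\<bar>?R\<bar> \<le> \<epsilon> * h\<^sup>2" by simp
    then show ?case unfolding eq .
  qed
qed

section \<open>From matrix inequalities to a local condition\<close>

lemma spec_in_eventually:
  assumes herm: "herm n M0" and J: "open J" and spec: "spec_in n M0 J"
    and conv: "\<And>i j. i < n \<Longrightarrow> j < n \<Longrightarrow> ((\<lambda>t. M t i j) \<longlongrightarrow> M0 i j) \<F>"
  shows "\<forall>\<^sub>F t in \<F>. spec_in n (M t) J"
proof -
  obtain l u where dec: "spectral_dec n M0 l u" using spectral_dec_exists[OF herm] by blast
  have inner: "\<exists>d>0. \<forall>y. \<bar>y - l k\<bar> < d \<longrightarrow> y \<in> J" if "k < n" for k
    using J spec_inD[OF spec dec that] unfolding open_dist dist_real_def by blast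
  have "\<forall>\<^sub>F t in \<F>. \<forall>k<n. \<forall>y. (y - l k)\<^sup>2 \<le> frob n (\<lambda>i j. M t i j - M0 i j) \<longrightarrow> y \<in> J"
    by (rule near_spectrum_eventually[OF conv inner])
  then show ?thesis
    by eventually_elim (rule spec_in_near[OF dec], blast)
qed

lemma hform_outer: "hform n (\<lambda>i j. z i * cnj (z j)) x = (cmod (inprod n x z))\<^sup>2"
proof -
  have "inprod n (app n (\<lambda>i j. z i * cnj (z j)) x) x = inprod n x z * cnj (inprod n x z)"
    by (simp add: inprod_def app_def sum_distrib_left sum_distrib_right mult_ac)
  then show ?thesis
    unfolding hform_def complex_norm_square[symmetric] by simp
qed

lemma hform_add: "hform n (\<lambda>i j. M i j + E i j) x = hform n M x + hform n E x"
  by (simp add: hform_def inprod_def app_def algebra_simps sum.distrib)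

lemma hform_diagm_le_rank1: "hform n (diagm a) x \<le> hform n (rank1 a v) x"
  unfolding rank1_def[abs_def] hform_add hform_outer by simp

lemma hull_of_spectra:
  assumes n: "n \<ge> 1" and J: "is_interval J" and M: "herm n M" "spec_in n M J" and M': "herm n M'" "spec_in n M' J"
  shows "\<exists>lo hi. lo \<in> J \<and> hi \<in> J \<and> lo \<le> hi \<and> {lo..hi} \<subseteq> J \<and> spec_in n M {lo..hi} \<and> spec_in n M' {lo..hi}"
proof -
  obtain l u where dec: "spectral_dec n M l u" using spectral_dec_exists[OF M(1)] by blast
  obtain l' u' where dec': "spectral_dec n M' l' u'" using spectral_dec_exists[OF M'(1)] by blast
  define S where "S = l ` {..<n} \<union> l' ` {..<n}"
  have S: "finite S" "S \<noteq> {}" "S \<subseteq> J"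
    using n spec_inD[OF M(2) dec] spec_inD[OF M'(2) dec'] by (auto simp: S_def lessThan_empty_iff)
  have mm: "Min S \<in> J" "Max S \<in> J" using S by (meson Min_in Max_in subsetD)+
  have le: "Min S \<le> Max S" using S(1,2) by simp
  have sub: "{Min S..Max S} \<subseteq> J"
    using mem_is_interval_1_I[OF J mm] by auto
  have "spec_in n M {Min S..Max S}" by (rule spec_inI[OF dec]) (use S(1) in \<open>auto simp: S_def\<close>)
  moreover have "spec_in n M' {Min S..Max S}" by (rule spec_inI[OF dec']) (use S(1) in \<open>auto simp: S_def\<close>)
  ultimately show ?thesis using mm le sub by blast
qed

lemma spec_in_combination:
  assumes n: "n \<ge> 1" and J: "is_interval J" and M: "herm n M" "spec_in n M J" and M': "herm n M'" "spec_in n M' J"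
    and t: "0 \<le> t" "t \<le> 1"
  shows "spec_in n (\<lambda>i j. of_real t * M i j + of_real (1 - t) * M' i j) J" (is "spec_in n ?C J")
proof -
  obtain lo hi where lh: "{lo..hi} \<subseteq> J" "spec_in n M {lo..hi}" "spec_in n M' {lo..hi}"
    using hull_of_spectra[OF n J M M'] by blast
  have "spec_in n ?C {lo..hi}"
    unfolding spec_in_interval_iff[OF herm_combination[OF M(1) M'(1)]]
  proof
    fix y
    have b: "lo * sqnorm n y \<le> hform n M y" "hform n M y \<le> hi * sqnorm n y"
      "lo * sqnorm n y \<le> hform n M' y" "hform n M' y \<le> hi * sqnorm n y"
      using lh(2,3) unfolding spec_in_interval_iff[OF M(1)] spec_in_interval_iff[OF M'(1)] by auto
    have "0 \<le> (1 - t) * (hform n M' y - lo * sqnorm n y) + t * (hform n M y - lo * sqnorm n y)"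
      using b t by (intro add_nonneg_nonneg mult_nonneg_nonneg) auto
    moreover have "0 \<le> (1 - t) * (hi * sqnorm n y - hform n M' y) + t * (hi * sqnorm n y - hform n M y)"
      using b t by (intro add_nonneg_nonneg mult_nonneg_nonneg) auto
    ultimately show "lo * sqnorm n y \<le> hform n ?C y \<and> hform n ?C y \<le> hi * sqnorm n y"
      unfolding hform_combination by (simp add: algebra_simps)
  qed
  then show ?thesis using lh(1) by (rule spec_in_mono)
qed

lemma spread_nodes:
  fixes r t0 :: real and n :: nat
  assumes "r > 0" "n \<ge> 1"
  defines "a \<equiv> (\<lambda>i. t0 + r * (real i / real n))"
  shows "inj_on a {..<n}" "i < n \<Longrightarrow> \<bar>a i - t0\<bar> < r"
proof -
  show "inj_on a {..<n}"
    by (rule inj_onI) (use assms in \<open>auto simp: a_def\<close>)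
  assume "i < n"
  then have "real i / real n < 1" "real i / real n \<ge> 0" using assms by auto
  then have "0 \<le> r * (real i / real n)" "r * (real i / real n) < r * 1"
    using assms(1) by (intro mult_nonneg_nonneg mult_strict_left_mono; simp)+
  then show "\<bar>a i - t0\<bar> < r" by (simp add: a_def)
qed

text \<open>The test vector for which the numerator of the perturbation by a constant vector \<open>v\<close> is a
  prescribed polynomial \<open>q\<close>, up to scaling.\<close>

lemma numer_interpolation:
  assumes a: "inj_on a {..<n}" and q: "degree q < n" and \<eta>: "\<eta> \<noteq> 0"
  defines "x \<equiv> (\<lambda>i. complex_of_real (poly q (a i) / (\<Prod>k\<in>{..<n} - {i}. a i - a k) / \<eta>))"
  shows "(cmod (numer n a (\<lambda>_. of_real (\<eta> * h)) x t))\<^sup>2 = h\<^sup>2 * (poly q t)\<^sup>2"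
proof -
  have "numer n a (\<lambda>_. of_real (\<eta> * h)) x t
     = of_real (h * poly (numer_part n a (\<lambda>i. poly q (a i) / (\<Prod>k\<in>{..<n} - {i}. a i - a k))) t)"
    using \<eta> by (simp add: numer_def numer_part_def poly_sum x_def sum_distrib_left mult_ac)
  then show ?thesis
    unfolding interpolation_at_nodes[OF a q] by (simp add: norm_mult power_mult_distrib)
qed

lemma divdiff_upper_bound:
  assumes g: "Ck k g" and Y: "finite Y" "card Y = Suc k" "Y \<subseteq> K" and K: "is_interval K"
    and neg: "\<And>t. t \<in> K \<Longrightarrow> (deriv ^^ k) g t \<le> - \<kappa>"
  shows "divdiff Y g \<le> - (\<kappa> / fact k)"
proof -
  obtain t where t: "t \<in> {Min Y..Max Y}" "divdiff Y g = (deriv ^^ k) g t / fact k"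
    using divdiff_mean_value[OF g Y(1,2)] by blast
  have "Y \<noteq> {}" using Y(2) by auto
  then have "t \<in> K" using is_interval_Min_Max[OF K Y(1) _ Y(3) t(1)] by blast
  from neg[OF this] show ?thesis
    unfolding t(2) minus_divide_left by (rule divide_right_mono) simp
qed

text \<open>If the condition fails at a point, then by continuity it fails uniformly on a ball, for one and
  the same polynomial.\<close>

lemma local_cond_failure:
  assumes F: "Ck k F" and J: "open J" and fail: "\<not> local_cond n k J F"
  shows "\<exists>q t0 r \<kappa>. degree q < n \<and> r > 0 \<and> \<kappa> > 0 \<and> ball t0 r \<subseteq> J \<and>
    (\<forall>t\<in>ball t0 r. (deriv ^^ k) (\<lambda>t. F t * (poly q t)\<^sup>2) t \<le> - \<kappa>)"
proof -
  obtain q t0 where q: "degree q < n" "t0 \<in> J" "(deriv ^^ k) (\<lambda>t. F t * (poly q t)\<^sup>2) t0 < 0"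
    using fail by (auto simp: local_cond_def not_le)
  define g where "g = (deriv ^^ k) (\<lambda>t. F t * (poly q t)\<^sup>2)"
  define \<kappa> where "\<kappa> = - g t0 / 2"
  have \<kappa>: "\<kappa> > 0" using q(3) by (simp add: \<kappa>_def g_def)
  have "Ck 0 g" unfolding g_def using Ck_deriv_pow[of 0 k] Ck_times_square[OF F] by simp
  then have "isCont g t0" by (simp add: continuous_on_eq_continuous_at)
  from this[unfolded continuous_at_real_range, rule_format, OF \<kappa>] obtain r1
    where r1: "r1 > 0" "\<And>t. \<bar>t - t0\<bar> < r1 \<Longrightarrow> \<bar>g t - g t0\<bar> < \<kappa>" by auto
  obtain r2 where r2: "r2 > 0" "ball t0 r2 \<subseteq> J" using J q(2) openE by blast
  have "g t \<le> - \<kappa>" if "t \<in> ball t0 (min r1 r2)" for t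
  proof -
    have "\<bar>g t - g t0\<bar> < \<kappa>" using r1(2)[of t] that by (simp add: dist_real_def abs_minus_commute)
    then show ?thesis by (simp add: \<kappa>_def)
  qed
  moreover have "ball t0 (min r1 r2) \<subseteq> J" using r2(2) by auto
  ultimately show ?thesis
    using q(1) r1(1) r2(1) \<kappa> unfolding g_def
    by (intro exI[of _ q] exI[of _ t0] exI[of _ "min r1 r2"] exI[of _ \<kappa>]) auto
qed

text \<open>Suppose the derivative of \<open>F q\<^sup>2\<close> is negative on a ball. Put the \<open>a\<^sub>i\<close> and, by taking \<open>v\<close> small, also
  the eigenvalues of \<open>diag a + v v\<^sup>*\<close> into this ball, and choose the test vector with numerator \<open>q\<close>. The
  divided difference at these nodes is negative.\<close>

theorem n_monotone_imp_local_cond: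
  assumes F: "Ck (2 * n - 1) F" and n: "n \<ge> 1" and J: "open J" and mono: "n_monotone n J F"
  shows "local_cond n (2 * n - 1) J F"
proof (rule ccontr)
  assume "\<not> ?thesis"
  from local_cond_failure[OF F J this] obtain q t0 r \<kappa> where q: "degree q < n" and r: "r > 0" and \<kappa>: "\<kappa> > 0"
    and sub: "ball t0 r \<subseteq> J" and neg: "\<And>t. t \<in> ball t0 r \<Longrightarrow> (deriv ^^ (2 * n - 1)) (\<lambda>t. F t * (poly q t)\<^sup>2) t \<le> - \<kappa>"
    by blast
  define a where "a i = t0 + r * (real i / real n)" for i
  have a: "inj_on a {..<n}" and "\<And>i. i < n \<Longrightarrow> \<bar>a i - t0\<bar> < r"
    using spread_nodes[OF r n] unfolding a_def by auto
  then have aK: "a i \<in> ball t0 r" if "i < n" for i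
    using that by (simp add: dist_real_def abs_minus_commute)
  have "\<forall>\<^sub>F \<eta> in at_right 0. spec_in n (rank1 a (\<lambda>_. of_real \<eta>)) (ball t0 r)"
  proof (rule spec_in_eventually[OF herm_diagm])
    fix i j
    have "((\<lambda>\<eta>. rank1 a (\<lambda>_. of_real \<eta>) i j) \<longlongrightarrow> diagm a i j + of_real 0 * cnj (of_real 0)) (at_right 0)"
      unfolding rank1_def by (intro tendsto_intros)
    then show "((\<lambda>\<eta>. rank1 a (\<lambda>_. of_real \<eta>) i j) \<longlongrightarrow> diagm a i j) (at_right 0)" by simp
  qed (use aK in \<open>auto simp: spec_in_diagm\<close>)
  moreover have "\<forall>\<^sub>F \<eta> in at_right (0::real). \<eta> > 0" by (simp add: eventually_at_right_less)
  ultimately have "\<forall>\<^sub>F \<eta> in at_right 0. spec_in n (rank1 a (\<lambda>_. of_real \<eta>)) (ball t0 r) \<and> \<eta> > 0"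
    by eventually_elim auto
  from eventually_happens'[OF _ this] obtain \<eta> where \<eta>: "spec_in n (rank1 a (\<lambda>_. of_real \<eta>)) (ball t0 r)" "\<eta> > 0"
    by auto
  define x where "x i = complex_of_real (poly q (a i) / (\<Prod>k\<in>{..<n} - {i}. a i - a k) / \<eta>)" for i
  obtain Y where Y: "finite Y" "Y \<subseteq> ball t0 r" "card Y = 2 * n"
    "\<And>F x. fform n F (rank1 a (\<lambda>_. of_real \<eta>)) x - fform n F (diagm a) x
      = divdiff Y (\<lambda>t. F t * (cmod (numer n a (\<lambda>_. of_real \<eta>) x t))\<^sup>2)"
    using rank1_divdiff[OF a aK _ \<eta>(1)] \<eta>(2) by auto
  have "divdiff Y (\<lambda>t. F t * (poly q t)\<^sup>2) \<le> - (\<kappa> / fact (2 * n - 1))"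
    by (rule divdiff_upper_bound[OF Ck_times_square[OF F] Y(1) _ Y(2) _ neg]) (use Y(3) n in \<open>auto simp: is_interval_ball_real\<close>)
  moreover have "fform n F (rank1 a (\<lambda>_. of_real \<eta>)) x - fform n F (diagm a) x = divdiff Y (\<lambda>t. F t * (poly q t)\<^sup>2)"
    unfolding Y(4) using numer_interpolation[OF a q, of \<eta> 1] \<eta>(2) unfolding x_def[symmetric] by simp
  moreover have "fform n F (diagm a) x \<le> fform n F (rank1 a (\<lambda>_. of_real \<eta>)) x"
  proof -
    have "spec_in n (diagm a) J" using aK sub by (auto simp: spec_in_diagm)
    from mono[unfolded n_monotone_iff, rule_format, OF herm_diagm herm_rank1 this spec_in_mono[OF \<eta>(1) sub] hform_diagm_le_rank1]
    show ?thesis .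
  qed
  moreover have "\<kappa> / fact (2 * n - 1) > 0" using \<kappa> by simp
  ultimately show False by linarith
qed

lemma spec_in_bordered_eventually:
  assumes J: "open J" and a: "\<And>i. i < n \<Longrightarrow> a i \<in> J"
  shows "\<forall>\<^sub>F h in at 0. \<forall>l\<in>{..<n}. spec_in (Suc n) (bordered n a (\<lambda>i. of_real h * H i l) (a l)) J"
proof (subst eventually_ball_finite_distrib)
  show "\<forall>l\<in>{..<n}. \<forall>\<^sub>F h in at 0. spec_in (Suc n) (bordered n a (\<lambda>i. of_real h * H i l) (a l)) J"
  proof
    fix l assume l: "l \<in> {..<n}"
    define al where "al i = (if i < n then a i else a l)" for i
    show "\<forall>\<^sub>F h in at 0. spec_in (Suc n) (bordered n a (\<lambda>i. of_real h * H i l) (a l)) J"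
    proof (rule spec_in_eventually[OF herm_diagm J])
      show "spec_in (Suc n) (diagm al) J" using a l by (auto simp: spec_in_diagm al_def)
      fix i j assume ij: "i < Suc n" "j < Suc n"
      have "((\<lambda>h::real. pencil (bordered n a (\<lambda>_. 0) (a l)) (bordered n (\<lambda>_. 0) (\<lambda>i. H i l) 0) h i j)
          \<longlongrightarrow> pencil (bordered n a (\<lambda>_. 0) (a l)) (bordered n (\<lambda>_. 0) (\<lambda>i. H i l) 0) 0 i j) (at 0)"
        unfolding pencil_def by (intro tendsto_intros)
      moreover have "pencil (bordered n a (\<lambda>_. 0) (a l)) (bordered n (\<lambda>_. 0) (\<lambda>i. H i l) 0) 0 i j = diagm al i j"
        using ij by (auto simp: pencil_def bordered_def diagm_def al_def)
      ultimately show "((\<lambda>h. bordered n a (\<lambda>i. of_real h * H i l) (a l) i j) \<longlongrightarrow> diagm al i j) (at 0)"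
        unfolding pencil_diag_bordered by simp
    qed
  qed
qed simp

lemma spec_in_pencil_eventually:
  assumes J: "open J" and M: "herm n M" "spec_in n M J"
  shows "\<forall>\<^sub>F h in at 0. spec_in n (pencil M E h) J" "\<forall>\<^sub>F h in at 0. spec_in n (pencil M E (- h)) J"
proof -
  have "((\<lambda>h::real. pencil M E h i j) \<longlongrightarrow> M i j + of_real 0 * E i j) (at 0)" for i j
    unfolding pencil_def by (intro tendsto_intros)
  then show "\<forall>\<^sub>F h in at 0. spec_in n (pencil M E h) J"
    by (intro spec_in_eventually[OF M(1) J M(2)]) simp
  have "((\<lambda>h::real. pencil M E (- h) i j) \<longlongrightarrow> M i j + of_real (- 0) * E i j) (at 0)" for i j
    unfolding pencil_def by (intro tendsto_intros)
  then show "\<forall>\<^sub>F h in at 0. spec_in n (pencil M E (- h)) J"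
    by (intro spec_in_eventually[OF M(1) J M(2)]) simp
qed

text \<open>As in the monotone case, with \<open>H\<close> the matrix of ones. Then every border is a constant vector, all
  \<open>n\<close> summands of \<open>border_excess\<close> have the same numerator \<open>h q\<close>, and each is at most \<open>- \<epsilon> h\<^sup>2\<close>; the
  second difference would be negative for small \<open>h\<close>.\<close>

theorem n_convex_imp_local_cond:
  assumes F: "Ck (2 * n) F" and n: "n \<ge> 1" and J: "open J" and conv: "n_convex n J F"
  shows "local_cond n (2 * n) J F"
proof (rule ccontr)
  assume "\<not> ?thesis"
  from local_cond_failure[OF F J this] obtain q t0 r \<kappa> where q: "degree q < n" and r: "r > 0" and \<kappa>: "\<kappa> > 0"
    and sub: "ball t0 r \<subseteq> J" and neg: "\<And>t. t \<in> ball t0 r \<Longrightarrow> (deriv ^^ (2 * n)) (\<lambda>t. F t * (poly q t)\<^sup>2) t \<le> - \<kappa>"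
    by blast
  define a where "a i = t0 + r * (real i / real n)" for i
  have a: "inj_on a {..<n}" and "\<And>i. i < n \<Longrightarrow> \<bar>a i - t0\<bar> < r"
    using spread_nodes[OF r n] unfolding a_def by auto
  then have aK: "a i \<in> ball t0 r" if "i < n" for i
    using that by (simp add: dist_real_def abs_minus_commute)
  have spa: "spec_in n (diagm a) J" using aK sub by (auto simp: spec_in_diagm)
  \<comment> \<open>all columns of \<open>h H\<close> are the constant vector \<open>h\<close>\<close>
  define H :: "nat \<Rightarrow> nat \<Rightarrow> complex" where "H = (\<lambda>_ _. 1)"
  have H: "herm n H" by (simp add: herm_def H_def)
  define x where "x i = complex_of_real (poly q (a i) / (\<Prod>k\<in>{..<n} - {i}. a i - a k) / 1)" for i
  define \<epsilon> where "\<epsilon> = \<kappa> / fact (2 * n)"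
  have \<epsilon>: "\<epsilon> > 0" using \<kappa> by (simp add: \<epsilon>_def)
  have F2: "Ck 2 F" using Ck_mono[OF _ F, of 2] n by simp
  have "\<forall>\<^sub>F h in at (0::real). h \<noteq> 0" by (simp add: eventually_neq_at_within)
  from eventually_happens'[OF _ eventually_conj[OF this eventually_conj[OF second_order_comparison[OF F2 H \<epsilon>, of a x]
    eventually_conj[OF spec_in_bordered_eventually[of "ball t0 r" n a H, OF open_ball aK]
    eventually_conj[OF spec_in_pencil_eventually(1)[OF J herm_diagm spa, of H] spec_in_pencil_eventually(2)[OF J herm_diagm spa, of H]]]]]]
  obtain h where h: "h \<noteq> 0"
    and cmp: "\<bar>second_diff n F (diagm a) H x h - 2 * border_excess n F a H x h\<bar> \<le> \<epsilon> * h\<^sup>2"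
    and spb: "\<And>l. l < n \<Longrightarrow> spec_in (Suc n) (bordered n a (\<lambda>i. of_real h * H i l) (a l)) (ball t0 r)"
    and spp: "spec_in n (pencil (diagm a) H h) J" "spec_in n (pencil (diagm a) H (- h)) J"
    by auto
  have b: "fform (Suc n) F (bordered n a (\<lambda>i. of_real h * H i l) (a l)) (pad n x) - fform n F (diagm a) x \<le> - (\<epsilon> * h\<^sup>2)"
    if l: "l < n" for l
  proof -
    have eq: "(\<lambda>i. complex_of_real h * H i l) = (\<lambda>_. of_real (1 * h))" by (simp add: H_def)
    obtain Y where Y: "finite Y" "Y \<subseteq> ball t0 r" "card Y = Suc (2 * n)"
      "\<And>F x. fform (Suc n) F (bordered n a (\<lambda>_. of_real (1 * h)) (a l)) (pad n x) - fform n F (diagm a) x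
        = divdiff Y (\<lambda>t. F t * (cmod (numer n a (\<lambda>_. of_real (1 * h)) x t))\<^sup>2)"
      using bordered_divdiff[OF a aK _ spb[OF l, unfolded eq]] h by auto
    have "divdiff Y (\<lambda>t. F t * (poly q t)\<^sup>2) \<le> - \<epsilon>"
      unfolding \<epsilon>_def by (rule divdiff_upper_bound[OF Ck_times_square[OF F] Y(1,3,2) _ neg]) (auto simp: is_interval_ball_real)
    then have "h\<^sup>2 * divdiff Y (\<lambda>t. F t * (poly q t)\<^sup>2) \<le> h\<^sup>2 * - \<epsilon>" by (rule mult_left_mono) simp
    moreover have num: "(cmod (numer n a (\<lambda>_. of_real (1 * h)) x t))\<^sup>2 = h\<^sup>2 * (poly q t)\<^sup>2" for t
      using numer_interpolation[OF a q, of 1 h t] unfolding x_def by simp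
    have weight: "(\<lambda>t. F t * (cmod (numer n a (\<lambda>_. of_real (1 * h)) x t))\<^sup>2) = (\<lambda>t. h\<^sup>2 * (F t * (poly q t)\<^sup>2))"
      unfolding num by (simp add: fun_eq_iff)
    ultimately show ?thesis
      unfolding eq Y(4) weight divdiff_cmult by (simp add: mult.commute)
  qed
  have "border_excess n F a H x h \<le> (\<Sum>l<n. - (\<epsilon> * h\<^sup>2))"
    unfolding border_excess_def by (rule sum_mono) (use b in auto)
  also have "\<dots> \<le> - (\<epsilon> * h\<^sup>2)"
  proof -
    have "1 * (\<epsilon> * h\<^sup>2) \<le> real n * (\<epsilon> * h\<^sup>2)" using n \<epsilon> by (intro mult_right_mono) auto
    then show ?thesis by simp
  qed
  finally have s: "border_excess n F a H x h \<le> - (\<epsilon> * h\<^sup>2)" .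
  have "fform n F (\<lambda>i j. of_real (1/2) * pencil (diagm a) H h i j + of_real (1 - 1/2) * pencil (diagm a) H (- h) i j) x
      \<le> 1/2 * fform n F (pencil (diagm a) H h) x + (1 - 1/2) * fform n F (pencil (diagm a) H (- h)) x"
  proof -
    have "(1/2::real) \<in> {0..1}" by simp
    then show ?thesis
      using conv[unfolded n_convex_iff] herm_pencil[OF herm_diagm H] spp by blast
  qed
  moreover have "(\<lambda>i j. of_real (1/2) * pencil (diagm a) H h i j + of_real (1 - 1/2) * pencil (diagm a) H (- h) i j) = diagm a"
    by (simp add: fun_eq_iff pencil_def field_simps)
  ultimately have "second_diff n F (diagm a) H x h \<ge> 0"
    by (simp add: second_diff_def)
  moreover have "\<epsilon> * h\<^sup>2 > 0" using \<epsilon> h by simp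
  ultimately show False using cmp s by linarith
qed

section \<open>From the local condition to matrix inequalities\<close>

lemma eventually_generic:
  "\<forall>\<^sub>F t in at_right (0::real). inj_on (\<lambda>i. a i + t * real i) {..<n::nat}"
  "\<forall>\<^sub>F t in at_right (0::real). \<forall>i\<in>{..<n}. v i + complex_of_real t \<noteq> 0"
proof -
  have ne: "\<forall>\<^sub>F t in at_right (0::real). t \<noteq> c" for c :: real
  proof (cases "c > 0")
    case True
    have "\<forall>\<^sub>F t in at_right (0::real). t < c" by (rule eventually_at_rightI[of 0 c]) (use True in auto)
    then show ?thesis by eventually_elim auto
  next
    case False
    have "\<forall>\<^sub>F t in at_right (0::real). t > 0" by (simp add: eventually_at_right_less)
    then show ?thesis by eventually_elim (use False in auto)
  qed
  have "\<forall>\<^sub>F t in at_right (0::real). \<forall>i\<in>{..<n}. \<forall>j\<in>{..<n}. t \<noteq> (a j - a i) / (real i - real j)"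
    by (intro eventually_ball_finite ballI ne) auto
  moreover have pos: "\<forall>\<^sub>F t in at_right (0::real). t > 0" by (simp add: eventually_at_right_less)
  ultimately show "\<forall>\<^sub>F t in at_right (0::real). inj_on (\<lambda>i. a i + t * real i) {..<n::nat}"
  proof eventually_elim
    case (elim t)
    show ?case
    proof (rule inj_onI, rule ccontr)
      fix i j assume ij: "i \<in> {..<n}" "j \<in> {..<n}" "a i + t * real i = a j + t * real j" "i \<noteq> j"
      then have "t = (a j - a i) / (real i - real j)" by (simp add: field_simps)
      then show False using elim(1) ij by blast
    qed
  qed
  have "\<forall>\<^sub>F t in at_right (0::real). \<forall>i\<in>{..<n}. t \<noteq> - Re (v i)"
    by (intro eventually_ball_finite ballI ne) auto
  then show "\<forall>\<^sub>F t in at_right (0::real). \<forall>i\<in>{..<n}. v i + complex_of_real t \<noteq> 0"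
  proof eventually_elim
    case (elim t)
    show ?case
    proof (intro ballI notI)
      fix i assume i: "i \<in> {..<n}" "v i + complex_of_real t = 0"
      then have "Re (v i) + t = 0" by (metis Re_complex_of_real plus_complex.simps(1) zero_complex.simps(1))
      then show False using elim i(1) by force
    qed
  qed
qed

text \<open>A perturbation that is generic for all small \<open>t > 0\<close>: with \<open>m = 1\<close> it separates coinciding entries
  of \<open>a\<close>, with \<open>m = 0\<close> it moves every entry off zero.\<close>

definition jitter :: "(nat \<Rightarrow> 'a::real_algebra_1) \<Rightarrow> nat \<Rightarrow> real \<Rightarrow> nat \<Rightarrow> 'a" where
  "jitter a m t i = a i + of_real (t * real (i ^ m))"

lemma jitter_tendsto: "((\<lambda>t. jitter a m t i) \<longlongrightarrow> a i) (at_right 0)"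
  for a :: "nat \<Rightarrow> 'a::{real_algebra_1, real_normed_vector}"
proof -
  have "((\<lambda>t. a i + of_real (t * real (i ^ m))) \<longlongrightarrow> a i + of_real (0 * real (i ^ m))) (at_right 0)"
    by (intro tendsto_intros)
  then show ?thesis by (simp add: jitter_def)
qed

lemma diagm_jitter_tendsto: "((\<lambda>t. diagm (jitter a 1 t) i j) \<longlongrightarrow> diagm a i j) (at_right 0)"
  using tendsto_of_real[OF jitter_tendsto[of a 1 i]] by (auto simp: diagm_def)

text \<open>The divided difference formulas require distinct \<open>a\<^sub>i\<close> and nonzero \<open>v\<^sub>i\<close>. Both sides are continuous
  in the matrix, so the inequality extends to all \<open>a\<close> and \<open>v\<close>.\<close>

lemma limit_of_generic:
  assumes F: "continuous_on UNIV F" and J: "open J"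
    and a: "\<And>i. i < n \<Longrightarrow> a i \<in> J" and spec: "spec_in N (X a v) J"
    and X: "\<And>b w. herm N (X b w)"
    and lim: "\<And>i j. ((\<lambda>t. X (jitter a 1 t) (jitter v 0 t) i j) \<longlongrightarrow> X a v i j) (at_right 0)"
    and generic: "\<And>b w. inj_on b {..<n} \<Longrightarrow> (\<And>i. i < n \<Longrightarrow> w i \<noteq> (0::complex)) \<Longrightarrow> (\<And>i. i < n \<Longrightarrow> b i \<in> J) \<Longrightarrow>
      spec_in N (X b w) J \<Longrightarrow> fform n F (diagm b) x \<le> fform N F (X b w) y"
  shows "fform n F (diagm a) x \<le> fform N F (X a v) y"
proof -
  have spa: "spec_in n (diagm a) J" using a by (simp add: spec_in_diagm)
  have "\<forall>\<^sub>F t in at_right 0. fform n F (diagm (jitter a 1 t)) x \<le> fform N F (X (jitter a 1 t) (jitter v 0 t)) y"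
    using spec_in_eventually[OF herm_diagm J spa diagm_jitter_tendsto]
      spec_in_eventually[OF X J spec lim] eventually_generic(1)[of a n] eventually_generic(2)[of n v]
  proof eventually_elim
    case (elim t)
    have "jitter a 1 t = (\<lambda>i. a i + t * real i)" "jitter v 0 t = (\<lambda>i. v i + complex_of_real t)"
      by (simp_all add: jitter_def fun_eq_iff)
    then show ?case using elim by (intro generic) (auto simp: spec_in_diagm)
  qed
  then show ?thesis
    by (intro tendsto_le[OF _ fform_tendsto[OF X X F lim] fform_tendsto[OF herm_diagm herm_diagm F diagm_jitter_tendsto]]) auto
qed

lemma fform_rank1_ge:
  assumes F: "Ck (2 * n - 1) F" and n: "n \<ge> 1" and J: "open J" "is_interval J"
    and lc: "local_cond n (2 * n - 1) J F"
    and a: "\<And>i. i < n \<Longrightarrow> a i \<in> J" and spec: "spec_in n (rank1 a v) J"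
  shows "fform n F (diagm a) x \<le> fform n F (rank1 a v) x"
proof (rule limit_of_generic[where X = rank1, OF Ck_imp_continuous[OF F] J(1) a spec herm_rank1])
  show "((\<lambda>t. rank1 (jitter a 1 t) (jitter v 0 t) i j) \<longlongrightarrow> rank1 a v i j) (at_right 0)" for i j
    unfolding rank1_def by (intro tendsto_add tendsto_mult tendsto_cnj jitter_tendsto diagm_jitter_tendsto)
  fix b w assume b: "inj_on b {..<n}" "\<And>i. i < n \<Longrightarrow> w i \<noteq> 0" "\<And>i. i < n \<Longrightarrow> b i \<in> J" "spec_in n (rank1 b w) J"
  obtain Y where Y: "finite Y" "Y \<subseteq> J" "card Y = 2 * n"
    "fform n F (rank1 b w) x - fform n F (diagm b) x = divdiff Y (\<lambda>s. F s * (cmod (numer n b w x s))\<^sup>2)"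
    using rank1_divdiff[OF b(1,3,2,4)] by blast
  have "divdiff Y (\<lambda>s. F s * (cmod (numer n b w x s))\<^sup>2) \<ge> 0"
    using n Y(3) by (intro local_cond_divdiff[OF F lc J(2) _ Y(1,2)]) auto
  then show "fform n F (diagm b) x \<le> fform n F (rank1 b w) x" using Y(4) by simp
qed

lemma fform_bordered_ge:
  assumes F: "Ck (2 * n) F" and n: "n \<ge> 1" and J: "open J" "is_interval J"
    and lc: "local_cond n (2 * n) J F"
    and a: "\<And>i. i < n \<Longrightarrow> a i \<in> J" and spec: "spec_in (Suc n) (bordered n a v g) J"
  shows "fform n F (diagm a) x \<le> fform (Suc n) F (bordered n a v g) (pad n x)"
proof (rule limit_of_generic[where X = "\<lambda>a v. bordered n a v g", OF Ck_imp_continuous[OF F] J(1) a spec herm_bordered])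
  show "((\<lambda>t. bordered n (jitter a 1 t) (jitter v 0 t) g i j) \<longlongrightarrow> bordered n a v g i j) (at_right 0)" for i j
    unfolding bordered_def using diagm_jitter_tendsto jitter_tendsto tendsto_cnj[OF jitter_tendsto] by auto
  fix b w assume b: "inj_on b {..<n}" "\<And>i. i < n \<Longrightarrow> w i \<noteq> 0" "\<And>i. i < n \<Longrightarrow> b i \<in> J" "spec_in (Suc n) (bordered n b w g) J"
  obtain Y where Y: "finite Y" "Y \<subseteq> J" "card Y = Suc (2 * n)"
    "fform (Suc n) F (bordered n b w g) (pad n x) - fform n F (diagm b) x = divdiff Y (\<lambda>s. F s * (cmod (numer n b w x s))\<^sup>2)"
    using bordered_divdiff[OF b(1,3,2,4)] by blast
  have "divdiff Y (\<lambda>s. F s * (cmod (numer n b w x s))\<^sup>2) \<ge> 0"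
    using n Y(3) by (intro local_cond_divdiff[OF F lc J(2) _ Y(1,2)]) auto
  then show "fform n F (diagm b) x \<le> fform (Suc n) F (bordered n b w g) (pad n x)" using Y(4) by simp
qed

text \<open>Pass to an eigenbasis of \<open>M\<close>.\<close>

lemma fform_add_outer_ge:
  assumes F: "Ck (2 * n - 1) F" and n: "n \<ge> 1" and J: "open J" "is_interval J"
    and lc: "local_cond n (2 * n - 1) J F"
    and M: "herm n M" "spec_in n M J" and M': "herm n (\<lambda>i j. M i j + z i * cnj (z j))" "spec_in n (\<lambda>i j. M i j + z i * cnj (z j)) J"
  shows "fform n F M x \<le> fform n F (\<lambda>i j. M i j + z i * cnj (z j)) x"
proof -
  obtain l u where dec: "spectral_dec n M l u" using spectral_dec_exists[OF M(1)] by blast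
  then have u: "orthobasis n u" by (simp add: spectral_dec_def)
  define M1 where "M1 = (\<lambda>i j. M i j + z i * cnj (z j))"
  have cM1: "conj_mat n u M1 i j = rank1 l (coords n u z) i j" if "i < n" "j < n" for i j
  proof -
    have "app n M1 (u j) k = app n M (u j) k + inprod n (u j) z * z k" for k
      by (simp add: app_def M1_def inprod_def distrib_right distrib_left sum.distrib sum_distrib_right sum_distrib_left mult_ac)
    then have "conj_mat n u M1 i j = conj_mat n u M i j + inprod n (u j) z * inprod n z (u i)"
      by (simp add: conj_mat_def inprod_def[of n "app n _ _"] distrib_right sum.distrib sum_distrib_left mult.assoc)
        (simp add: inprod_def[of n z "u i"] sum_distrib_left)
    then show ?thesis
      using conj_mat_eigenbasis[OF dec that] by (simp add: rank1_def coords_def inprod_commute[of n "u j" z])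
  qed
  have "fform n F M x = fform n F (diagm l) (coords n u x)"
    unfolding fform_conj_mat[OF u M(1), symmetric]
    by (rule fform_mat_cong) (auto simp: conj_mat_eigenbasis[OF dec])
  also have "\<dots> \<le> fform n F (rank1 l (coords n u z)) (coords n u x)"
  proof (rule fform_rank1_ge[OF F n J lc])
    show "l i \<in> J" if "i < n" for i using spec_inD[OF M(2) dec that] .
    have "spec_in n (conj_mat n u M1) J" using spec_in_conj_mat[OF u] M' unfolding M1_def by blast
    then show "spec_in n (rank1 l (coords n u z)) J"
      using spec_in_cong[of n "conj_mat n u M1" "rank1 l (coords n u z)"] cM1 by blast
  qed
  also have "\<dots> = fform n F (conj_mat n u M1) (coords n u x)"
    by (rule fform_mat_cong) (auto simp: cM1)
  also have "\<dots> = fform n F M1 x"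
    by (rule fform_conj_mat[OF u]) (use M' in \<open>simp add: M1_def\<close>)
  finally show ?thesis unfolding M1_def .
qed

text \<open>Diagonalize \<open>M' - M\<close> and add its rank one parts to \<open>M\<close> one after the other. The intermediate
  matrices lie between \<open>M\<close> and \<open>M'\<close>, so their spectra stay in the interval.\<close>

theorem local_cond_imp_n_monotone:
  assumes F: "Ck (2 * n - 1) F" and n: "n \<ge> 1" and J: "open J" "is_interval J"
    and lc: "local_cond n (2 * n - 1) J F"
  shows "n_monotone n J F"
  unfolding n_monotone_iff
proof (intro allI impI)
  fix M M' x
  assume M: "herm n M" and M': "herm n M'" and sM: "spec_in n M J" and sM': "spec_in n M' J"
    and le: "\<forall>x. hform n M x \<le> hform n M' x"
  obtain lo hi where lh: "{lo..hi} \<subseteq> J" "spec_in n M {lo..hi}" "spec_in n M' {lo..hi}"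
    using hull_of_spectra[OF n J(2) M sM M' sM'] by blast
  define D where "D i j = M' i j - M i j" for i j
  have D: "herm n D" unfolding D_def by (rule herm_diff) fact+
  obtain \<mu> w where dec: "spectral_dec n D \<mu> w" using spectral_dec_exists[OF D] by blast
  have "spec_in n D {0..Max (\<mu> ` {..<n})}"
  proof -
    have nn: "hform n D x \<ge> 0" for x unfolding D_def hform_diff using le by simp
    have "\<mu> k \<ge> 0" if k: "k < n" for k
    proof -
      have "hform n D (w k) = (\<Sum>j<n. \<mu> j * of_bool (k = j))"
        unfolding hform_eq[OF dec] using dec k
        by (intro sum.cong refl) (auto simp: spectral_dec_def orthobasis_def)
      also have "\<dots> = (\<Sum>j<n. if j = k then \<mu> k else 0)" by (rule sum.cong) auto
      finally show ?thesis using nn[of "w k"] k by simp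
    qed
    then show ?thesis by (intro spec_inI[OF dec]) auto
  qed
  then have mu: "\<mu> k \<ge> 0" if "k < n" for k using spec_inD[OF _ dec that] by fastforce
  define z where "z k i = of_real (sqrt (\<mu> k)) * w k i" for k i
  define X where "X m i j = M i j + (\<Sum>k<m. z k i * cnj (z k j))" for m i j
  have zz: "z k i * cnj (z k j) = of_real (\<mu> k) * w k i * cnj (w k j)" if "k < n" for k i j
  proof -
    have "complex_of_real (sqrt (\<mu> k)) * of_real (sqrt (\<mu> k)) = of_real (\<mu> k)"
      unfolding of_real_mult[symmetric] using mu[OF that] by simp
    then show ?thesis by (simp add: z_def mult_ac)
  qed
  have XS: "X (Suc m) = (\<lambda>i j. X m i j + z m i * cnj (z m j))" for m
    by (simp add: X_def fun_eq_iff)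
  have X0: "X 0 = M" by (simp add: X_def fun_eq_iff)
  have Xn: "X n i j = M' i j" if "i < n" "j < n" for i j
  proof -
    have "D i j = synth n \<mu> w i j" using dec that by (simp add: spectral_dec_def)
    then have "X n i j = M i j + D i j" by (simp add: X_def zz synth_def)
    then show ?thesis by (simp add: D_def)
  qed
  have Xh: "herm n (X m)" for m
    by (simp add: herm_def[of n "X m"] X_def hermD[OF M] mult.commute)
  have Xmono: "hform n (X m) x \<le> hform n (X (Suc m)) x" for m x
    unfolding XS hform_add hform_outer by simp
  have Xup: "hform n (X m) x \<le> hform n (X (m + k)) x" for m k x
  proof (induction k)
    case (Suc k)
    also have "hform n (X (m + k)) x \<le> hform n (X (m + Suc k)) x" using Xmono[of "m + k" x] by simp
    finally show ?case .
  qed simp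
  have hXn: "hform n (X n) x = hform n M' x" for x by (rule hform_cong) (auto simp: Xn)
  have sX: "spec_in n (X m) J" if "m \<le> n" for m
  proof -
    have "hform n M x \<le> hform n (X m) x" "hform n (X m) x \<le> hform n M' x" for x
      using Xup[of 0 x m] Xup[of m x "n - m"] that X0 hXn[of x] by auto
    moreover have "lo * sqnorm n x \<le> hform n M x" "hform n M' x \<le> hi * sqnorm n x" for x
      using lh(2,3) unfolding spec_in_interval_iff[OF M] spec_in_interval_iff[OF M'] by auto
    ultimately have "spec_in n (X m) {lo..hi}"
      unfolding spec_in_interval_iff[OF Xh] by (meson order.trans)
    then show ?thesis using lh(1) by (rule spec_in_mono)
  qed
  have step: "fform n F (X m) x \<le> fform n F (X (Suc m)) x" if "m < n" for m
    using fform_add_outer_ge[OF F n J lc Xh[of m] sX[of m], of "z m" x] Xh[of "Suc m"] sX[of "Suc m"] that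
    unfolding XS by simp
  have "m \<le> n \<Longrightarrow> fform n F (X 0) x \<le> fform n F (X m) x" for m
  proof (induction m)
    case (Suc m)
    then show ?case using step[of m] by simp
  qed simp
  from this[of n] have "fform n F M x \<le> fform n F (X n) x" by (simp add: X0)
  also have "\<dots> = fform n F M' x" by (rule fform_mat_cong) (auto simp: Xn)
  finally show "fform n F M x \<le> fform n F M' x" .
qed

text \<open>In an eigenbasis of \<open>M\<close>, each summand of \<open>border_excess\<close> is nonnegative by \<open>fform_bordered_ge\<close>.\<close>

lemma second_difference_ge:
  assumes F: "Ck (2 * n) F" and n: "n \<ge> 1" and J: "open J" "is_interval J"
    and lc: "local_cond n (2 * n) J F"
    and M: "herm n M" "spec_in n M J" and H: "herm n H" and \<epsilon>: "\<epsilon> > 0"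
  shows "\<forall>\<^sub>F h in at 0. second_diff n F M H x h \<ge> - \<epsilon> * h\<^sup>2"
proof -
  obtain a u where dec: "spectral_dec n M a u" using spectral_dec_exists[OF M(1)] by blast
  then have u: "orthobasis n u" by (simp add: spectral_dec_def)
  have aJ: "a i \<in> J" if "i < n" for i using spec_inD[OF M(2) dec that] .
  define K where "K = conj_mat n u H"
  have K: "herm n K" unfolding K_def by (rule herm_conj_mat[OF H])
  have tr: "fform n F (pencil M H h) x = fform n F (pencil (diagm a) K h) (coords n u x)" for h
  proof -
    have "conj_mat n u (pencil M H h) i j = pencil (diagm a) K h i j" if "i < n" "j < n" for i j
    proof -
      have "conj_mat n u (pencil M H h) i j = conj_mat n u M i j + of_real h * K i j"
        by (simp add: conj_mat_def K_def inprod_def[of n "app n _ _"] app_pencil distrib_right sum.distrib sum_distrib_left mult.assoc)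
      then show ?thesis using conj_mat_eigenbasis[OF dec that] by (simp add: pencil_def)
    qed
    then show ?thesis
      unfolding fform_conj_mat[OF u herm_pencil[OF M(1) H], symmetric] by (intro fform_mat_cong) auto
  qed
  have tr0: "fform n F M x = fform n F (diagm a) (coords n u x)"
    unfolding fform_conj_mat[OF u M(1), symmetric]
    by (rule fform_mat_cong) (auto simp: conj_mat_eigenbasis[OF dec])
  have F2: "Ck 2 F" using Ck_mono[OF _ F, of 2] n by simp
  have "\<forall>\<^sub>F h in at 0. \<forall>l\<in>{..<n}. spec_in (Suc n) (bordered n a (\<lambda>i. of_real h * K i l) (a l)) J"
    by (rule spec_in_bordered_eventually[OF J(1) aJ])
  with second_order_comparison[OF F2 K \<epsilon>, of a "coords n u x"]
  show ?thesis
  proof eventually_elim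
    case (elim h)
    have "border_excess n F a K (coords n u x) h \<ge> 0"
      unfolding border_excess_def
    proof (rule sum_nonneg)
      fix l assume "l \<in> {..<n}"
      then have "spec_in (Suc n) (bordered n a (\<lambda>i. of_real h * K i l) (a l)) J" using elim(2) by blast
      from fform_bordered_ge[OF F n J lc aJ this, of "coords n u x"]
      show "0 \<le> fform (Suc n) F (bordered n a (\<lambda>i. of_real h * K i l) (a l)) (pad n (coords n u x)) - fform n F (diagm a) (coords n u x)"
        by simp
    qed
    then show ?case using elim(1) by (simp add: second_diff_def tr tr0)
  qed
qed

theorem local_cond_imp_n_convex:
  assumes F: "Ck (2 * n) F" and n: "n \<ge> 1" and J: "open J" "is_interval J"
    and lc: "local_cond n (2 * n) J F"
  shows "n_convex n J F"
  unfolding n_convex_iff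
proof (intro ballI allI impI)
  fix t :: real and M M' x
  assume t: "t \<in> {0..1}" and M: "herm n M" and M': "herm n M'" and sM: "spec_in n M J" and sM': "spec_in n M' J"
  define H where "H i j = M i j - M' i j" for i j
  have H: "herm n H" unfolding H_def by (rule herm_diff) fact+
  define P where "P s = pencil M' H s" for s
  have hP: "herm n (P s)" for s unfolding P_def by (rule herm_pencil[OF M' H])
  have P: "P s = (\<lambda>i j. of_real s * M i j + of_real (1 - s) * M' i j)" for s
    by (simp add: P_def pencil_def H_def fun_eq_iff algebra_simps)
  have sP: "spec_in n (P s) J" if "0 \<le> s" "s \<le> 1" for s
    unfolding P by (rule spec_in_combination[OF n J(2) M sM M' sM' that])
  define \<phi> where "\<phi> s = fform n F (P s) x" for s
  have "\<phi> t \<le> (1 - t) * \<phi> 0 + t * \<phi> 1"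
  proof (rule convex_from_second_differences[OF _ _ t])
    show "continuous_on {0..1} \<phi>"
      unfolding continuous_on_def
    proof
      fix s :: real assume "s \<in> {0..1}"
      show "(\<phi> \<longlongrightarrow> \<phi> s) (at s within {0..1})"
        unfolding \<phi>_def
      proof (rule fform_tendsto[OF hP hP Ck_imp_continuous[OF F]])
        show "((\<lambda>s. P s i j) \<longlongrightarrow> P s i j) (at s within {0..1})" for i j
          unfolding P_def pencil_def by (intro tendsto_intros)
      qed
    qed
    fix s \<epsilon> :: real assume s: "0 < s" "s < 1" and \<epsilon>: "0 < \<epsilon>"
    have "P (s + h) = pencil (P s) H h" "P (s - h) = pencil (P s) H (- h)" for h
      by (simp_all add: P_def pencil_def fun_eq_iff algebra_simps)
    then have "\<forall>\<^sub>F h in at 0. \<phi> (s + h) + \<phi> (s - h) - 2 * \<phi> s \<ge> - \<epsilon> * h\<^sup>2"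
      unfolding \<phi>_def using second_difference_ge[OF F n J lc hP sP H \<epsilon>, of s x] s by (simp add: second_diff_def)
    then show "\<forall>\<^sub>F h in at_right 0. \<phi> (s + h) + \<phi> (s - h) - 2 * \<phi> s \<ge> - \<epsilon> * h\<^sup>2"
      by (rule filter_leD[rotated]) (rule at_le, simp)
  qed
  moreover have "P 0 = M'" "P 1 = M" by (simp_all add: fun_eq_iff P)
  then have "\<phi> 0 = fform n F M' x" "\<phi> 1 = fform n F M x" by (simp_all add: \<phi>_def)
  moreover have "\<phi> t = fform n F (\<lambda>i j. of_real t * M i j + of_real (1 - t) * M' i j) x"
    unfolding \<phi>_def P ..
  ultimately show "fform n F (\<lambda>i j. of_real t * M i j + of_real (1 - t) * M' i j) x \<le> t * fform n F M x + (1 - t) * fform n F M' x"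
    by simp
qed

section \<open>Gluing\<close>

text \<open>A finite list of pairs (point, weight) stands for the functional \<open>f \<mapsto> \<Sum> w f(p)\<close>.\<close>

definition weighted_sum :: "(real \<times> real) list \<Rightarrow> (real \<Rightarrow> real) \<Rightarrow> real" where
  "weighted_sum ws f = (\<Sum>(p, w)\<leftarrow>ws. w * f p)"

text \<open>Nonnegativity of those functionals of a family \<open>K\<close> whose points lie in \<open>J\<close>. Monotonicity and
  convexity for matrices of order \<open>n\<close> both have this form, which is all that smoothing and gluing use.\<close>

definition nonneg_on :: "(real \<times> real) list set \<Rightarrow> real set \<Rightarrow> (real \<Rightarrow> real) \<Rightarrow> bool" where
  "nonneg_on K J f \<longleftrightarrow> (\<forall>ws\<in>K. fst ` set ws \<subseteq> J \<longrightarrow> 0 \<le> weighted_sum ws f)"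

definition translate :: "real \<Rightarrow> (real \<times> real) list \<Rightarrow> (real \<times> real) list" where
  "translate s ws = map (\<lambda>(p, w). (p + s, w)) ws"

lemma weighted_sum_simps [simp]:
  "weighted_sum [] f = 0"
  "weighted_sum ((p, w) # ws) f = w * f p + weighted_sum ws f"
  "weighted_sum (ws @ ws') f = weighted_sum ws f + weighted_sum ws' f"
  by (simp_all add: weighted_sum_def)

lemma weighted_sum_translate: "weighted_sum (translate s ws) f = weighted_sum ws (\<lambda>t. f (t + s))"
  by (induction ws) (auto simp: translate_def)

lemma weighted_sum_cong: "(\<And>t. t \<in> fst ` set ws \<Longrightarrow> f t = g t) \<Longrightarrow> weighted_sum ws f = weighted_sum ws g"
  by (induction ws) auto

lemma weighted_sum_steklov:
  assumes f: "continuous_on UNIV f"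
  shows "(\<lambda>s. weighted_sum ws (\<lambda>t. f (t + s))) integrable_on {0..h} \<and>
    weighted_sum ws (steklov h f) = (1 / h) * integral {0..h} (\<lambda>s. weighted_sum ws (\<lambda>t. f (t + s)))"
proof (induction ws)
  case (Cons a ws)
  obtain p w where a: "a = (p, w)" by force
  have int: "(\<lambda>s. w * f (p + s)) integrable_on {0..h}"
    by (intro integrable_continuous_real continuous_intros continuous_on_compose2[OF f]) auto
  show ?case
    using Cons integral_add[OF int, of "\<lambda>s. weighted_sum ws (\<lambda>t. f (t + s))"]
    by (simp add: a steklov_def distrib_left integrable_add[OF int])
qed (simp add: integrable_0)

lemma weighted_sum_steklov_tendsto:
  assumes "continuous_on UNIV f"
  shows "((\<lambda>h. weighted_sum ws ((steklov h ^^ k) f)) \<longlongrightarrow> weighted_sum ws f) (at_right 0)"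
  by (induction ws) (auto intro!: tendsto_intros steklov_pow_tendsto assms)

lemma nonneg_on_subset: "nonneg_on K J f \<Longrightarrow> I \<subseteq> J \<Longrightarrow> nonneg_on K I f"
  unfolding nonneg_on_def by blast

lemma nonneg_on_cong:
  assumes eq: "\<And>t. t \<in> J \<Longrightarrow> f t = g t" and f: "nonneg_on K J f"
  shows "nonneg_on K J g"
  unfolding nonneg_on_def
proof (intro ballI impI)
  fix ws assume ws: "ws \<in> K" "fst ` set ws \<subseteq> J"
  have "weighted_sum ws f = weighted_sum ws g"
    by (rule weighted_sum_cong, rule eq) (use ws(2) in blast)
  then show "0 \<le> weighted_sum ws g"
    using f ws unfolding nonneg_on_def by metis
qed

lemma nonneg_on_steklov:
  assumes f: "continuous_on UNIV f" and h: "h > 0" and K: "\<And>s ws. ws \<in> K \<Longrightarrow> translate s ws \<in> K"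
    and nn: "nonneg_on K {p<..<r} f"
  shows "nonneg_on K {p<..<r - h} (steklov h f)"
  unfolding nonneg_on_def
proof (intro ballI impI)
  fix ws assume ws: "ws \<in> K" "fst ` set ws \<subseteq> {p<..<r - h}"
  have "0 \<le> integral {0..h} (\<lambda>s. weighted_sum ws (\<lambda>t. f (t + s)))"
  proof (rule integral_nonneg)
    show "(\<lambda>s. weighted_sum ws (\<lambda>t. f (t + s))) integrable_on {0..h}"
      using weighted_sum_steklov[OF f] by blast
    fix s assume "s \<in> {0..h}"
    then have "fst ` set (translate s ws) \<subseteq> {p<..<r}"
      using ws(2) by (force simp: translate_def)
    then show "0 \<le> weighted_sum ws (\<lambda>t. f (t + s))"
      using nn K[OF ws(1)] unfolding nonneg_on_def weighted_sum_translate[symmetric] by blast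
  qed
  then show "0 \<le> weighted_sum ws (steklov h f)"
    using weighted_sum_steklov[OF f, of ws h] h by simp
qed

lemma nonneg_on_steklov_pow:
  assumes f: "continuous_on UNIV f" and h: "h > 0" and K: "\<And>s ws. ws \<in> K \<Longrightarrow> translate s ws \<in> K"
    and nn: "nonneg_on K {p<..<r} f"
  shows "nonneg_on K {p<..<r - real k * h} ((steklov h ^^ k) f)"
proof (induction k)
  case (Suc k)
  from nonneg_on_steklov[OF Ck_imp_continuous[OF Ck_steklov_pow[OF f h]] h K Suc]
  show ?case by (simp add: algebra_simps)
qed (use nn in simp)

text \<open>Averaging \<open>k\<close> times with step \<open>h\<close> looks ahead by \<open>k h\<close>, so intervals lose \<open>k h\<close> at their right end;
  for small \<open>h\<close> the shortened intervals still overlap and still contain the given points.\<close>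

lemma eventually_steklov_step:
  assumes "c < b" and "hi < r"
  shows "\<forall>\<^sub>F h in at_right (0::real). 0 < h \<and> c < b - real k * h \<and> hi < r - real k * h"
proof -
  define e where "e = min (b - c) (r - hi) / (real k + 1)"
  have e: "e > 0" using assms by (simp add: e_def)
  show ?thesis
  proof (rule eventually_at_rightI[of 0 e])
    fix h assume h: "h \<in> {0<..<e}"
    have "real k * h \<le> (real k + 1) * h" using h by simp
    also have "\<dots> < (real k + 1) * e" using h by (intro mult_strict_left_mono) auto
    also have "\<dots> = min (b - c) (r - hi)" by (simp add: e_def)
    finally show "0 < h \<and> c < b - real k * h \<and> hi < r - real k * h" using h by auto
  qed (rule e)
qed

text \<open>Replace \<open>f\<close> outside a compact interval around the points of the functional by constants, smooth the
  result by iterated averages, pass through the local condition on the two overlapping intervals, and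
  let the step of the averages tend to zero.\<close>

theorem nonneg_on_glue:
  assumes abcd: "a < c" "c < b" "b < d" and K: "\<And>s ws. ws \<in> K \<Longrightarrow> translate s ws \<in> K"
    and local: "\<And>F J. Ck k F \<Longrightarrow> open J \<Longrightarrow> is_interval J \<Longrightarrow> nonneg_on K J F \<longleftrightarrow> local_cond n k J F"
    and f: "continuous_on {a<..<d} f" and nn: "nonneg_on K {a<..<b} f" "nonneg_on K {c<..<d} f"
  shows "nonneg_on K {a<..<d} f"
  unfolding nonneg_on_def
proof (intro ballI impI)
  fix ws assume ws: "ws \<in> K" "fst ` set ws \<subseteq> {a<..<d}"
  \<comment> \<open>inserting \<open>c\<close> and \<open>b\<close> makes the compact interval contain the overlap as well\<close>
  define lo hi where "lo = Min (insert c (fst ` set ws))" and "hi = Max (insert b (fst ` set ws))"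
  have "a < lo" "hi < d" using ws(2) abcd by (auto simp: lo_def hi_def)
  then obtain p r where pr: "a < p" "p < lo" "hi < r" "r < d"
    using dense[of a lo] dense[of hi d] by metis
  have "lo \<le> c" "b \<le> hi" by (simp_all add: lo_def hi_def)
  then have pc: "p < c" "b < r" using pr by linarith+
  have "lo \<le> t" "t \<le> hi" if "t \<in> fst ` set ws" for t
    using that by (simp_all add: lo_def hi_def)
  then have pts: "fst ` set ws \<subseteq> {p<..hi}" using pr(2) by fastforce
  define g where "g t = f (max p (min r t))" for t
  have g: "continuous_on UNIV g"
    unfolding g_def
    by (rule continuous_on_compose2[OF f]) (use pr pc abcd in \<open>auto intro!: continuous_intros\<close>)
  have eq: "f t = g t" if "t \<in> {p<..<r}" for t using that by (simp add: g_def)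
  have nng: "nonneg_on K {p<..<b} g" "nonneg_on K {c<..<r} g"
    by (rule nonneg_on_cong[OF eq nonneg_on_subset[OF nn(1)]] nonneg_on_cong[OF eq nonneg_on_subset[OF nn(2)]];
        use pr pc abcd in force)+
  have "\<forall>\<^sub>F h in at_right 0. 0 \<le> weighted_sum ws ((steklov h ^^ k) g)"
    using eventually_steklov_step[OF abcd(2) pr(3), of k]
  proof eventually_elim
    case (elim h)
    define F e where "F = (steklov h ^^ k) g" and "e = real k * h"
    have h: "h > 0" "c < b - e" "hi < r - e" "e \<ge> 0" using elim by (simp_all add: e_def)
    have F: "Ck k F" unfolding F_def by (rule Ck_steklov_pow[OF g h(1)])
    have "local_cond n k {p<..<b - e} F" "local_cond n k {c<..<r - e} F"
      using nonneg_on_steklov_pow[OF g h(1) K nng(1), of k] nonneg_on_steklov_pow[OF g h(1) K nng(2), of k]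
        local[OF F] by (auto simp: F_def e_def is_interval_oo)
    moreover have "{p<..<r - e} \<subseteq> {p<..<b - e} \<union> {c<..<r - e}" using h by auto
    ultimately have "local_cond n k {p<..<r - e} F"
      unfolding local_cond_def by blast
    then have "nonneg_on K {p<..<r - e} F" using local[OF F] by (simp add: is_interval_oo)
    moreover have "fst ` set ws \<subseteq> {p<..<r - e}" using pts h(3) by force
    ultimately show ?case using ws(1) unfolding nonneg_on_def F_def by blast
  qed
  then have "0 \<le> weighted_sum ws g"
    by (intro tendsto_lowerbound[OF weighted_sum_steklov_tendsto[OF g]]) auto
  also have "weighted_sum ws g = weighted_sum ws f"
    using pts pr(3) by (intro weighted_sum_cong eq[symmetric]) force
  finally show "0 \<le> weighted_sum ws f" .
qed

text \<open>The functional \<open>f \<mapsto> c \<langle>f(M) x, x\<rangle>\<close> for \<open>M = \<Sum>\<^sub>j l\<^sub>j u\<^sub>j u\<^sub>j\<^sup>*\<close>.\<close>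

definition spectral_list :: "nat \<Rightarrow> real \<Rightarrow> (nat \<Rightarrow> real) \<Rightarrow> (nat \<Rightarrow> nat \<Rightarrow> complex) \<Rightarrow> (nat \<Rightarrow> complex) \<Rightarrow> (real \<times> real) list" where
  "spectral_list n c l u x = map (\<lambda>j. (l j, c * (cmod (inprod n x (u j)))\<^sup>2)) [0..<n]"

lemma weighted_sum_spectral_list:
  "spectral_dec n M l u \<Longrightarrow> weighted_sum (spectral_list n c l u x) f = c * fform n f M x"
  by (simp add: weighted_sum_def spectral_list_def fform_eq interv_sum_list_conv_sum_set_nat
      lessThan_atLeast0 sum_distrib_left mult_ac o_def)

lemma points_spectral_list [simp]: "fst ` set (spectral_list n c l u x) = l ` {..<n}"
  by (simp add: spectral_list_def image_image atLeast0LessThan)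

lemma spec_in_iff_image:
  assumes dec: "spectral_dec n M l u"
  shows "spec_in n M J \<longleftrightarrow> l ` {..<n} \<subseteq> J"
proof
  show "spec_in n M J \<Longrightarrow> l ` {..<n} \<subseteq> J" by (auto dest: spec_inD[OF _ dec])
  show "l ` {..<n} \<subseteq> J \<Longrightarrow> spec_in n M J" by (rule spec_inI[OF dec]) auto
qed

definition shift :: "(nat \<Rightarrow> nat \<Rightarrow> complex) \<Rightarrow> real \<Rightarrow> nat \<Rightarrow> nat \<Rightarrow> complex" where
  "shift M s i j = M i j + diagm (\<lambda>_. s) i j"

lemma spectral_dec_shift:
  assumes dec: "spectral_dec n M l u"
  shows "spectral_dec n (shift M s) (\<lambda>j. l j + s) u"
proof (rule spectral_decI)
  show "orthobasis n u" using dec by (simp add: spectral_dec_def)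
  fix i j assume ij: "i < n" "j < n"
  have "app n (shift M s) (u j) i = app n M (u j) i + app n (diagm (\<lambda>_. s)) (u j) i"
    by (simp add: app_def shift_def distrib_right sum.distrib)
  then show "app n (shift M s) (u j) i = of_real (l j + s) * u j i"
    using ij by (simp add: app_diagm spectral_dec_eigenvector[OF dec] distrib_right)
qed

lemma fform_scalar: "fform n f (diagm (\<lambda>_. s)) x = f s * sqnorm n x"
  by (simp add: fform_diagm sqnorm_def sum_distrib_left)

lemma hform_scalar: "hform n (diagm (\<lambda>_. s)) x = s * sqnorm n x"
  by (simp add: hform_eq_fform[OF herm_diagm] fform_scalar)

lemma hform_shift: "hform n (shift M s) x = hform n M x + s * sqnorm n x"
  unfolding shift_def[abs_def] hform_add hform_scalar ..

definition monotone_tests :: "nat \<Rightarrow> (real \<times> real) list set" where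
  "monotone_tests n = {spectral_list n 1 l' u' x @ spectral_list n (- 1) l u x | M M' l u l' u' x.
     spectral_dec n M l u \<and> spectral_dec n M' l' u' \<and> (\<forall>y. hform n M y \<le> hform n M' y)}"

definition convex_tests :: "nat \<Rightarrow> (real \<times> real) list set" where
  "convex_tests n =
     {spectral_list n t l u x @ spectral_list n (1 - t) l' u' x @ spectral_list n (- 1) l'' u'' x | M M' t l u l' u' l'' u'' x.
     t \<in> {0..1} \<and> spectral_dec n M l u \<and> spectral_dec n M' l' u' \<and>
     spectral_dec n (\<lambda>i j. of_real t * M i j + of_real (1 - t) * M' i j) l'' u''}"

lemma translate_spectral_list: "translate s (spectral_list n c l u x) = spectral_list n c (\<lambda>j. l j + s) u x"
  by (simp add: translate_def spectral_list_def)

lemma translate_append: "translate s (ws @ ws') = translate s ws @ translate s ws'"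
  by (simp add: translate_def)

lemma monotone_testsI:
  assumes "spectral_dec n M l u" "spectral_dec n M' l' u'" "\<And>y. hform n M y \<le> hform n M' y"
  shows "spectral_list n 1 l' u' x @ spectral_list n (- 1) l u x \<in> monotone_tests n"
  unfolding monotone_tests_def
  by (rule CollectI, intro exI conjI allI, rule refl) (fact assms)+

lemma convex_testsI:
  assumes "t \<in> {0..1}" "spectral_dec n M l u" "spectral_dec n M' l' u'"
    and "spectral_dec n (\<lambda>i j. of_real t * M i j + of_real (1 - t) * M' i j) l'' u''"
  shows "spectral_list n t l u x @ spectral_list n (1 - t) l' u' x @ spectral_list n (- 1) l'' u'' x \<in> convex_tests n"
  unfolding convex_tests_def
  by (rule CollectI, intro exI conjI, rule refl) (fact assms)+

lemma translate_monotone_tests: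
  assumes "ws \<in> monotone_tests n"
  shows "translate s ws \<in> monotone_tests n"
proof -
  obtain M M' l u l' u' x where ws: "ws = spectral_list n 1 l' u' x @ spectral_list n (- 1) l u x"
    and dec: "spectral_dec n M l u" "spectral_dec n M' l' u'" and le: "\<And>y. hform n M y \<le> hform n M' y"
    using assms unfolding monotone_tests_def by blast
  show ?thesis
    unfolding ws translate_append translate_spectral_list
    by (rule monotone_testsI[OF dec[THEN spectral_dec_shift]]) (simp add: hform_shift le)
qed

lemma translate_convex_tests:
  assumes "ws \<in> convex_tests n"
  shows "translate s ws \<in> convex_tests n"
proof -
  obtain M M' t l u l' u' l'' u'' x where
    ws: "ws = spectral_list n t l u x @ spectral_list n (1 - t) l' u' x @ spectral_list n (- 1) l'' u'' x"
    and t: "t \<in> {0..1}" and dec: "spectral_dec n M l u" "spectral_dec n M' l' u'"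
      "spectral_dec n (\<lambda>i j. of_real t * M i j + of_real (1 - t) * M' i j) l'' u''"
    using assms unfolding convex_tests_def by blast
  have "shift (\<lambda>i j. of_real t * M i j + of_real (1 - t) * M' i j) s
      = (\<lambda>i j. of_real t * shift M s i j + of_real (1 - t) * shift M' s i j)"
    by (simp add: fun_eq_iff shift_def algebra_simps)
  then show ?thesis
    unfolding ws translate_append translate_spectral_list
    using convex_testsI[OF t dec(1,2)[THEN spectral_dec_shift, of s]] dec(3)[THEN spectral_dec_shift, of s] by simp
qed

lemma n_monotone_iff_tests: "n_monotone n J f \<longleftrightarrow> nonneg_on (monotone_tests n) J f"
proof
  assume mono: "n_monotone n J f"
  show "nonneg_on (monotone_tests n) J f"
    unfolding nonneg_on_def
  proof (intro ballI impI)
    fix ws assume mem: "ws \<in> monotone_tests n" and pts: "fst ` set ws \<subseteq> J"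
    from mem obtain M M' l u l' u' x where ws: "ws = spectral_list n 1 l' u' x @ spectral_list n (- 1) l u x"
      and dec: "spectral_dec n M l u" "spectral_dec n M' l' u'" and le: "\<forall>y. hform n M y \<le> hform n M' y"
      unfolding monotone_tests_def by blast
    have "spec_in n M J" "spec_in n M' J"
      using pts dec by (simp_all add: ws image_Un spec_in_iff_image)
    then have "fform n f M x \<le> fform n f M' x"
      using mono[unfolded n_monotone_iff] le dec[THEN spectral_dec_herm] by blast
    then show "0 \<le> weighted_sum ws f"
      using dec by (simp add: ws weighted_sum_spectral_list)
  qed
next
  assume nn: "nonneg_on (monotone_tests n) J f"
  show "n_monotone n J f"
    unfolding n_monotone_iff
  proof (intro allI impI)
    fix M M' x
    assume M: "herm n M" "herm n M'" "spec_in n M J" "spec_in n M' J" "\<forall>x. hform n M x \<le> hform n M' x"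
    obtain l u l' u' where dec: "spectral_dec n M l u" "spectral_dec n M' l' u'"
      using spectral_dec_exists M(1,2) by metis
    have "spectral_list n 1 l' u' x @ spectral_list n (- 1) l u x \<in> monotone_tests n"
      using dec M(5) by (intro monotone_testsI) auto
    moreover have "fst ` set (spectral_list n 1 l' u' x @ spectral_list n (- 1) l u x) \<subseteq> J"
      using M(3,4) dec by (simp add: image_Un spec_in_iff_image)
    ultimately have "0 \<le> weighted_sum (spectral_list n 1 l' u' x @ spectral_list n (- 1) l u x) f"
      using nn unfolding nonneg_on_def by blast
    then show "fform n f M x \<le> fform n f M' x"
      using dec by (simp add: weighted_sum_spectral_list)
  qed
qed

text \<open>The functionals also use the eigenvalues of the convex combination, and these lie in \<open>J\<close>
  because \<open>J\<close> is an interval.\<close>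

lemma n_convex_iff_tests:
  assumes n: "n \<ge> 1" and J: "is_interval J"
  shows "n_convex n J f \<longleftrightarrow> nonneg_on (convex_tests n) J f"
proof
  assume conv: "n_convex n J f"
  show "nonneg_on (convex_tests n) J f"
    unfolding nonneg_on_def
  proof (intro ballI impI)
    fix ws assume mem: "ws \<in> convex_tests n" and pts: "fst ` set ws \<subseteq> J"
    from mem obtain M M' t l u l' u' l'' u'' x where
      ws: "ws = spectral_list n t l u x @ spectral_list n (1 - t) l' u' x @ spectral_list n (- 1) l'' u'' x"
      and t: "t \<in> {0..1}" and dec: "spectral_dec n M l u" "spectral_dec n M' l' u'"
        "spectral_dec n (\<lambda>i j. of_real t * M i j + of_real (1 - t) * M' i j) l'' u''"
      unfolding convex_tests_def by blast
    have "spec_in n M J" "spec_in n M' J"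
      using pts dec by (simp_all add: ws image_Un spec_in_iff_image)
    then have "fform n f (\<lambda>i j. of_real t * M i j + of_real (1 - t) * M' i j) x \<le> t * fform n f M x + (1 - t) * fform n f M' x"
      using conv[unfolded n_convex_iff] t dec[THEN spectral_dec_herm] by blast
    then show "0 \<le> weighted_sum ws f"
      using dec by (simp add: ws weighted_sum_spectral_list del: of_real_diff)
  qed
next
  assume nn: "nonneg_on (convex_tests n) J f"
  show "n_convex n J f"
    unfolding n_convex_iff
  proof (intro ballI allI impI)
    fix t :: real and M M' x
    assume t: "t \<in> {0..1}" and M: "herm n M" and M': "herm n M'" and s: "spec_in n M J" "spec_in n M' J"
    define C where "C = (\<lambda>i j. of_real t * M i j + of_real (1 - t) * M' i j)"
    obtain l u l' u' l'' u'' where dec: "spectral_dec n M l u" "spectral_dec n M' l' u'" "spectral_dec n C l'' u''"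
      using spectral_dec_exists[OF M] spectral_dec_exists[OF M']
        spectral_dec_exists[OF herm_combination[OF M M', of t "1 - t"]] unfolding C_def by blast
    define ws where "ws = spectral_list n t l u x @ spectral_list n (1 - t) l' u' x @ spectral_list n (- 1) l'' u'' x"
    have "ws \<in> convex_tests n"
      unfolding ws_def by (rule convex_testsI[OF t dec(1,2)]) (use dec(3) in \<open>simp only: C_def\<close>)
    moreover have "spec_in n C J"
      unfolding C_def using t by (intro spec_in_combination[OF n J M s(1) M' s(2)]) auto
    then have "fst ` set ws \<subseteq> J"
      using s dec by (simp add: ws_def image_Un spec_in_iff_image)
    ultimately have "0 \<le> weighted_sum ws f"
      using nn unfolding nonneg_on_def by blast
    then show "fform n f (\<lambda>i j. of_real t * M i j + of_real (1 - t) * M' i j) x \<le> t * fform n f M x + (1 - t) * fform n f M' x"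
      using dec unfolding C_def[symmetric] by (simp add: ws_def weighted_sum_spectral_list)
  qed
qed

section \<open>Continuity and the gluing theorem\<close>

lemma sqnorm_unit: "n \<ge> 1 \<Longrightarrow> sqnorm n (\<lambda>i. of_bool (i = 0)) = 1"
proof -
  assume n: "n \<ge> 1"
  have "sqnorm n (\<lambda>i. of_bool (i = 0)) = (\<Sum>i<n. if i = 0 then 1 else 0)"
    unfolding sqnorm_def by (rule sum.cong) auto
  then show ?thesis using n by simp
qed

lemma n_monotone_imp_mono_on:
  assumes n: "n \<ge> 1" and mono: "n_monotone n I f"
  shows "mono_on I f"
proof (rule mono_onI)
  fix s t assume st: "s \<in> I" "t \<in> I" "s \<le> t"
  have "fform n f (diagm (\<lambda>_. s)) x \<le> fform n f (diagm (\<lambda>_. t)) x" for x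
    using mono[unfolded n_monotone_iff] herm_diagm st
    by (simp add: spec_in_diagm hform_scalar mult_right_mono sqnorm_nonneg)
  from this[of "\<lambda>i. of_bool (i = 0)"] show "f s \<le> f t"
    by (simp add: fform_scalar sqnorm_unit[OF n])
qed

lemma n_convex_imp_convex_on:
  assumes n: "n \<ge> 1" and I: "convex I" and conv: "n_convex n I f"
  shows "convex_on I f"
proof (rule convex_onI)
  fix t s r :: real assume t: "0 < t" "t < 1" and sr: "s \<in> I" "r \<in> I"
  have c: "(\<lambda>i j. of_real (1 - t) * diagm (\<lambda>_. s) i j + of_real (1 - (1 - t)) * diagm (\<lambda>_. r) i j) = diagm (\<lambda>_. (1 - t) * s + t * r)"
    by (auto simp: fun_eq_iff diagm_def)
  have "fform n f (diagm (\<lambda>_. (1 - t) * s + t * r)) x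
      \<le> (1 - t) * fform n f (diagm (\<lambda>_. s)) x + (1 - (1 - t)) * fform n f (diagm (\<lambda>_. r)) x" for x
  proof -
    have "1 - t \<in> {0..1}" using t by simp
    moreover have "spec_in n (diagm (\<lambda>_. s)) I" "spec_in n (diagm (\<lambda>_. r)) I" using sr by (auto simp: spec_in_diagm)
    ultimately show ?thesis
      using conv[unfolded n_convex_iff] herm_diagm unfolding c[symmetric] by blast
  qed
  from this[of "\<lambda>i. of_bool (i = 0)"] show "f ((1 - t) *\<^sub>R s + t *\<^sub>R r) \<le> (1 - t) * f s + t * f r"
    by (simp add: fform_scalar sqnorm_unit[OF n])
qed (fact I)

text \<open>In the first two coordinates the test matrices are \<open>x0 + s diag(1, -11)\<close> and \<open>x0 + s B\<close> with
  \<open>B\<close> having rows \<open>(3, 4)\<close> and \<open>(4, -3)\<close>. Their difference is \<open>2 s z z\<^sup>*\<close> with \<open>z = (1, 2)\<close>, and the vector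
  \<open>(1, -2)\<close> is an eigenvector of \<open>B\<close> for the eigenvalue \<open>-5\<close>. Evaluating both forms at this vector gives
  the inequality. It excludes jumps, since the points on its right lie left of \<open>x0\<close>.\<close>

lemma two_monotone_inequality:
  assumes n: "n \<ge> 2" and J: "open J" and mono: "n_monotone n J f" and x0: "x0 \<in> J"
  shows "\<forall>\<^sub>F s in at_right 0. f (x0 + s) + 4 * f (x0 - 11 * s) \<le> 5 * f (x0 - 5 * s)"
proof -
  define g where "g = (\<lambda>s (i::nat). if i = 1 then x0 - 11 * s else x0 + s)"
  define z where "z = (\<lambda>s (i::nat). complex_of_real (if i = 0 then sqrt (2 * s) else if i = 1 then 2 * sqrt (2 * s) else 0))"
  define x where "x = (\<lambda>i::nat. if i = 0 then 1 else if i = 1 then -2 else (0::complex))"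
  have split: "(\<Sum>i<n. u i) = u 0 + u 1 + (\<Sum>i\<in>{2..<n}. u i)" for u :: "nat \<Rightarrow> 'a::comm_monoid_add"
  proof -
    have "{..<n} = insert 0 (insert 1 {2..<n})" using n by auto
    then show ?thesis by (simp add: add.assoc)
  qed
  have lim_g: "((\<lambda>s. diagm (g s) i j) \<longlongrightarrow> diagm (\<lambda>_. x0) i j) (at_right 0)" for i j
  proof -
    have "((\<lambda>s. complex_of_real (x0 - 11 * s)) \<longlongrightarrow> of_real (x0 - 11 * 0)) (at_right 0)"
      "((\<lambda>s. complex_of_real (x0 + s)) \<longlongrightarrow> of_real (x0 + 0)) (at_right 0)"
      by (intro tendsto_intros)+
    then have "((\<lambda>s. complex_of_real (g s i)) \<longlongrightarrow> of_real x0) (at_right 0)"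
      unfolding g_def by (cases "i = 1") simp_all
    then show ?thesis by (auto simp: diagm_def)
  qed
  have lim_r: "((\<lambda>s. rank1 (g s) (z s) i j) \<longlongrightarrow> diagm (\<lambda>_. x0) i j) (at_right 0)" for i j
  proof -
    have z: "((\<lambda>s. z s i) \<longlongrightarrow> 0) (at_right 0)" for i
    proof -
      have "((\<lambda>s. complex_of_real (sqrt (2 * s))) \<longlongrightarrow> of_real (sqrt (2 * 0))) (at_right 0)"
        "((\<lambda>s. complex_of_real (2 * sqrt (2 * s))) \<longlongrightarrow> of_real (2 * sqrt (2 * 0))) (at_right 0)"
        by (intro tendsto_intros)+
      then show ?thesis
        by (cases "i = 0"; cases "i = 1") (simp_all add: z_def)
    qed
    have "((\<lambda>s. rank1 (g s) (z s) i j) \<longlongrightarrow> diagm (\<lambda>_. x0) i j + 0 * cnj 0) (at_right 0)"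
      unfolding rank1_def by (intro tendsto_add tendsto_mult tendsto_cnj lim_g z)
    then show ?thesis by simp
  qed
  have sp: "spec_in n (diagm (\<lambda>_. x0)) J" using x0 by (simp add: spec_in_diagm)
  have "\<forall>\<^sub>F s in at_right (0::real). s > 0" by (simp add: eventually_at_right_less)
  with spec_in_eventually[OF herm_diagm J sp lim_g] spec_in_eventually[OF herm_diagm J sp lim_r]
  show ?thesis
  proof eventually_elim
    case (elim s)
    have "fform n f (diagm (g s)) x \<le> fform n f (rank1 (g s) (z s)) x"
      using mono[unfolded n_monotone_iff] herm_diagm herm_rank1 elim(1,2) hform_diagm_le_rank1 by blast
    moreover have "fform n f (diagm (g s)) x = f (x0 + s) + 4 * f (x0 - 11 * s)"
      unfolding fform_diagm split by (simp add: g_def x_def)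
    moreover have "fform n f (rank1 (g s) (z s)) x = f (x0 - 5 * s) * sqnorm n x"
    proof (rule fform_eigenvector[OF herm_rank1])
      fix i assume i: "i < n"
      have sq: "complex_of_real (sqrt (2 * s)) * of_real (sqrt (2 * s)) = of_real (2 * s)"
        unfolding of_real_mult[symmetric] using elim(3) by simp
      have "inprod n x (z s) = - 3 * of_real (sqrt (2 * s))"
        unfolding inprod_def split by (simp add: x_def z_def)
      then show "app n (rank1 (g s) (z s)) x i = of_real (x0 - 5 * s) * x i"
        using sq by (auto simp: app_rank1[OF i] g_def x_def z_def algebra_simps)
    qed
    moreover have "sqnorm n x = 5"
      unfolding sqnorm_def split by (simp add: x_def)
    ultimately show ?case by simp
  qed
qed

text \<open>With \<open>L\<close> the left limit of \<open>f\<close> at \<open>x0\<close>, the inequality above bounds \<open>f(x0 + s)\<close> by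
  \<open>5 L - 4 (L - \<epsilon>)\<close> for small \<open>s\<close>, so the right limit does not exceed the left one.\<close>

lemma n_monotone_imp_continuous:
  assumes n: "n \<ge> 2" and J: "open J" and mono: "n_monotone n J f"
  shows "continuous_on J f"
proof -
  have m: "mono_on J f" using n_monotone_imp_mono_on[OF _ mono] n by simp
  have "isCont f x0" if x0: "x0 \<in> J" for x0
    unfolding continuous_at_real_range real_norm_def
  proof (intro allI impI)
    fix e :: real assume e: "e > 0"
    obtain r where r: "r > 0" "ball x0 r \<subseteq> J" using J x0 openE by blast
    have inJ: "t \<in> J" if "\<bar>t - x0\<bar> < r" for t using r(2) that by (auto simp: dist_real_def abs_minus_commute)
    define L where "L = Sup (f ` {x0 - r<..<x0})"
    have ne: "f ` {x0 - r<..<x0} \<noteq> {}" using r(1) by auto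
    have le: "f s \<le> f t" if "s \<le> t" "\<bar>s - x0\<bar> < r" "\<bar>t - x0\<bar> < r" for s t
      using mono_onD[OF m inJ[OF that(2)] inJ[OF that(3)] that(1)] .
    have bdd: "bdd_above (f ` {x0 - r<..<x0})"
      by (rule bdd_aboveI[of _ "f x0"]) (use le r(1) in auto)
    have upper: "f t \<le> L" if "x0 - r < t" "t < x0" for t
      unfolding L_def using bdd that by (intro cSup_upper) auto
    have "L - e / 5 < L" using e by simp
    then obtain t0 where t0: "x0 - r < t0" "t0 < x0" "L - e / 5 < f t0"
      unfolding L_def using less_cSup_iff[OF ne bdd] by auto
    have near: "L - e / 5 < f t" if "t0 \<le> t" "t < x0" for t
      using le[of t0 t] t0 that by auto
    \<comment> \<open>small enough that \<open>x0 - 11 s\<close> stays in the range where \<open>f\<close> is close to its left limit\<close>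
    have "\<forall>\<^sub>F s in at_right (0::real). s \<in> {0<..<min (r / 2) ((x0 - t0) / 11)}"
      using r(1) t0(2) by (intro eventually_at_rightI[of 0 "min (r / 2) ((x0 - t0) / 11)"]) auto
    from eventually_happens'[OF _ eventually_conj[OF two_monotone_inequality[OF n J mono x0] this]]
    obtain s where s: "f (x0 + s) + 4 * f (x0 - 11 * s) \<le> 5 * f (x0 - 5 * s)" "0 < s" "s < r / 2" "s < (x0 - t0) / 11"
      by auto
    have "f (x0 - 5 * s) \<le> L" "L - e / 5 < f (x0 - 11 * s)"
      using s t0 by (auto intro!: upper near)
    then have right: "f (x0 + s) < L + 4 / 5 * e" using s(1) by linarith
    have "L \<le> f x0" unfolding L_def by (rule cSup_least[OF ne]) (use le r(1) in auto)
    have "\<bar>f t - f x0\<bar> < e" if t: "\<bar>t - x0\<bar> < min s (x0 - t0)" for t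
    proof (cases "t < x0")
      case True
      have "L - e / 5 < f t" using near[of t] True t by auto
      moreover have "f t \<le> f x0" using le[of t x0] True t s r(1) by auto
      moreover have "f x0 \<le> f (x0 + s)" using le[of x0 "x0 + s"] s r(1) by auto
      ultimately show ?thesis using right by linarith
    next
      case False
      have "f x0 \<le> f t" using le[of x0 t] False t s r(1) by auto
      moreover have "f t \<le> f (x0 + s)" using le[of t "x0 + s"] t s r(1) False by auto
      ultimately show ?thesis using right \<open>L \<le> f x0\<close> e by linarith
    qed
    then show "\<exists>d>0. \<forall>x'. \<bar>x' - x0\<bar> < d \<longrightarrow> \<bar>f x' - f x0\<bar> < e"
      using s(2) t0(2) by (intro exI[of _ "min s (x0 - t0)"]) auto
  qed
  then show ?thesis by (simp add: continuous_at_imp_continuous_on)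
qed

lemma one_monotone_iff: "n_monotone 1 I f \<longleftrightarrow> mono_on I f"
proof
  assume m: "mono_on I f"
  show "n_monotone 1 I f"
    unfolding n_monotone_iff
  proof (intro allI impI)
    fix M M' x
    assume M: "herm 1 M" and M': "herm 1 M'" and sM: "spec_in 1 M I" and sM': "spec_in 1 M' I"
      and le: "\<forall>x. hform 1 M x \<le> hform 1 M' x"
    have eq: "\<exists>s. fform 1 f M x = f s * sqnorm 1 x \<and> hform 1 M (\<lambda>_. 1) = s \<and> s \<in> I"
      if M: "herm 1 M" "spec_in 1 M I" for M f
    proof -
      obtain l u where dec: "spectral_dec 1 M l u" using spectral_dec_exists[OF M(1)] by blast
      have "(cmod (inprod 1 y (u 0)))\<^sup>2 = sqnorm 1 y" for y
        using spectral_dec_parseval[OF dec, of y] by simp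
      then show ?thesis
        using spec_inD[OF M(2) dec, of 0] unfolding fform_eq[OF dec] hform_eq[OF dec]
        by (intro exI[of _ "l 0"]) (simp add: sqnorm_def)
    qed
    obtain s s' where "fform 1 f M x = f s * sqnorm 1 x" "hform 1 M (\<lambda>_. 1) = s" "s \<in> I"
      "fform 1 f M' x = f s' * sqnorm 1 x" "hform 1 M' (\<lambda>_. 1) = s'" "s' \<in> I"
      using eq[OF M sM] eq[OF M' sM'] by blast
    note ss = this
    have "s \<le> s'" using le ss(2,5) by blast
    then have "f s \<le> f s'" using mono_onD[OF m ss(3,6)] by blast
    then show "fform 1 f M x \<le> fform 1 f M' x"
      unfolding ss(1,4) by (rule mult_right_mono) (rule sqnorm_nonneg)
  qed
qed (rule n_monotone_imp_mono_on[OF order_refl])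

lemma mono_on_glue:
  fixes f :: "real \<Rightarrow> real"
  assumes "c < b" and f: "mono_on {a<..<b} f" and g: "mono_on {c<..<d} f"
  shows "mono_on {a<..<d} f"
proof (rule mono_onI)
  fix s t assume st: "s \<in> {a<..<d}" "t \<in> {a<..<d}" "s \<le> t"
  define m where "m = (b + c) / 2"
  have m: "c < m" "m < b" using assms(1) by (auto simp: m_def)
  consider "t < b" | "c < s" | "b \<le> t" "s \<le> c" by linarith
  then show "f s \<le> f t"
  proof cases
    case 3
    have "f s \<le> f m" using mono_onD[OF f, of s m] st m 3 by auto
    also have "f m \<le> f t" using mono_onD[OF g, of m t] st m 3 by auto
    finally show ?thesis .
  qed (use mono_onD[OF f, of s t] mono_onD[OF g, of s t] st in auto)
qed

theorem corollary1p5: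
  fixes a b c d :: real and n :: nat and f :: "real \<Rightarrow> real"
  assumes "a < c" and "c < b" and "b < d" and "n \<ge> 1"
  shows "(n_monotone n {a<..<b} f \<and> n_monotone n {c<..<d} f \<longrightarrow> n_monotone n {a<..<d} f) \<and>
         (n_convex n {a<..<b} f \<and> n_convex n {c<..<d} f \<longrightarrow> n_convex n {a<..<d} f)"
proof -
  have union: "{a<..<d} = {a<..<b} \<union> {c<..<d}" using assms by auto
  show ?thesis
  proof (intro conjI impI; elim conjE)
    assume m: "n_monotone n {a<..<b} f" "n_monotone n {c<..<d} f"
    show "n_monotone n {a<..<d} f"
    proof (cases "n = 1")
      case True
      then show ?thesis using m mono_on_glue[OF assms(2)] by (simp only: one_monotone_iff)
    next
      case False
      then have n: "n \<ge> 2" using assms(4) by simp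
      have cont: "continuous_on {a<..<d} f"
        unfolding union using n_monotone_imp_continuous[OF n _ m(1)] n_monotone_imp_continuous[OF n _ m(2)]
        by (intro continuous_on_open_Un) auto
      have "nonneg_on (monotone_tests n) J F \<longleftrightarrow> local_cond n (2 * n - 1) J F"
        if "Ck (2 * n - 1) F" "open J" "is_interval J" for F J
        using n_monotone_imp_local_cond[OF that(1) assms(4) that(2)]
          local_cond_imp_n_monotone[OF that(1) assms(4) that(2,3)]
        unfolding n_monotone_iff_tests by blast
      from nonneg_on_glue[OF assms(1-3) translate_monotone_tests this cont] show ?thesis
        using m unfolding n_monotone_iff_tests by blast
    qed
  next
    assume m: "n_convex n {a<..<b} f" "n_convex n {c<..<d} f"
    have cont: "continuous_on {a<..<d} f"
      unfolding union
      using convex_on_continuous[OF _ n_convex_imp_convex_on[OF assms(4) _ m(1)]]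
        convex_on_continuous[OF _ n_convex_imp_convex_on[OF assms(4) _ m(2)]]
      by (intro continuous_on_open_Un) auto
    have "nonneg_on (convex_tests n) J F \<longleftrightarrow> local_cond n (2 * n) J F"
      if "Ck (2 * n) F" "open J" "is_interval J" for F J
      using n_convex_imp_local_cond[OF that(1) assms(4) that(2)]
        local_cond_imp_n_convex[OF that(1) assms(4) that(2,3)]
      unfolding n_convex_iff_tests[OF assms(4) that(3)] by blast
    from nonneg_on_glue[OF assms(1-3) translate_convex_tests this cont] show "n_convex n {a<..<d} f"
      using m unfolding n_convex_iff_tests[OF assms(4) is_interval_oo] by blast
  qed
qed

end
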